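(* Let $W$ and $W'$ be Coxeter groups with $\widehat W\cong\widehat{W'}$. Then $W$ and $W'$ have the same number of ends.
   Context: The number of ends of a finitely generated group is the number of ends of any of its Cayley graphs with respect to a finite generating set (it is $0,1,2$ or $\infty$). Coxeter groups are $W_\Gamma=\langle V(\Gamma)\mid v^2,\ (vw)^{m(\{v,w\})}\text{ for }\{v,w\}\in E(\Gamma)\rangle$ for a finite simplicial graph $\Gamma$ with labels in $\mathbb{N}_{\ge2}$; $\widehat{G}$ is profinite completion. *)

theory Defs
  imports "HOL-Analysis.Analysis" "HOL-Algebra.Algebra" "HOL-Library.Extended_Nat"
begin

definition coxeter_graph :: "'v set \<Rightarrow> 'v set set \<Rightarrow> ('v set \<Rightarrow> nat) \<Rightarrow> bool" where
  "coxeter_graph V E m \<longleftrightarrow> finite V \<and>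
     (\<forall>e\<in>E. \<exists>v w. v \<in> V \<and> w \<in> V \<and> v \<noteq> w \<and> e = {v, w}) \<and>
     (\<forall>e\<in>E. m e \<ge> 2)"

text \<open>Relators v^2 and (vw)^{m({v,w})} as words over V (all generators are involutions,
  so words in V suffice).\<close>
definition coxeter_relators :: "'v set \<Rightarrow> 'v set set \<Rightarrow> ('v set \<Rightarrow> nat) \<Rightarrow> 'v list set" where
  "coxeter_relators V E m =
     {[v, v] | v. v \<in> V} \<union>
     {concat (replicate (m {v, w}) [v, w]) | v w. {v, w} \<in> E \<and> v \<noteq> w}"

inductive word_eq :: "'v list set \<Rightarrow> 'v list \<Rightarrow> 'v list \<Rightarrow> bool" for R where
  refl: "word_eq R x x"
| sym: "word_eq R x y \<Longrightarrow> word_eq R y x"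
| trans: "word_eq R x y \<Longrightarrow> word_eq R y z \<Longrightarrow> word_eq R x z"
| rel: "r \<in> R \<Longrightarrow> word_eq R (u @ r @ w) (u @ w)"

definition word_class :: "'v set \<Rightarrow> 'v list set \<Rightarrow> 'v list \<Rightarrow> 'v list set" where
  "word_class V R x = {y \<in> lists V. word_eq R x y}"

definition coxeter_group :: "'v set \<Rightarrow> 'v set set \<Rightarrow> ('v set \<Rightarrow> nat) \<Rightarrow> 'v list set monoid" where
  "coxeter_group V E m =
     (let R = coxeter_relators V E m in
      \<lparr> carrier = word_class V R ` lists V,
        mult = (\<lambda>A B. word_class V R ((SOME x. x \<in> A) @ (SOME y. y \<in> B))),
        one = word_class V R [] \<rparr>)"

definition ecard :: "'a set \<Rightarrow> enat" where
  "ecard A = (if finite A then enat (card A) else \<infinity>)"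

definition cayley_edges :: "('a, 'b) monoid_scheme \<Rightarrow> 'a set \<Rightarrow> ('a \<times> 'a) set" where
  "cayley_edges G S = {(x, y). x \<in> carrier G \<and> y \<in> carrier G \<and>
      (\<exists>s\<in>S. y = x \<otimes>\<^bsub>G\<^esub> s \<or> x = y \<otimes>\<^bsub>G\<^esub> s)}"

definition cayley_components :: "('a, 'b) monoid_scheme \<Rightarrow> 'a set \<Rightarrow> 'a set \<Rightarrow> 'a set set" where
  "cayley_components G S K =
     (let Ed = {(x, y) \<in> cayley_edges G S. x \<notin> K \<and> y \<notin> K} in
      {C. \<exists>x \<in> carrier G - K. C = {y. (x, y) \<in> Ed\<^sup>*}})"

definition ends_wrt :: "('a, 'b) monoid_scheme \<Rightarrow> 'a set \<Rightarrow> enat" where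
  "ends_wrt G S = (SUP K \<in> {K. finite K \<and> K \<subseteq> carrier G}.
      ecard {C \<in> cayley_components G S K. infinite C})"

text \<open>Number of ends of a finitely generated group: computed on the Cayley graph of
  some finite generating set (independent of the choice).\<close>
definition group_ends :: "('a, 'b) monoid_scheme \<Rightarrow> enat" where
  "group_ends G = ends_wrt G (SOME S. finite S \<and> S \<subseteq> carrier G \<and> generate G S = carrier G)"

definition fin_normal :: "('a, 'b) monoid_scheme \<Rightarrow> 'a set set" where
  "fin_normal G = {N. N \<lhd> G \<and> finite (carrier (G Mod N))}"

definition profinite_completion :: "('a, 'b) monoid_scheme \<Rightarrow> ('a set \<Rightarrow> 'a set) monoid" where
  "profinite_completion G =
     \<lparr> carrier = {f. (\<forall>N \<in> fin_normal G. f N \<in> carrier (G Mod N)) \<and>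
                     (\<forall>N. N \<notin> fin_normal G \<longrightarrow> f N = undefined) \<and>
                     (\<forall>N \<in> fin_normal G. \<forall>M \<in> fin_normal G. N \<subseteq> M \<longrightarrow> f N \<subseteq> f M)},
       mult = (\<lambda>f g. \<lambda>N. if N \<in> fin_normal G then f N <#>\<^bsub>G\<^esub> g N else undefined),
       one = (\<lambda>N. if N \<in> fin_normal G then N else undefined) \<rparr>"

text \<open>Profinite topology: subspace of the product of the discrete finite quotients.\<close>
definition profinite_topology :: "('a, 'b) monoid_scheme \<Rightarrow> ('a set \<Rightarrow> 'a set) topology" where
  "profinite_topology G = topology (\<lambda>U. U \<subseteq> carrier (profinite_completion G) \<and>
      (\<forall>f \<in> U. \<exists>N \<in> fin_normal G.
          {g \<in> carrier (profinite_completion G). g N = f N} \<subseteq> U))"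

definition profinite_iso :: "('a, 'b) monoid_scheme \<Rightarrow> ('c, 'd) monoid_scheme \<Rightarrow> bool" where
  "profinite_iso G H \<longleftrightarrow> (\<exists>\<phi>. \<phi> \<in> iso (profinite_completion G) (profinite_completion H) \<and>
      homeomorphic_map (profinite_topology G) (profinite_topology H) \<phi>)"

end

theory Submission
  imports Defs "HOL-Number_Theory.Cong"
begin

text \<open>If W splits over a finite special subgroup C as an amalgam of A and B, its profinite completion acts on a profinite
  tree, the inverse limit of finite coset graphs. Dually, every C-invariant function factoring through a finite
  quotient is the difference of an A-invariant and a B-invariant one, also modulo p. A trace argument modulo p then
  shows by induction that finite groups generated by successive steps of prime order have nonempty connected fixed
  sets. Suppose that the completion is also that of a Coxeter group W' whose graph is not disconnected by any finite
  special subgroup. The fixed subtrees of the generators of W' then have a common vertex, so the closure of A or of B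
  is everything; this is refuted by congruence quotients of the reflection representation. Hence splittings over
  finite special subgroups are visible in the profinite completion.

  Without such a splitting an infinite W is one-ended, because a word can be moved around the polygon of a finite
  dihedral coset while staying outside of a given ball. With a splitting, there are two ends if some law
  [x^n, y^n] = 1 holds and infinitely many otherwise, and residual finiteness makes this law a profinite property.\<close>


section \<open>Fixed points in inverse systems of coset graphs\<close>

text \<open>The coset graph of one finite quotient is connected but may have cycles, and an element
  may fix a vertex there without fixing anything in the limit. Limit points are never formed: every
  statement about the profinite tree concerns functions on some finite level and may have to pass to
  a finer one, hence the quantifiers \<open>\<exists>M\<in>NN. M \<subseteq> N\<close>. Acyclicity
  is the solvability of f = fA - fB modulo p, because over the integers the two parts of a periodic
  f need not be periodic. The fixed point statements are analogues of Smith theory for groups of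
  order p. Several generators of W' need not generate a finite group, so they have no common fixed
  vertex for trivial reasons; only pairs joined by an edge do. Connectedness of the graph without
  the generators that fix a given edge takes the place of a Helly argument, and residual finiteness
  of W' ensures that, at a fine enough level, the generators removed generate a finite group. The
  coefficients of the reflections are not rational in general, so congruences are taken in a
  finitely generated additive group spanned by cosines.\<close>

lemma funpow_mult_fix: "(\<pi> ^^ k) x = x \<Longrightarrow> (\<pi> ^^ (k * a)) x = x"
  by (induction a) (auto simp: funpow_add algebra_simps)

text \<open>A point moved by \<pi> has an orbit of exactly p elements: if the i-th and j-th iterates
  agree for i < j < p, then j - i is invertible modulo p, and a Bezout identity makes \<pi> itself
  fix the i-th iterate. One chosen representative per orbit is then met at exactly one
  exponent.\<close>

lemma transversal_prime_perm:
  fixes \<pi> :: "'a \<Rightarrow> 'a" and p :: nat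
  assumes p: "Factorial_Ring.prime p" and closed: "\<And>x. x \<in> \<Omega> \<Longrightarrow> \<pi> x \<in> \<Omega>"
    and per: "\<And>x. x \<in> \<Omega> \<Longrightarrow> (\<pi> ^^ p) x = x" and nofix: "\<And>x. x \<in> \<Omega> \<Longrightarrow> \<pi> x \<noteq> x"
  shows "\<exists>D\<subseteq>\<Omega>. \<forall>x\<in>\<Omega>. \<exists>!i. i < p \<and> (\<pi> ^^ i) x \<in> D"
proof -
  define orb where "orb x = {(\<pi> ^^ i) x | i. True}" for x
  define rep where "rep S = (SOME y. y \<in> S)" for S :: "'a set"
  define D where "D = {rep (orb x) | x. x \<in> \<Omega>}"
  have p0: "p > 0" using p prime_gt_0_nat by blast
  have pw: "(\<pi> ^^ i) x \<in> \<Omega>" if "x \<in> \<Omega>" for i x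
    using that by (induction i) (auto intro: closed)
  have self: "x \<in> orb x" for x unfolding orb_def by (auto intro: exI[of _ 0])
  have orbmod: "(\<pi> ^^ i) x = (\<pi> ^^ (i mod p)) x" if "x \<in> \<Omega>" for i x
  proof -
    have "(\<pi> ^^ i) x = (\<pi> ^^ (i mod p + p * (i div p))) x" by simp
    also have "\<dots> = (\<pi> ^^ (i mod p)) ((\<pi> ^^ (p * (i div p))) x)" by (simp only: funpow_add o_apply)
    also have "(\<pi> ^^ (p * (i div p))) x = x" by (rule funpow_mult_fix) (rule per[OF that])
    finally show ?thesis .
  qed
  have orbeq: "orb ((\<pi> ^^ i) x) = orb x" if "x \<in> \<Omega>" for i x
  proof
    show "orb ((\<pi> ^^ i) x) \<subseteq> orb x"
    proof
      fix y assume "y \<in> orb ((\<pi> ^^ i) x)"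
      then obtain j where "y = (\<pi> ^^ j) ((\<pi> ^^ i) x)" unfolding orb_def by auto
      then have "y = (\<pi> ^^ (j + i)) x" unfolding funpow_add o_apply .
      then show "y \<in> orb x" unfolding orb_def by blast
    qed
    show "orb x \<subseteq> orb ((\<pi> ^^ i) x)"
    proof
      fix y assume "y \<in> orb x"
      then obtain j where j: "y = (\<pi> ^^ j) x" unfolding orb_def by auto
      \<comment> \<open>The p * i extra steps change nothing at x and make the natural number j + p
        * i - i an honest difference.\<close>
      have "y = (\<pi> ^^ (j + p * i)) x"
        unfolding funpow_add o_apply j funpow_mult_fix[OF per[OF that]] ..
      also have "j + p * i = (j + p * i - i) + i" using p0 by (cases p) auto
      finally have "y = (\<pi> ^^ (j + p * i - i)) ((\<pi> ^^ i) x)"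
        unfolding funpow_add o_apply .
      then show "y \<in> orb ((\<pi> ^^ i) x)" unfolding orb_def by blast
    qed
  qed
  have rep: "rep (orb x) \<in> orb x" for x
    unfolding rep_def by (rule someI[of _ x]) (rule self)
  have orbsub: "y \<in> \<Omega> \<and> orb y = orb x" if xy: "x \<in> \<Omega>" "y \<in> orb x" for x y
  proof -
    obtain i where "y = (\<pi> ^^ i) x" using xy(2) unfolding orb_def by auto
    then show ?thesis using xy(1) pw orbeq by simp
  qed
  have DO: "D \<subseteq> \<Omega>" unfolding D_def using rep orbsub by blast
  have DD: "y = rep (orb y)" if y: "y \<in> D" for y
  proof -
    obtain x where x: "x \<in> \<Omega>" "y = rep (orb x)" using y unfolding D_def by auto
    then have "orb y = orb x" using orbsub[OF x(1) rep] by simp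
    then show ?thesis using x by simp
  qed
  have "\<exists>!i. i < p \<and> (\<pi> ^^ i) x \<in> D" if x: "x \<in> \<Omega>" for x
  proof (rule ex_ex1I)
    obtain i where i: "rep (orb x) = (\<pi> ^^ i) x" using rep[of x] unfolding orb_def by auto
    have "(\<pi> ^^ (i mod p)) x \<in> D" unfolding D_def orbmod[OF x, of i, symmetric] i[symmetric] using x by blast
    then show "\<exists>i. i < p \<and> (\<pi> ^^ i) x \<in> D" using p0 by (intro exI[of _ "i mod p"]) auto
  next
    have key: False if ij: "i < j" "j < p" "(\<pi> ^^ i) x \<in> D" "(\<pi> ^^ j) x \<in> D" for i j
    proof -
      have e: "(\<pi> ^^ i) x = (\<pi> ^^ j) x" using DD[OF ij(3)] DD[OF ij(4)] unfolding orbeq[OF x] by simp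
      define z where "z = (\<pi> ^^ i) x"
      have z: "z \<in> \<Omega>" unfolding z_def using pw x by blast
      have "(\<pi> ^^ (j - i)) z = (\<pi> ^^ ((j - i) + i)) x" unfolding z_def funpow_add o_apply ..
      also have "(j - i) + i = j" using ij by simp
      finally have kz: "(\<pi> ^^ (j - i)) z = z" using e unfolding z_def by simp
      have "\<not> p dvd (j - i)" using ij by (auto dest: dvd_imp_le)
      then have "coprime (j - i) p" using p by (metis coprime_commute prime_imp_coprime)
      then obtain a b where ab: "(j - i) * a = p * b + 1"
        using coprime_bezout_strong[of "j - i" p] prime_gt_1_nat[OF p] by auto
      have "z = (\<pi> ^^ ((j - i) * a)) z" using funpow_mult_fix[OF kz] by simp
      also have "\<dots> = \<pi> z" unfolding ab using funpow_mult_fix[OF per[OF z], of b] by simp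
      finally show False using nofix[OF z] by simp
    qed
    fix i j assume "i < p \<and> (\<pi> ^^ i) x \<in> D" "j < p \<and> (\<pi> ^^ j) x \<in> D"
    then show "i = j" using key[of i j] key[of j i] by (cases i j rule: linorder_cases) auto
  qed
  then show ?thesis using DO by (intro exI[of _ D] conjI ballI)
qed

section \<open>Fixed cosets and functions on finite levels\<close>

context group
begin

text \<open>A vertex or edge at level N is a coset of \<open>S <#> N\<close>; left multiplication by
  h fixes the coset of x exactly if inv x h x lies in \<open>S <#> N\<close>. Group elements stand
  for their cosets, so that different levels can be compared as subsets of one carrier.\<close>

definition fix_set :: "'a set \<Rightarrow> 'a set \<Rightarrow> 'a set \<Rightarrow> 'a set" where
  "fix_set S N H = {x \<in> carrier G. \<forall>h\<in>H. inv x \<otimes> h \<otimes> x \<in> S <#> N}"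

definition right_inv :: "'a set \<Rightarrow> ('a \<Rightarrow> 'c) \<Rightarrow> bool" where
  "right_inv Y f \<longleftrightarrow> (\<forall>x\<in>carrier G. \<forall>y\<in>Y. f (x \<otimes> y) = f x)"

text \<open>Such functions live on the cosets of S in the finite quotient by N.\<close>

definition level_fun :: "'a set \<Rightarrow> 'a set \<Rightarrow> ('a \<Rightarrow> 'c) \<Rightarrow> bool" where
  "level_fun S N f \<longleftrightarrow> right_inv S f \<and> right_inv N f"

lemma level_fun_mono: "level_fun S N f \<Longrightarrow> N' \<subseteq> N \<Longrightarrow> level_fun S N' f"
  unfolding level_fun_def right_inv_def by blast

lemma level_fun_comp1: "level_fun S N f \<Longrightarrow> level_fun S N (\<lambda>x. u (f x))"
  unfolding level_fun_def right_inv_def by auto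

lemma level_fun_comp2: "level_fun S N f \<Longrightarrow> level_fun S N g \<Longrightarrow> level_fun S N (\<lambda>x. u (f x) (g x))"
  unfolding level_fun_def right_inv_def by auto

lemma level_fun_left:
  assumes "subgroup S G" "N \<lhd> G" "g \<in> carrier G" "level_fun S N f"
  shows "level_fun S N (\<lambda>x. f (g \<otimes> x))"
proof -
  have "S \<subseteq> carrier G" "N \<subseteq> carrier G"
    using assms subgroup.subset normal_imp_subgroup by blast+
  then show ?thesis using assms(3,4) unfolding level_fun_def right_inv_def
    by (metis m_assoc m_closed subsetD)
qed

lemma setmult_subgroup:
  assumes "subgroup S G" "N \<lhd> G" shows "subgroup (S <#> N) G"
proof -
  have "second_isomorphism_grp N G S"
    using assms by (simp add: second_isomorphism_grp_def second_isomorphism_grp_axioms_def)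
  from second_isomorphism_grp.normal_set_mult_subgroup[OF this]
  show ?thesis unfolding commut_normal[OF assms] .
qed

lemma level_fun_mult:
  assumes "subgroup S G" "N \<lhd> G" "level_fun S N f" "x \<in> carrier G" "y \<in> S <#> N"
  shows "f (x \<otimes> y) = f x"
proof -
  obtain a n where an: "a \<in> S" "n \<in> N" "y = a \<otimes> n" using assms(5) unfolding set_mult_def by auto
  have c: "a \<in> carrier G" "n \<in> carrier G" 
    using an assms(1,2) subgroup.subset normal_imp_subgroup by blast+
  have "f (x \<otimes> y) = f ((x \<otimes> a) \<otimes> n)" using an c assms(4) by (simp add: m_assoc)
  also have "\<dots> = f x" using assms(3,4) an c unfolding level_fun_def right_inv_def by simp
  finally show ?thesis .
qed

lemma fix_set_level_fun:
  assumes "subgroup S G" "N \<lhd> G" "level_fun S N f" "x \<in> fix_set S N H" "h \<in> H" "h \<in> carrier G"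
  shows "f (h \<otimes> x) = f x"
proof -
  have x: "x \<in> carrier G" and y: "inv x \<otimes> h \<otimes> x \<in> S <#> N" using assms unfolding fix_set_def by auto
  have "h \<otimes> x = x \<otimes> (inv x \<otimes> h \<otimes> x)" using x assms(6)
    by (simp add: m_assoc[symmetric])
  then show ?thesis using level_fun_mult[OF assms(1-3) x y] by simp
qed

lemma fix_set_mono: "S \<subseteq> S' \<Longrightarrow> N \<subseteq> N' \<Longrightarrow> H' \<subseteq> H \<Longrightarrow> fix_set S N H \<subseteq> fix_set S' N' H'"
  using mono_set_mult[of S S' N N' G] unfolding fix_set_def by blast

lemma fix_set_insert: "x \<in> fix_set S N (insert h H) \<longleftrightarrow> x \<in> fix_set S N H \<and> x \<in> fix_set S N {h}"
  unfolding fix_set_def by auto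

lemma fix_set_right:
  assumes "subgroup S G" "N \<lhd> G" "H \<subseteq> carrier G" "x \<in> carrier G" "y \<in> S <#> N"
  shows "x \<otimes> y \<in> fix_set S N H \<longleftrightarrow> x \<in> fix_set S N H"
proof -
  interpret Y: subgroup "S <#> N" G by (rule setmult_subgroup[OF assms(1,2)])
  have y: "y \<in> carrier G" using assms(5) by auto
  have "inv (x \<otimes> y) \<otimes> h \<otimes> (x \<otimes> y) \<in> S <#> N \<longleftrightarrow> inv x \<otimes> h \<otimes> x \<in> S <#> N" if "h \<in> H" for h
  proof -
    have h: "h \<in> carrier G" using that assms(3) by auto
    have 1: "inv (x \<otimes> y) \<otimes> h \<otimes> (x \<otimes> y) = inv y \<otimes> (inv x \<otimes> h \<otimes> x) \<otimes> y"
      using h y assms(4) by (simp add: inv_mult_group m_assoc)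
    have 2: "inv x \<otimes> h \<otimes> x = y \<otimes> (inv (x \<otimes> y) \<otimes> h \<otimes> (x \<otimes> y)) \<otimes> inv y"
      unfolding 1 using h y assms(4) by (simp add: m_assoc) (simp add: m_assoc[symmetric])
    show ?thesis using 1 2 assms(5) by (metis Y.m_closed Y.m_inv_closed)
  qed
  then show ?thesis using assms(4) y unfolding fix_set_def by auto
qed

lemma subset_setmult:
  assumes "subgroup S G" "subgroup N G" shows "S \<subseteq> S <#> N" "N \<subseteq> S <#> N"
proof -
  have "x \<in> S <#> N" if "x \<in> S" for x
    unfolding set_mult_def using that subgroup.one_closed[OF assms(2)] r_one[of x] subgroup.mem_carrier[OF assms(1) that]
    by blast
  then show "S \<subseteq> S <#> N" by blast
  have "x \<in> S <#> N" if "x \<in> N" for x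
    unfolding set_mult_def using that subgroup.one_closed[OF assms(1)] l_one[of x] subgroup.mem_carrier[OF assms(2) that]
    by blast
  then show "N \<subseteq> S <#> N" by blast
qed

lemma level_fun_fixset:
  assumes "subgroup S G" "N \<lhd> G" "H \<subseteq> carrier G"
  shows "level_fun S N (\<lambda>x. x \<in> fix_set S N H)"
  using fix_set_right[OF assms] subset_setmult[OF assms(1) normal_imp_subgroup[OF assms(2)]]
  unfolding level_fun_def right_inv_def by blast

lemma fix_set_conv:
  assumes "x \<in> carrier G"
  shows "x \<in> fix_set S N {h} \<longleftrightarrow> inv x \<otimes> h \<otimes> x \<in> S <#> N"
  using assms unfolding fix_set_def by auto

end

text \<open>The cosets of A and B are the vertices, those of C the edges of a graph, over the inverse limit of the quotients by
  the members of NN. The last two assumptions say that this graph is connected and has no cycles, in terms of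
  locally constant functions.\<close>

locale tree_tower = group G for G (structure) +
  fixes NN :: "'a set set" and A B C :: "'a set"
  assumes NN_normal: "N \<in> NN \<Longrightarrow> N \<lhd> G"
    and NN_nonempty: "NN \<noteq> {}"
    and NN_directed: "N \<in> NN \<Longrightarrow> M \<in> NN \<Longrightarrow> \<exists>L\<in>NN. L \<subseteq> N \<inter> M"
    and subA: "subgroup A G" and subB: "subgroup B G" and subC: "subgroup C G"
    and CA: "C \<subseteq> A" and CB: "C \<subseteq> B"
    and generation: "\<And>N D x. N \<in> NN \<Longrightarrow> level_fun A N (D :: 'a \<Rightarrow> bool) \<Longrightarrow> level_fun B N D \<Longrightarrow> x \<in> carrier G \<Longrightarrow> D x = D \<one>"
    and splitting: "\<And>p N f. 0 < p \<Longrightarrow> N \<in> NN \<Longrightarrow> level_fun C N f \<Longrightarrow>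
      \<exists>M\<in>NN. \<exists>fA fB. level_fun A M fA \<and> level_fun B M fB \<and> (\<forall>x\<in>carrier G. [f x = fA x - fB x] (mod (int p)))"
begin

lemma common_level:
  assumes "finite F" "F \<subseteq> NN" shows "\<exists>L\<in>NN. \<forall>N\<in>F. L \<subseteq> N"
  using assms
proof (induction F rule: finite_induct)
  case empty
  then show ?case using NN_nonempty by auto
next
  case (insert N F)
  then obtain L where L: "L \<in> NN" "\<forall>N\<in>F. L \<subseteq> N" by auto
  obtain L' where "L' \<in> NN" "L' \<subseteq> N \<inter> L" using NN_directed[of N L] insert L by auto
  with L show ?case by (intro bexI[of _ L']) auto
qed

text \<open>A locally constant function on the vertices that has no jump across an edge fixed by H is constant on the vertices
  fixed by H, where membership in the fixed set may be tested at a finer level.\<close>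

definition fix_connected :: "'a set \<Rightarrow> bool" where
  "fix_connected H \<longleftrightarrow> (\<forall>N\<in>NN. \<forall>DA DB :: 'a \<Rightarrow> bool. level_fun A N DA \<longrightarrow> level_fun B N DB \<longrightarrow>
     (\<forall>x\<in>fix_set C N H. DA x = DB x) \<longrightarrow>
     (\<exists>M\<in>NN. M \<subseteq> N \<and> (\<exists>b. (\<forall>x\<in>fix_set A M H. DA x = b) \<and> (\<forall>x\<in>fix_set B M H. DB x = b))))"

text \<open>Nonemptiness is asked at each level separately; a compatible choice of fixed vertices,
  which compactness would provide in the profinite case, is never made.\<close>

definition fix_nonempty :: "'a set \<Rightarrow> bool" where
  "fix_nonempty H \<longleftrightarrow> (\<forall>N\<in>NN. fix_set A N H \<noteq> {} \<or> fix_set B N H \<noteq> {})"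

definition fix_tree :: "'a set \<Rightarrow> bool" where "fix_tree H \<longleftrightarrow> fix_connected H \<and> fix_nonempty H"

lemma fix_connectedD:
  assumes "fix_connected H" "N \<in> NN" "level_fun A N (DA :: 'a \<Rightarrow> bool)" "level_fun B N DB" "\<And>x. x \<in> fix_set C N H \<Longrightarrow> DA x = DB x"
  shows "\<exists>M\<in>NN. M \<subseteq> N \<and> (\<exists>b. (\<forall>x\<in>fix_set A M H. DA x = b) \<and> (\<forall>x\<in>fix_set B M H. DB x = b))"
  by (rule assms(1)[unfolded fix_connected_def, THEN bspec, OF assms(2), THEN spec, THEN spec, THEN mp, THEN mp, THEN mp])
    (use assms(3-5) in auto)

text \<open>Each value c is tested by its indicator function, and the finitely many levels obtained
  have a common refinement. There, two values that occur on fixed vertices cannot be told apart by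
  the indicator of either, so they are equal.\<close>

lemma fix_connected_fun:
  fixes fA fB :: "'a \<Rightarrow> 'c"
  assumes H: "fix_connected H" and N: "N \<in> NN" and l: "level_fun A N fA" "level_fun B N fB"
    and eq: "\<forall>x\<in>fix_set C N H. fA x = fB x" and fin: "finite S" "range fA \<subseteq> S" "range fB \<subseteq> S"
  shows "\<exists>M\<in>NN. M \<subseteq> N \<and> (\<exists>b. (\<forall>x\<in>fix_set A M H. fA x = b) \<and> (\<forall>x\<in>fix_set B M H. fB x = b))"
proof -
  have "\<forall>c\<in>S. \<exists>M\<in>NN. M \<subseteq> N \<and> (\<exists>b. (\<forall>x\<in>fix_set A M H. (fA x = c) = b) \<and> (\<forall>x\<in>fix_set B M H. (fB x = c) = b))"
  proof
    fix c assume "c \<in> S"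
    have "level_fun A N (\<lambda>x. fA x = c)" "level_fun B N (\<lambda>x. fB x = c)"
      by (rule level_fun_comp1[OF l(1)], rule level_fun_comp1[OF l(2)])
    then show "\<exists>M\<in>NN. M \<subseteq> N \<and> (\<exists>b. (\<forall>x\<in>fix_set A M H. (fA x = c) = b) \<and> (\<forall>x\<in>fix_set B M H. (fB x = c) = b))"
      by (rule fix_connectedD[OF H N]) (use eq in auto)
  qed
  then obtain M where M: "\<forall>c\<in>S. M c \<in> NN \<and> M c \<subseteq> N \<and> (\<exists>b. (\<forall>x\<in>fix_set A (M c) H. (fA x = c) = b) \<and> (\<forall>x\<in>fix_set B (M c) H. (fB x = c) = b))"
    by metis
  have "insert N (M ` S) \<subseteq> NN" "finite (insert N (M ` S))" using M N fin(1) by auto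
  then obtain L where L: "L \<in> NN" "\<forall>N'\<in>insert N (M ` S). L \<subseteq> N'"
    using common_level by meson
  define P where "P y \<longleftrightarrow> (\<exists>x\<in>fix_set A L H. y = fA x) \<or> (\<exists>x\<in>fix_set B L H. y = fB x)" for y
  have PS: "y \<in> S" if "P y" for y using that fin(2,3) unfolding P_def by auto
  have P1: "y = c" if c: "P c" and y: "P y" for c y
  proof -
    have cS: "c \<in> S" using PS c .
    have sub: "fix_set A L H \<subseteq> fix_set A (M c) H" "fix_set B L H \<subseteq> fix_set B (M c) H"
      using fix_set_mono[of A A L "M c" H H] fix_set_mono[of B B L "M c" H H] L(2) cS by auto
    obtain b where b: "\<forall>x\<in>fix_set A (M c) H. (fA x = c) = b" "\<forall>x\<in>fix_set B (M c) H. (fB x = c) = b"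
      using M[THEN bspec, OF cS] by (elim conjE exE) (rule that)
    have "(z = c) = b" if z: "P z" for z
    proof -
      consider (a) x where "x \<in> fix_set A L H" "z = fA x" | (b) x where "x \<in> fix_set B L H" "z = fB x"
        using z unfolding P_def by blast
      then show ?thesis
      proof cases
        case a
        then show ?thesis using b(1)[THEN bspec, OF subsetD[OF sub(1)]] by simp
      next
        case b
        then show ?thesis using \<open>\<forall>x\<in>fix_set B (M c) H. (fB x = c) = b\<close>[THEN bspec, OF subsetD[OF sub(2)]] by simp
      qed
    qed
    from this[OF c] this[OF y] show ?thesis by blast
  qed
  have PA: "P (fA x)" if "x \<in> fix_set A L H" for x unfolding P_def using that by (intro disjI1 bexI[of _ x] HOL.refl)
  have PB: "P (fB x)" if "x \<in> fix_set B L H" for x unfolding P_def using that by (intro disjI2 bexI[of _ x] HOL.refl)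
  have "(\<forall>x\<in>fix_set A L H. fA x = (SOME y. P y)) \<and> (\<forall>x\<in>fix_set B L H. fB x = (SOME y. P y))"
    using P1[OF someI[of P, OF PA] PA] P1[OF someI[of P, OF PB] PB] by simp
  then have "\<exists>b. (\<forall>x\<in>fix_set A L H. fA x = b) \<and> (\<forall>x\<in>fix_set B L H. fB x = b)" by (rule exI)
  then show ?thesis using L by (intro bexI[of _ L]) auto
qed

lemma fix_connected_cong:
  fixes fA fB :: "'a \<Rightarrow> int"
  assumes H: "fix_connected H" and N: "N \<in> NN" and l: "level_fun A N fA" "level_fun B N fB" and p: "0 < (p::nat)"
    and eq: "\<forall>x\<in>fix_set C N H. [fA x = fB x] (mod int p)"
  shows "\<exists>M\<in>NN. M \<subseteq> N \<and> (\<exists>b. (\<forall>x\<in>fix_set A M H. [fA x = b] (mod int p)) \<and> (\<forall>x\<in>fix_set B M H. [fB x = b] (mod int p)))"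
proof -
  have "level_fun A N (\<lambda>x. fA x mod int p)" "level_fun B N (\<lambda>x. fB x mod int p)"
    by (rule level_fun_comp1[OF l(1)], rule level_fun_comp1[OF l(2)])
  moreover have "finite {0..<int p}" "range (\<lambda>x. fA x mod int p) \<subseteq> {0..<int p}" "range (\<lambda>x. fB x mod int p) \<subseteq> {0..<int p}"
    using p by auto
  moreover have "\<forall>x\<in>fix_set C N H. fA x mod int p = fB x mod int p" using eq unfolding cong_def .
  ultimately obtain M b where "M \<in> NN" "M \<subseteq> N" "\<forall>x\<in>fix_set A M H. fA x mod int p = b" "\<forall>x\<in>fix_set B M H. fB x mod int p = b"
    using fix_connected_fun[OF H N, of "\<lambda>x. fA x mod int p" "\<lambda>x. fB x mod int p" "{0..<int p}"] by blast
  then show ?thesis unfolding cong_def by (intro bexI[of _ M] conjI exI[of _ b]) auto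
qed

text \<open>Both properties see H only through its fixed sets, so a generating set may be traded for
  another one with the same fixed sets.\<close>

lemma fix_tree_cong:
  assumes "fix_tree H" "\<And>S N. N \<in> NN \<Longrightarrow> subgroup S G \<Longrightarrow> fix_set S N H = fix_set S N H'"
  shows "fix_tree H'"
  using assms subA subB subC unfolding fix_tree_def fix_connected_def fix_nonempty_def by simp

text \<open>Induction base: nothing is required of a vertex, and connectedness is the assumption
  \<open>generation\<close> for the whole graph.\<close>

lemma fix_tree_empty: "fix_tree {}"
proof -
  have fs: "fix_set S N {} = carrier G" for S N unfolding fix_set_def by auto
  have "fix_connected {}" unfolding fix_connected_def fs
  proof (intro ballI allI impI)
    fix N and DA DB :: "'a \<Rightarrow> bool"
    assume N: "N \<in> NN" and l: "level_fun A N DA" "level_fun B N DB" and eq: "\<forall>x\<in>carrier G. DA x = DB x"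
    have "B \<subseteq> carrier G" "N \<subseteq> carrier G" using subB N NN_normal normal_imp_subgroup subgroup.subset by blast+
    then have "level_fun B N DA" using l(2) eq unfolding level_fun_def right_inv_def by (metis m_closed subsetD)
    then have "\<forall>x\<in>carrier G. DA x = DA \<one>" using generation[OF N l(1)] by blast
    then show "\<exists>M\<in>NN. M \<subseteq> N \<and> (\<exists>b. (\<forall>x\<in>carrier G. DA x = b) \<and> (\<forall>x\<in>carrier G. DB x = b))"
      using N eq by blast
  qed
  moreover have "fix_nonempty {}" unfolding fix_nonempty_def fs by blast
  ultimately show ?thesis unfolding fix_tree_def by blast
qed

text \<open>The trace of f along the powers of h. In a step of order p it is h-invariant on the
  fixed points of H and vanishes modulo p on those of h as well; these two facts drive the
  argument.\<close>

definition orbit_sum :: "'a \<Rightarrow> nat \<Rightarrow> ('a \<Rightarrow> int) \<Rightarrow> 'a \<Rightarrow> int" where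
  "orbit_sum h p f x = (\<Sum>i<p. f (h [^] i \<otimes> x))"

lemma level_fun_tr:
  assumes "subgroup S G" "N \<lhd> G" "h \<in> carrier G" "level_fun S N f"
  shows "level_fun S N (orbit_sum h p f)"
proof -
  have "level_fun S N (\<lambda>x. f (h [^] i \<otimes> x))" for i :: nat using level_fun_left[OF assms(1,2) _ assms(4)] assms(3) by simp
  then show ?thesis unfolding level_fun_def right_inv_def orbit_sum_def by simp
qed

end

text \<open>One step of order p: on the vertices and edges fixed by H, left multiplication by h
  acts, and its p-th power acts trivially. Both conditions speak of the actions at each level, so H
  may be any set of elements.\<close>

locale tower_step = tree_tower +
  fixes H :: "'a set" and h :: 'a and p :: nat
  assumes Hc: "H \<subseteq> carrier G" and hc: "h \<in> carrier G" and p: "Factorial_Ring.prime p"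
    and stab: "\<And>N S x. N \<in> NN \<Longrightarrow> subgroup S G \<Longrightarrow> x \<in> fix_set S N H \<Longrightarrow> h \<otimes> x \<in> fix_set S N H"
    and ord: "\<And>N S x. N \<in> NN \<Longrightarrow> subgroup S G \<Longrightarrow> x \<in> fix_set S N H \<Longrightarrow> inv x \<otimes> h [^] p \<otimes> x \<in> S <#> N"
begin

lemma p0: "p > 0" using p prime_gt_0_nat by blast

lemma stab_pow: "N \<in> NN \<Longrightarrow> subgroup S G \<Longrightarrow> x \<in> fix_set S N H \<Longrightarrow> h [^] (i::nat) \<otimes> x \<in> fix_set S N H"
proof (induction i)
  case 0
  then show ?case by (simp add: fix_set_def)
next
  case (Suc i)
  have x: "x \<in> carrier G" using Suc.prems unfolding fix_set_def by blast
  have "h [^] Suc i \<otimes> x = h \<otimes> (h [^] i \<otimes> x)" using x hc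
    by (simp add: m_assoc[symmetric] nat_pow_comm[of h 1 i, simplified])
  then show ?case using stab Suc by simp
qed

lemma level_fun_period:
  assumes "N \<in> NN" "subgroup S G" "level_fun S N f" "x \<in> fix_set S N H"
  shows "f (h [^] p \<otimes> x) = f x"
proof -
  have x: "x \<in> carrier G" using assms(4) unfolding fix_set_def by blast
  then have "x \<in> fix_set S N {h [^] p}" using ord[OF assms(1,2,4)] by (simp add: fix_set_conv)
  from fix_set_level_fun[OF assms(2) NN_normal[OF assms(1)] assms(3) this] show ?thesis using hc by simp
qed

lemma level_fun_fixed_pow:
  assumes "N \<in> NN" "subgroup S G" "level_fun S N f" "x \<in> fix_set S N (insert h H)"
  shows "f (h [^] (i::nat) \<otimes> x) = f x"
proof (induction i)
  case 0
  then show ?case using assms unfolding fix_set_def by simp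
next
  case (Suc i)
  have x: "x \<in> carrier G" using assms unfolding fix_set_def by blast
  have "level_fun S N (\<lambda>x. f (h [^] i \<otimes> x))" using level_fun_left[OF assms(2) NN_normal[OF assms(1)] _ assms(3)] hc by simp
  from fix_set_level_fun[OF assms(2) NN_normal[OF assms(1)] this assms(4), of h]
  show ?case using hc x Suc by (simp add: m_assoc)
qed

text \<open>Shifting the exponents cyclically replaces the term at exponent 0 by the one at exponent
  p, which is equal to it on fixed points of H.\<close>

lemma orbit_sum_shift:
  assumes "N \<in> NN" "subgroup S G" "level_fun S N f" "x \<in> fix_set S N H"
  shows "orbit_sum h p f (h \<otimes> x) = orbit_sum h p f x"
proof -
  have x: "x \<in> carrier G" using assms(4) unfolding fix_set_def by blast
  obtain q where q: "p = Suc q" using p0 by (cases p) auto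
  have "h [^] i \<otimes> (h \<otimes> x) = h [^] Suc i \<otimes> x" for i :: nat using hc x by (simp add: m_assoc)
  then have "orbit_sum h p f (h \<otimes> x) = (\<Sum>i<p. f (h [^] Suc i \<otimes> x))" unfolding orbit_sum_def by presburger
  also have "\<dots> = (\<Sum>i<q. f (h [^] Suc i \<otimes> x)) + f (h [^] p \<otimes> x)" unfolding q by simp
  also have "f (h [^] p \<otimes> x) = f (h [^] (0::nat) \<otimes> x)" using level_fun_period[OF assms] x by simp
  also have "(\<Sum>i<q. f (h [^] Suc i \<otimes> x)) + f (h [^] (0::nat) \<otimes> x) = orbit_sum h p f x"
    unfolding orbit_sum_def q sum.lessThan_Suc_shift by simp
  finally show ?thesis .
qed

text \<open>All p terms coincide; modulo p a trace is therefore invisible on the points fixed by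
  h.\<close>

lemma orbit_sum_fixed:
  assumes "N \<in> NN" "subgroup S G" "level_fun S N f" "x \<in> fix_set S N (insert h H)"
  shows "orbit_sum h p f x = int p * f x"
  unfolding orbit_sum_def using level_fun_fixed_pow[OF assms] by simp

text \<open>On the cosets fixed by H but not by h, multiplication by h is a permutation without
  fixed points whose p-th power is the identity, so \<open>transversal_prime_perm\<close> applies.
  The transversal is pulled back to the group as a predicate on cosets.\<close>

lemma fundamental_domain:
  assumes N: "N \<in> NN" and S: "subgroup S G"
  shows "\<exists>D :: 'a \<Rightarrow> bool. level_fun S N D \<and> (\<forall>x\<in>carrier G. D x \<longrightarrow> x \<in> fix_set S N H - fix_set S N (insert h H)) \<and>
    (\<forall>x\<in>fix_set S N H - fix_set S N (insert h H). \<exists>!i. i < p \<and> D (h [^] i \<otimes> x))"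
proof -
  note Nn = NN_normal[OF N]
  define Y where "Y = S <#> N"
  have Ysub: "subgroup Y G" unfolding Y_def by (rule setmult_subgroup[OF S Nn])
  then interpret Y: subgroup Y G .
  define Z where "Z = fix_set S N H - fix_set S N (insert h H)"
  define \<Omega> where "\<Omega> = {x <# Y | x. x \<in> Z}"
  define \<pi> where "\<pi> c = h <# c" for c
  have Zc: "Z \<subseteq> carrier G" unfolding Z_def fix_set_def by auto
  have coset_eq: "x <# Y = y <# Y \<longleftrightarrow> inv x \<otimes> y \<in> Y" if "x \<in> carrier G" "y \<in> carrier G" for x y
  proof
    assume e: "x <# Y = y <# Y"
    have "y \<in> y <# Y" unfolding l_coset_def using that r_one[of y] Y.one_closed by blast
    then have "y \<in> x <# Y" using e by simp
    then obtain z where "z \<in> Y" "y = x \<otimes> z" unfolding l_coset_def by auto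
    then show "inv x \<otimes> y \<in> Y" using that by (simp add: m_assoc[symmetric])
  next
    assume "inv x \<otimes> y \<in> Y"
    then have "x \<otimes> (inv x \<otimes> y) \<in> x <# Y" unfolding l_coset_def by auto
    then have "y \<in> x <# Y" using that by (simp add: m_assoc[symmetric])
    then show "x <# Y = y <# Y" using l_repr_independence[OF _ _ Ysub] that by blast
  qed
  have \<pi>: "\<pi> (x <# Y) = (h \<otimes> x) <# Y" if "x \<in> carrier G" for x
    unfolding \<pi>_def using that hc Y.subset by (simp add: lcos_m_assoc)
  have \<pi>n: "(\<pi> ^^ i) (x <# Y) = (h [^] i \<otimes> x) <# Y" if "x \<in> carrier G" for x i
  proof (induction i)
    case 0
    then show ?case using that by simp
  next
    case (Suc i)
    have "h [^] Suc i \<otimes> x = h \<otimes> (h [^] i \<otimes> x)" using that hc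
      by (simp add: m_assoc[symmetric] nat_pow_comm[of h 1 i, simplified])
    then show ?case using Suc \<pi>[of "h [^] i \<otimes> x"] that hc by simp
  qed
  have Zh: "h \<otimes> x \<in> Z" if "x \<in> Z" for x
  proof -
    have x: "x \<in> carrier G" using that Zc by auto
    have "inv (h \<otimes> x) \<otimes> h \<otimes> (h \<otimes> x) = inv x \<otimes> h \<otimes> x" 
      using x hc by (simp add: inv_mult_group m_assoc)
    then show ?thesis using that stab[OF N S] x hc unfolding Z_def
      by (simp add: fix_set_insert[of _ _ _ h H] fix_set_conv)
  qed
  have Zy: "x \<otimes> y \<in> Z \<longleftrightarrow> x \<in> Z" if "x \<in> carrier G" "y \<in> Y" for x y
    using fix_set_right[OF S Nn Hc that(1)] fix_set_right[OF S Nn _ that(1), of "insert h H"] that hc Hc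
    unfolding Z_def Y_def by auto
  have "\<exists>D\<subseteq>\<Omega>. \<forall>x\<in>\<Omega>. \<exists>!i. i < p \<and> (\<pi> ^^ i) x \<in> D"
  proof (rule transversal_prime_perm[OF p])
    show "\<pi> c \<in> \<Omega>" if "c \<in> \<Omega>" for c using that Zh Zc \<pi> unfolding \<Omega>_def by blast
    show "(\<pi> ^^ p) c = c" if c: "c \<in> \<Omega>" for c
    proof -
      obtain x where x: "x \<in> Z" "c = x <# Y" using c unfolding \<Omega>_def by auto
      then have xc: "x \<in> carrier G" using Zc by auto
      have "inv x \<otimes> (h [^] p \<otimes> x) \<in> Y" using ord[OF N S, of x] x(1) xc hc unfolding Z_def Y_def by (simp add: m_assoc)
      then show ?thesis using \<pi>n[OF xc] coset_eq[of x "h [^] p \<otimes> x"] xc hc x(2) by simp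
    qed
    show "\<pi> c \<noteq> c" if c: "c \<in> \<Omega>" for c
    proof
      assume e: "\<pi> c = c"
      obtain x where x: "x \<in> Z" "c = x <# Y" using c unfolding \<Omega>_def by auto
      then have xc: "x \<in> carrier G" using Zc by auto
      have "inv x \<otimes> (h \<otimes> x) \<in> Y" using e \<pi>[OF xc] coset_eq[of x "h \<otimes> x"] xc hc x(2) by simp
      then have "x \<in> fix_set S N (insert h H)" using x(1) xc hc unfolding Z_def Y_def
        by (simp add: fix_set_insert[of _ _ _ h H] fix_set_conv m_assoc)
      then show False using x(1) unfolding Z_def by blast
    qed
  qed
  then obtain D0 where D0: "D0 \<subseteq> \<Omega>" "\<forall>x\<in>\<Omega>. \<exists>!i. i < p \<and> (\<pi> ^^ i) x \<in> D0" by blast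
  define D where "D x = (x <# Y \<in> D0)" for x
  have "D (x \<otimes> y) = D x" if "x \<in> carrier G" "y \<in> Y" for x y
  proof -
    have "x <# Y = (x \<otimes> y) <# Y" using coset_eq[of x "x \<otimes> y"] that by (simp add: m_assoc[symmetric])
    then show ?thesis unfolding D_def by simp
  qed
  moreover have "S \<subseteq> Y" "N \<subseteq> Y" unfolding Y_def using subset_setmult[OF S normal_imp_subgroup[OF Nn]] by auto
  ultimately have "level_fun S N D" unfolding level_fun_def right_inv_def by blast
  moreover have "x \<in> Z" if x: "x \<in> carrier G" "D x" for x
  proof -
    obtain z where z: "z \<in> Z" "x <# Y = z <# Y" using x(2) D0(1) unfolding D_def \<Omega>_def by auto
    then have zc: "z \<in> carrier G" using Zc by auto
    have y: "inv z \<otimes> x \<in> Y" using coset_eq[of z x] z zc x by simp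
    have "x = z \<otimes> (inv z \<otimes> x)" using zc x by (simp add: m_assoc[symmetric])
    then show ?thesis using Zy[OF zc y] z by simp
  qed
  moreover have "\<exists>!i. i < p \<and> D (h [^] i \<otimes> x)" if "x \<in> Z" for x
  proof -
    have "x <# Y \<in> \<Omega>" using that unfolding \<Omega>_def by auto
    then have "\<exists>!i. i < p \<and> (\<pi> ^^ i) (x <# Y) \<in> D0" using D0(2) by (rule bspec[rotated])
    moreover have "x \<in> carrier G" using that Zc by auto
    ultimately show ?thesis unfolding D_def \<pi>n[OF \<open>x \<in> carrier G\<close>] by simp
  qed
  ultimately show ?thesis unfolding Z_def by (intro exI[of _ D]) blast
qed

text \<open>The powers of h act freely on the edges fixed by H but not by h, so that an invariant function vanishing on the
  edges fixed by h is the trace of its restriction to a fundamental domain.\<close>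

lemma trace_splitting:
  assumes N: "N \<in> NN" and f: "level_fun C N f" 
    and inva: "\<forall>x\<in>fix_set C N H. [f (h \<otimes> x) = f x] (mod int p)"
    and zero: "\<forall>x\<in>fix_set C N (insert h H). [f x = 0] (mod int p)"
  shows "\<exists>M\<in>NN. M \<subseteq> N \<and> (\<exists>bA bB. level_fun A M bA \<and> level_fun B M bB \<and>
     (\<forall>x\<in>fix_set C M H. [f x = orbit_sum h p bA x - orbit_sum h p bB x] (mod int p)))"
proof -
  obtain D where D: "level_fun C N D" "\<forall>x\<in>carrier G. D x \<longrightarrow> x \<in> fix_set C N H - fix_set C N (insert h H)"
    "\<forall>x\<in>fix_set C N H - fix_set C N (insert h H). \<exists>!i. i < p \<and> D (h [^] i \<otimes> x)"
    using fundamental_domain[OF N subC] by blast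
  define g where "g x = (if D x then f x else 0)" for x
  have gl: "level_fun C N g" unfolding g_def using level_fun_comp2[OF D(1) f, of "\<lambda>d y. if d then y else 0"] .
  have fpow: "[f (h [^] i \<otimes> x) = f x] (mod int p)" if "x \<in> fix_set C N H" for x and i :: nat
  proof (induction i)
    case 0
    then show ?case using that by (simp add: fix_set_def)
  next
    case (Suc i)
    have x: "x \<in> carrier G" using that unfolding fix_set_def by blast
    have "h [^] Suc i \<otimes> x = h \<otimes> (h [^] i \<otimes> x)" using x hc
      by (simp add: m_assoc[symmetric] nat_pow_comm[of h 1 i, simplified])
    then show ?case using inva stab_pow[OF N subC that, of i] Suc by (metis cong_trans)
  qed
  have trg: "[orbit_sum h p g x = f x] (mod int p)" if x: "x \<in> fix_set C N H" for x
  proof (cases "x \<in> fix_set C N (insert h H)")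
    case True
    have "[f x = 0] (mod int p)" using zero True by blast
    moreover have "[orbit_sum h p g x = 0] (mod int p)" unfolding orbit_sum_fixed[OF N subC gl True] by (simp add: cong_0_iff)
    ultimately show ?thesis by (metis cong_sym cong_trans)
  next
    case False
    then obtain i where i: "i < p" "D (h [^] i \<otimes> x)" and u: "\<And>j. j < p \<Longrightarrow> D (h [^] j \<otimes> x) \<Longrightarrow> j = i"
      using D(3) x by blast
    have "orbit_sum h p g x = (\<Sum>j<p. if j = i then f (h [^] i \<otimes> x) else 0)"
      unfolding orbit_sum_def g_def
    proof (rule sum.cong[OF HOL.refl])
      fix j assume "j \<in> {..<p}"
      then have "j < p" by simp
      then have "D (h [^] j \<otimes> x) \<longleftrightarrow> j = i" using u[of j] i(2) by metis
      then show "(if D (h [^] j \<otimes> x) then f (h [^] j \<otimes> x) else 0) = (if j = i then f (h [^] i \<otimes> x) else 0)" by simp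
    qed
    also have "\<dots> = f (h [^] i \<otimes> x)" using i by simp
    finally show ?thesis using fpow[OF x] by simp
  qed
  \<comment> \<open>It is the restriction g that is split, and the trace is taken afterwards: both
    parts of f then come out as traces.\<close>
  obtain M fA fB where M: "M \<in> NN" "level_fun A M fA" "level_fun B M fB" "\<forall>x\<in>carrier G. [g x = fA x - fB x] (mod int p)"
    using splitting[OF p0 N gl] by blast
  obtain L where L: "L \<in> NN" "L \<subseteq> N \<inter> M" using NN_directed[OF N M(1)] by blast
  have "[f x = orbit_sum h p fA x - orbit_sum h p fB x] (mod int p)" if "x \<in> fix_set C L H" for x
  proof -
    have xN: "x \<in> fix_set C N H" using that fix_set_mono[of C C L N H H] L by blast
    have x: "x \<in> carrier G" using that unfolding fix_set_def by blast
    have "[orbit_sum h p g x = (\<Sum>i<p. fA (h [^] i \<otimes> x) - fB (h [^] i \<otimes> x))] (mod int p)"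
      unfolding orbit_sum_def using M(4) x hc by (intro cong_sum) auto
    then have "[orbit_sum h p g x = orbit_sum h p fA x - orbit_sum h p fB x] (mod int p)" unfolding orbit_sum_def sum_subtractf .
    then show ?thesis using trg[OF xN] by (metis cong_sym cong_trans)
  qed
  moreover have "level_fun A L fA" "level_fun B L fB" using M L level_fun_mono by blast+
  ultimately show ?thesis using L by (intro bexI[of _ L]) auto
qed

end

section \<open>Fixed points of a step of prime order\<close>

context tower_step
begin

lemma fix_set_AC: "fix_set C N K \<subseteq> fix_set A N K" and fix_set_BC: "fix_set C N K \<subseteq> fix_set B N K"
  using fix_set_mono[OF CA, of N N K K] fix_set_mono[OF CB, of N N K K] by auto

lemma level_fun_C: "level_fun A N f \<Longrightarrow> level_fun C N f" "level_fun B N f \<Longrightarrow> level_fun C N f"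
  using CA CB unfolding level_fun_def right_inv_def by blast+

lemma not_cong_0_1: "\<not> [(1::int) = 0] (mod int p)" 
  using prime_gt_1_nat[OF p] by (simp add: cong_def)

text \<open>Replace D by h-invariant data E that agree with D on the vertices fixed by h. The jump
  of E across edges fixed by H is h-invariant and zero on edges fixed by h, hence a difference of
  traces. Removing the traces leaves functions without jumps modulo p, which are constant on the
  vertices fixed by H; on those fixed by h too the traces vanish, so D is constant there.\<close>

lemma fix_connected_step:
  assumes H: "fix_connected H" shows "fix_connected (insert h H)"
  unfolding fix_connected_def
proof (intro ballI allI impI)
  fix N and DA DB :: "'a \<Rightarrow> bool"
  assume N: "N \<in> NN" and l: "level_fun A N DA" "level_fun B N DB" and eq: "\<forall>x\<in>fix_set C N (insert h H). DA x = DB x"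
  note Nn = NN_normal[OF N]
  \<comment> \<open>Conjunction over the orbit makes the predicate h-invariant on the points fixed
    by H without changing it on the points that h fixes as well.\<close>
  define E where "E D x = (\<forall>i<p. D (h [^] i \<otimes> x))" for D :: "'a \<Rightarrow> bool" and x
  have lE: "level_fun S N (E D)" if "subgroup S G" "level_fun S N D" for S D
  proof -
    have "level_fun S N (\<lambda>x. D (h [^] i \<otimes> x))" for i :: nat using level_fun_left[OF that(1) Nn _ that(2)] hc by simp
    then show ?thesis unfolding level_fun_def right_inv_def E_def by simp
  qed
  have Eh: "E D (h \<otimes> x) = E D x" if "subgroup S G" "level_fun S N D" "x \<in> fix_set S N H" for S D x
  proof -
    have x: "x \<in> carrier G" using that(3) unfolding fix_set_def by blast
    have s: "h [^] i \<otimes> (h \<otimes> x) = h [^] Suc i \<otimes> x" for i :: nat using hc x by (simp add: m_assoc)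
    have per: "D (h [^] p \<otimes> x) = D (h [^] (0::nat) \<otimes> x)" using level_fun_period[OF N that] x by simp
    obtain q where q: "p = Suc q" using p0 by (cases p) auto
    have "E D (h \<otimes> x) = (\<forall>i<p. D (h [^] Suc i \<otimes> x))" unfolding E_def s ..
    also have "\<dots> = ((\<forall>i<q. D (h [^] Suc i \<otimes> x)) \<and> D (h [^] p \<otimes> x))" unfolding q All_less_Suc by blast
    also have "\<dots> = E D x" unfolding per E_def unfolding q All_less_Suc2 by blast
    finally show ?thesis .
  qed
  have Efix: "E D x = D x" if "subgroup S G" "level_fun S N D" "x \<in> fix_set S N (insert h H)" for S D x
    unfolding E_def using level_fun_fixed_pow[OF N that] p0 by auto
  define f where "f x = of_bool (E DA x) - (of_bool (E DB x) :: int)" for x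
  have lA: "level_fun A N (\<lambda>x. of_bool (E DA x) :: int)" and lB: "level_fun B N (\<lambda>x. of_bool (E DB x) :: int)"
    by (rule level_fun_comp1[OF lE[OF subA l(1)]], rule level_fun_comp1[OF lE[OF subB l(2)]])
  have "level_fun C N f" unfolding f_def using level_fun_comp2[OF level_fun_C(1)[OF lA] level_fun_C(2)[OF lB], of minus] .
  moreover have "\<forall>x\<in>fix_set C N H. [f (h \<otimes> x) = f x] (mod int p)"
    unfolding f_def using Eh[OF subA l(1)] Eh[OF subB l(2)] fix_set_AC fix_set_BC by (simp add: subset_iff)
  moreover have "\<forall>x\<in>fix_set C N (insert h H). [f x = 0] (mod int p)"
    unfolding f_def using Efix[OF subA l(1)] Efix[OF subB l(2)] fix_set_AC fix_set_BC eq by (simp add: subset_iff)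
  ultimately obtain M bA bB where M: "M \<in> NN" "M \<subseteq> N" "level_fun A M bA" "level_fun B M bB"
     "\<forall>x\<in>fix_set C M H. [f x = orbit_sum h p bA x - orbit_sum h p bB x] (mod int p)"
    using trace_splitting[OF N] by metis
  note Mn = NN_normal[OF M(1)]
  define gA where "gA x = of_bool (E DA x) - orbit_sum h p bA x" for x
  define gB where "gB x = of_bool (E DB x) - orbit_sum h p bB x" for x
  have "level_fun A M gA" "level_fun B M gB" unfolding gA_def gB_def
    using level_fun_comp2[OF level_fun_mono[OF lA M(2)] level_fun_tr[OF subA Mn hc M(3)], of minus]
      level_fun_comp2[OF level_fun_mono[OF lB M(2)] level_fun_tr[OF subB Mn hc M(4)], of minus] by auto
  moreover have "\<forall>x\<in>fix_set C M H. [gA x = gB x] (mod int p)"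
  proof
    fix x assume "x \<in> fix_set C M H"
    then have "[f x = orbit_sum h p bA x - orbit_sum h p bB x] (mod int p)" using M(5) by blast
    then show "[gA x = gB x] (mod int p)" unfolding f_def gA_def gB_def cong_iff_dvd_diff
      by (simp add: algebra_simps)
  qed
  ultimately obtain L c where L: "L \<in> NN" "L \<subseteq> M" "\<forall>x\<in>fix_set A L H. [gA x = c] (mod int p)" 
      "\<forall>x\<in>fix_set B L H. [gB x = c] (mod int p)"
    using fix_connected_cong[OF H M(1) _ _ p0] by metis
  \<comment> \<open>The truth value of D is recovered from its 0-1 value modulo p, as 0 and 1 are
    incongruent. The right-hand side is the same for A and for B.\<close>
  have main: "D x = [1 = c] (mod int p)"
    if "subgroup S G" "level_fun S N D" "level_fun S M b" "\<forall>x\<in>fix_set S L H. [of_bool (E D x) - orbit_sum h p b x = c] (mod int p)"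
       "x \<in> fix_set S L (insert h H)" for S D b x
  proof -
    have xs: "x \<in> fix_set S L H" "x \<in> fix_set S M (insert h H)" "x \<in> fix_set S N (insert h H)"
      using that(5) subsetD[OF fix_set_mono[OF order_refl L(2) order_refl], of x S "insert h H"]
        subsetD[OF fix_set_mono[OF order_refl order_trans[OF L(2) M(2)] order_refl], of x S "insert h H"]
        fix_set_insert[of x S L h H] by simp_all
    have "[of_bool (D x) - int p * b x = c] (mod int p)"
      using that(4)[THEN bspec, OF xs(1)] unfolding Efix[OF that(1,2) xs(3)] orbit_sum_fixed[OF M(1) that(1,3) xs(2)] .
    then have e: "[of_bool (D x) = c] (mod int p)" unfolding cong_def
      by (metis diff_conv_add_uminus mod_mult_self2 mult_minus_right)
    show ?thesis
    proof (cases "D x")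
      case True
      then show ?thesis using e by simp
    next
      case False
      then have "[0 = c] (mod int p)" using e by simp
      then have "\<not> [1 = c] (mod int p)" using not_cong_0_1 by (metis cong_sym cong_trans)
      then show ?thesis using False by simp
    qed
  qed
  show "\<exists>M\<in>NN. M \<subseteq> N \<and> (\<exists>b. (\<forall>x\<in>fix_set A M (insert h H). DA x = b) \<and> (\<forall>x\<in>fix_set B M (insert h H). DB x = b))"
    using main[OF subA l(1) M(3) L(3)[unfolded gA_def]] main[OF subB l(2) M(4) L(4)[unfolded gB_def]] L M(2)
    by (intro bexI[of _ L] conjI exI[of _ "[1 = c] (mod int p)"]) auto
qed

text \<open>If h fixed no vertex among those fixed by H, each of these would have a phase in Z/p,
  the exponent that brings it into a fundamental domain, and h would lower the phase by 1. Across an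
  edge the phases of the two endpoints differ by an h-invariant function, hence by a difference of
  traces. Corrected by these h-invariant traces, the phase becomes constant on the fixed vertices,
  although h still changes it by 1.\<close>

lemma fix_nonempty_step:
  assumes H: "fix_connected H" "fix_nonempty H" shows "fix_nonempty (insert h H)"
  unfolding fix_nonempty_def
proof (intro ballI)
  fix N assume N: "N \<in> NN"
  note Nn = NN_normal[OF N]
  show "fix_set A N (insert h H) \<noteq> {} \<or> fix_set B N (insert h H) \<noteq> {}"
  proof (rule ccontr)
    assume "\<not> ?thesis"
    then have eA: "fix_set A N (insert h H) = {}" and eB: "fix_set B N (insert h H) = {}" by auto
    define j where "j D x = int (THE i. i < p \<and> D (h [^] i \<otimes> x))" for D :: "'a \<Rightarrow> bool" and x
    have lj: "level_fun S N (j D)" if "subgroup S G" "level_fun S N D" for S D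
    proof -
      have "level_fun S N (\<lambda>x. D (h [^] i \<otimes> x))" for i :: nat using level_fun_left[OF that(1) Nn _ that(2)] hc by simp
      then show ?thesis unfolding level_fun_def right_inv_def j_def by simp
    qed
    have jh: "[j D (h \<otimes> x) = j D x - 1] (mod int p)"
      if "subgroup S G" "level_fun S N D" "\<forall>x\<in>fix_set S N H. \<exists>!i. i < p \<and> D (h [^] i \<otimes> x)" "x \<in> fix_set S N H" for S D x
    proof -
      note that0 = that
      have x: "x \<in> carrier G" using that(4) unfolding fix_set_def by blast
      have s: "h [^] i \<otimes> (h \<otimes> x) = h [^] Suc i \<otimes> x" for i :: nat using hc x by (simp add: m_assoc)
      have jp: "\<exists>i. j D y = int i \<and> i < p \<and> D (h [^] i \<otimes> y)" if y: "y \<in> fix_set S N H" for y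
        unfolding j_def using theI'[of "\<lambda>i. i < p \<and> D (h [^] i \<otimes> y)"] that(1) \<open>\<forall>x\<in>fix_set S N H. \<exists>!i. i < p \<and> D (h [^] i \<otimes> x)\<close> y by blast
      obtain i where i: "j D x = int i" "i < p" "D (h [^] i \<otimes> x)" using jp[OF that0(4)] by blast
      obtain k where k: "j D (h \<otimes> x) = int k" "k < p" "D (h [^] Suc k \<otimes> x)" 
        using jp[OF stab[OF N that0(1,4)]] unfolding s by blast
      show ?thesis
      \<comment> \<open>If h x enters the domain after k steps, then x does so after k + 1, except
        for k = p - 1: there the exponent of x is 0 and the two sides differ by a full p.\<close>
      proof (cases "Suc k < p")
        case True
        then have "i = Suc k" using that(3,4) i k by blast
        then show ?thesis using i k by simp
      next
        case False
        then have e: "Suc k = p" using k by simp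
        then have "D x" using level_fun_period[OF N that(1,2,4)] k by simp
        then have "D (h [^] (0::nat) \<otimes> x)" using x by simp
        then have "i = 0" using that(3,4) i p0 by blast
        moreover have "int k - (0 - 1) = int p" using e by simp
        ultimately show ?thesis unfolding cong_iff_dvd_diff i(1) k(1) by simp
      qed
    qed
    obtain DA where DA: "level_fun A N DA" "\<forall>x\<in>fix_set A N H. \<exists>!i. i < p \<and> DA (h [^] i \<otimes> x)"
      using fundamental_domain[OF N subA] unfolding eA Diff_empty by (elim exE conjE) (rule that)
    obtain DB where DB: "level_fun B N DB" "\<forall>x\<in>fix_set B N H. \<exists>!i. i < p \<and> DB (h [^] i \<otimes> x)"
      using fundamental_domain[OF N subB] unfolding eB Diff_empty by (elim exE conjE) (rule that)
    note jA = jh[OF subA DA] and jB = jh[OF subB DB]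
    note lA = lj[OF subA DA(1)] and lB = lj[OF subB DB(1)]
    define f where "f x = j DA x - j DB x" for x
    have "level_fun C N f" unfolding f_def using level_fun_comp2[OF level_fun_C(1)[OF lA] level_fun_C(2)[OF lB], of minus] .
    moreover have "\<forall>x\<in>fix_set C N H. [f (h \<otimes> x) = f x] (mod int p)"
    proof
      fix x assume x: "x \<in> fix_set C N H"
      have "[j DA (h \<otimes> x) - j DB (h \<otimes> x) = (j DA x - 1) - (j DB x - 1)] (mod int p)"
        by (intro cong_diff jA jB subsetD[OF fix_set_AC x] subsetD[OF fix_set_BC x])
      then show "[f (h \<otimes> x) = f x] (mod int p)" unfolding f_def by simp
    qed
    \<comment> \<open>The endpoints of an edge fixed by h would be fixed by h, so there is no such
      edge.\<close>
    moreover have "\<forall>x\<in>fix_set C N (insert h H). [f x = 0] (mod int p)" using eA fix_set_AC by blast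
    ultimately obtain M bA bB where M: "M \<in> NN" "M \<subseteq> N" "level_fun A M bA" "level_fun B M bB"
       "\<forall>x\<in>fix_set C M H. [f x = orbit_sum h p bA x - orbit_sum h p bB x] (mod int p)"
      using trace_splitting[OF N] by metis
    note Mn = NN_normal[OF M(1)]
    define gA where "gA x = j DA x - orbit_sum h p bA x" for x
    define gB where "gB x = j DB x - orbit_sum h p bB x" for x
    have "level_fun A M gA" "level_fun B M gB" unfolding gA_def gB_def
      using level_fun_comp2[OF level_fun_mono[OF lA M(2)] level_fun_tr[OF subA Mn hc M(3)], of minus]
        level_fun_comp2[OF level_fun_mono[OF lB M(2)] level_fun_tr[OF subB Mn hc M(4)], of minus] by auto
    moreover have "\<forall>x\<in>fix_set C M H. [gA x = gB x] (mod int p)"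
    proof
      fix x assume "x \<in> fix_set C M H"
      then have "[f x = orbit_sum h p bA x - orbit_sum h p bB x] (mod int p)" using M(5) by blast
      then show "[gA x = gB x] (mod int p)" unfolding f_def gA_def gB_def cong_iff_dvd_diff
        by (simp add: algebra_simps)
    qed
    ultimately obtain L c where L: "L \<in> NN" "L \<subseteq> M" "\<forall>x\<in>fix_set A L H. [gA x = c] (mod int p)" 
        "\<forall>x\<in>fix_set B L H. [gB x = c] (mod int p)"
      using fix_connected_cong[OF H(1) M(1) _ _ p0] by metis
    have main: False
      if "subgroup S G" "level_fun S M b" "\<forall>x\<in>fix_set S L H. [j D x - orbit_sum h p b x = c] (mod int p)"
         "\<And>x. x \<in> fix_set S N H \<Longrightarrow> [j D (h \<otimes> x) = j D x - 1] (mod int p)"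
         "x \<in> fix_set S L H" for S D b x
    proof -
      have xs: "x \<in> fix_set S M H" "x \<in> fix_set S N H"
        using that(5) fix_set_mono[of S S L M H H] fix_set_mono[of S S L N H H] L(2) M(2) by auto
      have "[j D (h \<otimes> x) - orbit_sum h p b (h \<otimes> x) = j D x - orbit_sum h p b x] (mod int p)"
        using that(3,5) stab[OF L(1) that(1,5)] by (metis cong_sym cong_trans)
      then have "[j D (h \<otimes> x) - orbit_sum h p b x = j D x - orbit_sum h p b x] (mod int p)"
        unfolding orbit_sum_shift[OF M(1) that(1,2) xs(1)] .
      then have "[j D x - 1 = j D x] (mod int p)" using that(4)[OF xs(2)]
        by (metis cong_diff_iff_cong_0 cong_sym cong_trans diff_diff_eq2 diff_add_cancel cong_add_rcancel)
      then have "[(1::int) = 0] (mod int p)" unfolding cong_iff_dvd_diff by simp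
      then show False using not_cong_0_1 by blast
    qed
    have "fix_set A L H \<noteq> {} \<or> fix_set B L H \<noteq> {}" using H(2) L(1) unfolding fix_nonempty_def by blast
    then show False
      using main[OF subA M(3) L(3)[unfolded gA_def] jA] main[OF subB M(4) L(4)[unfolded gB_def] jB] by blast
  qed
qed

lemma fix_tree_step: "fix_tree H \<Longrightarrow> fix_tree (insert h H)"
  using fix_connected_step fix_nonempty_step unfolding fix_tree_def by blast

end

section \<open>Cyclic and dihedral groups of finite order\<close>

context tree_tower
begin

lemma fix_set_pow:
  assumes "subgroup S G" "N \<in> NN" "g \<in> carrier G" "x \<in> fix_set S N {g}"
  shows "x \<in> fix_set S N {g [^] (k::nat)}"
proof -
  interpret Y: subgroup "S <#> N" G by (rule setmult_subgroup[OF assms(1) NN_normal[OF assms(2)]])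
  have x: "x \<in> carrier G" using assms(4) unfolding fix_set_def by blast
  have g: "inv x \<otimes> g \<otimes> x \<in> S <#> N" using assms(4) fix_set_conv[OF x] by blast
  have "inv x \<otimes> g [^] k \<otimes> x \<in> S <#> N"
  proof (induction k)
    case 0
    then show ?case using x by simp
  next
    case (Suc k)
    have "inv x \<otimes> g [^] Suc k \<otimes> x = (inv x \<otimes> g [^] k \<otimes> x) \<otimes> (inv x \<otimes> g \<otimes> x)"
      using x assms(3) by (simp add: m_assoc) (simp add: m_assoc[symmetric])
    then show ?case using Suc g by simp
  qed
  then show ?thesis using fix_set_conv[OF x] by blast
qed

lemma fix_tree_finite_order:
  assumes "g \<in> carrier G" "0 < m" "g [^] (m::nat) = \<one>"
  shows "fix_tree {g}"
  using assms
proof (induction m arbitrary: g rule: less_induct)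
  case (less m)
  note g = less.prems(1)
  show ?case
  proof (cases "m = 1")
    case True
    then have g1: "g = \<one>" using less.prems by (simp add: nat_pow_Suc)
    show ?thesis
    proof (rule fix_tree_cong[OF fix_tree_empty])
      fix S N assume N: "N \<in> NN" and S: "subgroup S G"
      interpret Y: subgroup "S <#> N" G by (rule setmult_subgroup[OF S NN_normal[OF N]])
      show "fix_set S N {} = fix_set S N {g}" unfolding fix_set_def g1 by auto
    qed
  next
    case False
    then obtain p where p: "Factorial_Ring.prime p" "p dvd m" using prime_factor_nat by blast
    then obtain k where k: "m = p * k" by auto
    have k0: "0 < k" "k < m" using k less.prems(2) prime_gt_1_nat[OF p(1)] by auto
    have "fix_tree {g [^] p}"
      by (rule less.IH[OF k0(2)]) (use less.prems k0 k in \<open>auto simp: nat_pow_pow\<close>)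
    moreover have step: "tower_step G NN A B C {g [^] p} g p"
    proof (unfold_locales)
      fix N S x assume N: "N \<in> NN" and S: "subgroup S G" and xf: "x \<in> fix_set S N {g [^] p}"
      have x: "x \<in> carrier G" using xf unfolding fix_set_def by blast
      show "inv x \<otimes> g [^] p \<otimes> x \<in> S <#> N" using xf fix_set_conv[OF x] by blast
      have "g [^] p \<otimes> g = g \<otimes> g [^] p" using g nat_pow_comm[of g p 1] by simp
      then have "inv (g \<otimes> x) \<otimes> g [^] p \<otimes> (g \<otimes> x) = inv x \<otimes> (inv g \<otimes> (g \<otimes> g [^] p)) \<otimes> x"
        using g x by (simp add: inv_mult_group m_assoc) (simp add: m_assoc[symmetric])
      also have "\<dots> = inv x \<otimes> g [^] p \<otimes> x" using g x by (simp add: m_assoc[symmetric])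
      finally show "g \<otimes> x \<in> fix_set S N {g [^] p}" using xf fix_set_conv[OF x] fix_set_conv[of "g \<otimes> x"] g x by simp
    qed (use g p in auto)
    ultimately have "fix_tree {g, g [^] p}" using tower_step.fix_tree_step[OF step] by simp
    then show ?thesis
    proof (rule fix_tree_cong)
      fix S N assume "N \<in> NN" "subgroup S G"
      then show "fix_set S N {g, g [^] p} = fix_set S N {g}"
        using fix_set_pow[of S N g _ p] g by (auto simp: fix_set_insert[of _ _ _ g "{g [^] p}"])
    qed
  qed
qed

text \<open>The involution v inverts the rotation v w and so permutes its fixed cosets, which makes
  v a step of order 2. The sets {v, v w} and {v, w} have the same fixed cosets.\<close>

lemma fix_tree_dihedral:
  assumes v: "v \<in> carrier G" "v \<otimes> v = \<one>" and w: "w \<in> carrier G" "w \<otimes> w = \<one>"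
    and m: "0 < m" "(v \<otimes> w) [^] (m::nat) = \<one>"
  shows "fix_tree {v, w}"
proof -
  have "fix_tree {v \<otimes> w}" by (rule fix_tree_finite_order[OF _ m]) (use v w in auto)
  have iv: "inv v = v" "inv w = w" using v w by (auto intro: inv_equality)
  have fs: "fix_set S N {v, v \<otimes> w} = fix_set S N {v, w}" if "N \<in> NN" "subgroup S G" for S N
  proof -
    interpret Y: subgroup "S <#> N" G by (rule setmult_subgroup[OF that(2) NN_normal[OF that(1)]])
    have "inv x \<otimes> (v \<otimes> w) \<otimes> x \<in> S <#> N \<longleftrightarrow> inv x \<otimes> w \<otimes> x \<in> S <#> N" 
      if x: "x \<in> carrier G" and xv: "inv x \<otimes> v \<otimes> x \<in> S <#> N" for x
    proof -
      have 1: "inv x \<otimes> (v \<otimes> w) \<otimes> x = (inv x \<otimes> v \<otimes> x) \<otimes> (inv x \<otimes> w \<otimes> x)"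
        using x v w by (simp add: m_assoc) (simp add: m_assoc[symmetric])
      have "(inv x \<otimes> v \<otimes> x) \<otimes> (inv x \<otimes> v \<otimes> x) = inv x \<otimes> ((v \<otimes> v) \<otimes> x)"
        using x v(1) by (simp add: m_assoc) (simp add: m_assoc[symmetric])
      then have vv: "(inv x \<otimes> v \<otimes> x) \<otimes> (inv x \<otimes> v \<otimes> x) = \<one>" using x v by simp
      then have 2: "inv x \<otimes> w \<otimes> x = (inv x \<otimes> v \<otimes> x) \<otimes> (inv x \<otimes> (v \<otimes> w) \<otimes> x)"
        unfolding 1 using x v(1) w(1) by (simp add: m_assoc[symmetric])
      show ?thesis using 1 2 xv by (metis Y.m_closed)
    qed
    then show ?thesis unfolding fix_set_def by auto
  qed
  have vv: "v \<otimes> (v \<otimes> y) = y" if "y \<in> carrier G" for y using v that by (simp add: m_assoc[symmetric])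
  have step: "tower_step G NN A B C {v \<otimes> w} v 2"
  proof (unfold_locales)
    fix N S x assume N: "N \<in> NN" and S: "subgroup S G" and xf: "x \<in> fix_set S N {v \<otimes> w}"
    interpret Y: subgroup "S <#> N" G by (rule setmult_subgroup[OF S NN_normal[OF N]])
    have x: "x \<in> carrier G" using xf unfolding fix_set_def by blast
    have xy: "inv x \<otimes> (v \<otimes> w) \<otimes> x \<in> S <#> N" using xf fix_set_conv[OF x] by blast
    have v2: "v [^] (2::nat) = \<one>" using v by (simp add: numeral_2_eq_2)
    show "inv x \<otimes> v [^] (2::nat) \<otimes> x \<in> S <#> N" unfolding v2 using x by simp
    have "inv (v \<otimes> x) \<otimes> (v \<otimes> w) \<otimes> (v \<otimes> x) = inv (inv x \<otimes> (v \<otimes> w) \<otimes> x)"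
      using v(1) w(1) x by (simp add: inv_mult_group m_assoc iv vv)
    then show "v \<otimes> x \<in> fix_set S N {v \<otimes> w}" using Y.m_inv_closed[OF xy] fix_set_conv[of "v \<otimes> x"] v x by simp
  qed (use v w in \<open>auto intro: two_is_prime_nat\<close>)
  have "fix_tree {v, v \<otimes> w}" using tower_step.fix_tree_step[OF step] \<open>fix_tree {v \<otimes> w}\<close> by simp
  then show ?thesis by (rule fix_tree_cong) (rule fs)
qed

end

section \<open>Common fixed vertices of several elements\<close>

context tree_tower
begin

lemma fix_connected_congE:
  assumes "fix_connected H" "N \<in> NN" "level_fun A N fA" "level_fun B N fB" "0 < (p::nat)"
    "\<And>x. x \<in> fix_set C N H \<Longrightarrow> [fA x = fB x] (mod int p)"
  obtains M b where "M \<in> NN" "M \<subseteq> N" "\<And>x. x \<in> fix_set A M H \<Longrightarrow> [fA x = b] (mod int p)"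
    "\<And>x. x \<in> fix_set B M H \<Longrightarrow> [fB x = b] (mod int p)"
proof -
  have "\<forall>x\<in>fix_set C N H. [fA x = fB x] (mod int p)" using assms(6) by (rule ballI)
  from fix_connected_cong[OF assms(1-5) this] show ?thesis by (elim bexE conjE exE) (rule that, assumption+, (erule bspec, assumption)+)
qed

text \<open>This is \<open>fix_connected_congE\<close> for the empty set, whose fixed sets are the
  whole group.\<close>

lemma const_cong:
  assumes "N \<in> NN" "level_fun A N fA" "level_fun B N fB" "0 < (p::nat)"
    "\<And>x. x \<in> carrier G \<Longrightarrow> [fA x = fB x] (mod int p)"
  shows "\<exists>b. \<forall>x\<in>carrier G. [fA x = b] (mod int p) \<and> [fB x = b] (mod int p)"
proof -
  have fs: "fix_set S N {} = carrier G" for S N unfolding fix_set_def by auto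
  have c: "fix_connected {}" using fix_tree_empty unfolding fix_tree_def by simp
  show ?thesis
    by (rule fix_connected_congE[OF c assms(1-4), unfolded fs]) (use assms(5) in auto)
qed

lemma level_fun_sum:
  assumes "\<And>i. i \<in> J \<Longrightarrow> level_fun S N (f i)" shows "level_fun S N (\<lambda>x. \<Sum>i\<in>J. f i x)"
  using assms unfolding level_fun_def right_inv_def by simp

lemma level_fun_zero: "level_fun S N (\<lambda>_. c)"
  unfolding level_fun_def right_inv_def by simp

text \<open>If there is no common fixed vertex, choose at every vertex some v for which the vertex is not fixed. The jumps of the
  indicator functions of these choices are supported off the fixed edges, and connectedness away from each edge makes
  their values on the fixed trees agree modulo 2, while they add up to 1.\<close>

theorem common_fixed_vertex:
  fixes \<sigma> :: "'i \<Rightarrow> 'a" and adj :: "'i \<Rightarrow> 'i \<Rightarrow> bool"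
  assumes fin: "finite I" and sc: "\<And>v. v \<in> I \<Longrightarrow> \<sigma> v \<in> carrier G"
    and gd: "\<And>v. v \<in> I \<Longrightarrow> fix_tree {\<sigma> v}"
    and adjne: "\<And>v w. v \<in> I \<Longrightarrow> w \<in> I \<Longrightarrow> adj v w \<Longrightarrow> fix_nonempty {\<sigma> v, \<sigma> w}"
    and N0: "N0 \<in> NN"
    and conn: "\<And>x Z T. x \<in> carrier G \<Longrightarrow> T = {v \<in> I. x \<in> fix_set C N0 {\<sigma> v}} \<Longrightarrow> Z \<subseteq> I - T \<Longrightarrow> Z \<noteq> {} \<Longrightarrow>
      (\<And>v w. v \<in> Z \<Longrightarrow> w \<in> I - T \<Longrightarrow> adj v w \<Longrightarrow> w \<in> Z) \<Longrightarrow> Z = I - T"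
  shows "fix_set A N0 (\<sigma> ` I) \<noteq> {} \<or> fix_set B N0 (\<sigma> ` I) \<noteq> {}"
proof (rule ccontr)
  assume "\<not> ?thesis"
  then have eA: "fix_set A N0 (\<sigma> ` I) = {}" and eB: "fix_set B N0 (\<sigma> ` I) = {}" by auto
  note Nn = NN_normal[OF N0]
  define a where "a S x = (SOME v. v \<in> I \<and> x \<notin> fix_set S N0 {\<sigma> v})" for S x
  define D where "D S v x = (of_bool (a S x = v) :: int)" for S v x
  have aI: "a S x \<in> I \<and> x \<notin> fix_set S N0 {\<sigma> (a S x)}" if "x \<in> carrier G" "fix_set S N0 (\<sigma> ` I) = {}" for S x
  proof -
    have "x \<notin> fix_set S N0 (\<sigma> ` I)" using that by simp
    then have "\<exists>v. v \<in> I \<and> x \<notin> fix_set S N0 {\<sigma> v}" using that(1) unfolding fix_set_def by auto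
    then show ?thesis unfolding a_def by (rule someI_ex)
  qed
  have mem: "x \<otimes> y \<in> fix_set S N0 {\<sigma> v} \<longleftrightarrow> x \<in> fix_set S N0 {\<sigma> v}"
    if "subgroup S G" "v \<in> I" "x \<in> carrier G" "y \<in> S \<union> N0" for S v x y
    using level_fun_fixset[OF that(1) Nn, of "{\<sigma> v}"] sc that unfolding level_fun_def right_inv_def by auto
  have la: "level_fun S N0 (a S)" if "subgroup S G" for S
  proof -
    have "a S (x \<otimes> y) = a S x" if xy: "x \<in> carrier G" "y \<in> S \<union> N0" for x y
      unfolding a_def using mem[OF \<open>subgroup S G\<close> _ xy] by (intro arg_cong[where f = Eps] ext) auto
    then show ?thesis unfolding level_fun_def right_inv_def by blast
  qed
  have lD: "level_fun S N0 (D S v)" if "subgroup S G" for S v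
    unfolding D_def by (rule level_fun_comp1[OF la[OF that]])
  have Dsum: "(\<Sum>v\<in>I. D S v x) = 1" if "x \<in> carrier G" "fix_set S N0 (\<sigma> ` I) = {}" for S x
    using aI[OF that] fin unfolding D_def of_bool_def by simp
  have D0: "D S v x = 0" if "x \<in> fix_set S N0 {\<sigma> v}" "fix_set S N0 (\<sigma> ` I) = {}" for S v x
  proof -
    have "x \<in> carrier G" using that(1) unfolding fix_set_def by blast
    from aI[OF this that(2)] have "a S x \<noteq> v" using that(1) by metis
    then show ?thesis unfolding D_def by simp
  qed
  \<comment> \<open>The type of an edge is the set of indices v whose \<sigma> v fix it. Jumps are
    sorted by type, so that each part is supported on edges of a single type.\<close>
  define T where "T x = {v \<in> I. x \<in> fix_set C N0 {\<sigma> v}}" for x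
  define TT where "TT = T ` carrier G"
  have TTI: "T' \<subseteq> I" if "T' \<in> TT" for T' using that unfolding TT_def T_def by auto
  have finTT: "finite TT" using TTI fin by (meson PowI finite_Pow_iff finite_subset subsetI)
  have lT: "level_fun C N0 T"
  proof -
    have "T (x \<otimes> y) = T x" if "x \<in> carrier G" "y \<in> C \<union> N0" for x y
      unfolding T_def using mem[OF subC _ that] by auto
    then show ?thesis unfolding level_fun_def right_inv_def by blast
  qed
  have fCA: "x \<in> fix_set A N K" and fCB: "x \<in> fix_set B N K" if "x \<in> fix_set C N K" for x N K
    using that fix_set_mono[OF CA, of N N K K] fix_set_mono[OF CB, of N N K K] by auto
  have lC: "level_fun C N f" if "level_fun A N f \<or> level_fun B N f" for N and f :: "'a \<Rightarrow> int"
    using that CA CB unfolding level_fun_def right_inv_def by blast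
  define b where "b v T' x = (if T x = T' then D A v x - D B v x else 0)" for v T' x
  have lb: "level_fun C N0 (b v T')" for v T'
  proof -
    have "level_fun C N0 (\<lambda>x. D A v x - D B v x)"
      by (rule level_fun_comp2) (use lC lD[OF subA] lD[OF subB] in auto)
    then show ?thesis unfolding b_def by (rule level_fun_comp2[OF lT])
  qed
  have bzero: "b v T' x = 0" if "x \<in> carrier G" "v \<in> I" "v \<in> T' \<or> T' \<notin> TT" for v T' x
  proof (cases "T x = T'")
    case True
    then have "v \<in> T x" using that unfolding TT_def by auto
    then have "x \<in> fix_set C N0 {\<sigma> v}" unfolding T_def by blast
    then show ?thesis unfolding b_def using D0[OF fCA eA] D0[OF fCB eB] by simp
  qed (simp add: b_def)
  \<comment> \<open>For v in T' the jump is zero and the two parts are required to be literally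
    zero, so that the sums below may range over all v and all T'.\<close>
  define P where "P v T' q \<longleftrightarrow> (case q of (M, fA, fB) \<Rightarrow> M \<in> NN \<and> level_fun A M fA \<and> level_fun B M fB \<and>
     (\<forall>x\<in>carrier G. [b v T' x = fA x - fB x] (mod int 2)) \<and> (v \<in> T' \<longrightarrow> fA = (\<lambda>_. 0) \<and> fB = (\<lambda>_. 0)))" for v T' q
  have "\<exists>q. P v T' q" if v: "v \<in> I" for v T'
  proof (cases "v \<in> T'")
    case True
    then have "P v T' (N0, (\<lambda>_. 0), (\<lambda>_. 0))" unfolding P_def using N0 level_fun_zero bzero v by auto
    then show ?thesis by blast
  next
    case False
    obtain M fA fB where "M \<in> NN" "level_fun A M fA" "level_fun B M fB" "\<forall>x\<in>carrier G. [b v T' x = fA x - fB x] (mod int 2)"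
      using splitting[OF pos2 N0 lb[of v T']] by (elim bexE exE conjE) (rule that)
    then have "P v T' (M, fA, fB)" unfolding P_def using False by simp
    then show ?thesis by blast
  qed
  then obtain q where q: "\<And>v T'. v \<in> I \<Longrightarrow> P v T' (q v T')" by metis
  define fA where "fA v T' = fst (snd (q v T'))" for v T'
  define fB where "fB v T' = snd (snd (q v T'))" for v T'
  have q1: "fst (q v T') \<in> NN" "level_fun A (fst (q v T')) (fA v T')" "level_fun B (fst (q v T')) (fB v T')"
    "\<And>x. x \<in> carrier G \<Longrightarrow> [b v T' x = fA v T' x - fB v T' x] (mod int 2)" 
    "v \<in> T' \<Longrightarrow> fA v T' = (\<lambda>_. 0)" "v \<in> T' \<Longrightarrow> fB v T' = (\<lambda>_. 0)" if "v \<in> I" for v T'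
    using q[OF that, of T'] unfolding P_def fA_def fB_def by (auto split: prod.splits)
  define F0 where "F0 = insert N0 ((\<lambda>(v, T'). fst (q v T')) ` (I \<times> TT))"
  have "finite F0" "F0 \<subseteq> NN" using q1(1) N0 fin finTT unfolding F0_def by auto
  from common_level[OF this] obtain M where M0: "M \<in> NN" "\<forall>N\<in>F0. M \<subseteq> N" by (elim bexE) (rule that)
  have M: "M \<in> NN" "M \<subseteq> N0" "\<And>v T'. v \<in> I \<Longrightarrow> T' \<in> TT \<Longrightarrow> M \<subseteq> fst (q v T')" using M0 unfolding F0_def by auto
  have lfA: "level_fun A M (fA v T')" and lfB: "level_fun B M (fB v T')" if "v \<in> I" "T' \<in> TT" for v T'
    by (rule level_fun_mono[OF q1(2)[OF that(1)] M(3)[OF that]], rule level_fun_mono[OF q1(3)[OF that(1)] M(3)[OF that]])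
  note del = q1(4)
  \<comment> \<open>Summed over all types, the parts have the same jumps as the indicator
    \<open>D\<close>, so the difference has none.\<close>
  have "\<exists>k. \<forall>x\<in>carrier G. [(\<Sum>T'\<in>TT. fA v T' x) - D A v x = k] (mod int 2) \<and> [(\<Sum>T'\<in>TT. fB v T' x) - D B v x = k] (mod int 2)"
    if v: "v \<in> I" for v
  proof (rule const_cong[OF M(1)])
    show "level_fun A M (\<lambda>x. (\<Sum>T'\<in>TT. fA v T' x) - D A v x)"
      by (rule level_fun_comp2[OF level_fun_sum level_fun_mono[OF lD[OF subA] M(2)]]) (use lfA v in auto)
    show "level_fun B M (\<lambda>x. (\<Sum>T'\<in>TT. fB v T' x) - D B v x)"
      by (rule level_fun_comp2[OF level_fun_sum level_fun_mono[OF lD[OF subB] M(2)]]) (use lfB v in auto)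
    fix x assume x: "x \<in> carrier G"
    have "(\<Sum>T'\<in>TT. b v T' x) = D A v x - D B v x"
      unfolding b_def using finTT x by (simp add: TT_def)
    moreover have "[(\<Sum>T'\<in>TT. b v T' x) = (\<Sum>T'\<in>TT. fA v T' x - fB v T' x)] (mod int 2)"
      by (intro cong_sum del v x)
    ultimately show "[(\<Sum>T'\<in>TT. fA v T' x) - D A v x = (\<Sum>T'\<in>TT. fB v T' x) - D B v x] (mod int 2)"
      unfolding sum_subtractf cong_iff_dvd_diff by presburger
  qed simp
  then obtain k where k: "\<And>v x. v \<in> I \<Longrightarrow> x \<in> carrier G \<Longrightarrow> [(\<Sum>T'\<in>TT. fA v T' x) - D A v x = k v] (mod int 2)"
    "\<And>v x. v \<in> I \<Longrightarrow> x \<in> carrier G \<Longrightarrow> [(\<Sum>T'\<in>TT. fB v T' x) - D B v x = k v] (mod int 2)"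
    by metis
  \<comment> \<open>Summed over v, the indicators are identically 1 at both ends of an edge, so
    their jumps cancel on each type.\<close>
  have "\<exists>c. \<forall>x\<in>carrier G. [(\<Sum>v\<in>I. fA v T' x) = c] (mod int 2) \<and> [(\<Sum>v\<in>I. fB v T' x) = c] (mod int 2)"
    if T': "T' \<in> TT" for T'
  proof (rule const_cong[OF M(1)])
    show "level_fun A M (\<lambda>x. \<Sum>v\<in>I. fA v T' x)" "level_fun B M (\<lambda>x. \<Sum>v\<in>I. fB v T' x)"
      using level_fun_sum[of I A M "\<lambda>v. fA v T'"] level_fun_sum[of I B M "\<lambda>v. fB v T'"] lfA lfB T' by auto
    fix x assume x: "x \<in> carrier G"
    have "(\<Sum>v\<in>I. b v T' x) = (if T x = T' then (\<Sum>v\<in>I. D A v x) - (\<Sum>v\<in>I. D B v x) else 0)"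
      unfolding b_def by (simp add: sum_subtractf)
    also have "\<dots> = 0" using Dsum[OF x eA] Dsum[OF x eB] by simp
    finally have "(\<Sum>v\<in>I. b v T' x) = 0" .
    moreover have "[(\<Sum>v\<in>I. b v T' x) = (\<Sum>v\<in>I. fA v T' x - fB v T' x)] (mod int 2)"
      by (intro cong_sum del x)
    ultimately show "[(\<Sum>v\<in>I. fA v T' x) = (\<Sum>v\<in>I. fB v T' x)] (mod int 2)"
      unfolding sum_subtractf cong_iff_dvd_diff by presburger
  qed simp
  then obtain c where c: "\<And>T' x. T' \<in> TT \<Longrightarrow> x \<in> carrier G \<Longrightarrow> [(\<Sum>v\<in>I. fA v T' x) = c T'] (mod int 2)"
    "\<And>T' x. T' \<in> TT \<Longrightarrow> x \<in> carrier G \<Longrightarrow> [(\<Sum>v\<in>I. fB v T' x) = c T'] (mod int 2)"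
    by metis
  \<comment> \<open>An edge fixed by \<sigma> u has u in its type, hence is not of type T' when u is
    outside T'. So the part belonging to T' has no jump along the fixed tree of \<sigma> u.\<close>
  have "\<exists>L m. L \<in> NN \<and> L \<subseteq> M \<and> (\<forall>x\<in>fix_set A L {\<sigma> u}. [fA v T' x = m] (mod int 2)) \<and> (\<forall>x\<in>fix_set B L {\<sigma> u}. [fB v T' x = m] (mod int 2))"
    if vTu: "v \<in> I" "T' \<in> TT" "u \<in> I - T'" for v T' u
  proof -
    have "fix_connected {\<sigma> u}" using gd[of u] vTu unfolding fix_tree_def by simp
    then show ?thesis
    proof (rule fix_connected_congE[OF _ M(1) lfA[OF vTu(1,2)] lfB[OF vTu(1,2)]])
      fix x assume xf: "x \<in> fix_set C M {\<sigma> u}"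
      then have x: "x \<in> carrier G" unfolding fix_set_def by blast
      have "x \<in> fix_set C N0 {\<sigma> u}" using subsetD[OF fix_set_mono[OF order_refl M(2) order_refl] xf] .
      then have "T x \<noteq> T'" using vTu(3) unfolding T_def by auto
      then have "b v T' x = 0" unfolding b_def by simp
      then show "[fA v T' x = fB v T' x] (mod int 2)" using del[OF vTu(1) x, of T'] 
        unfolding cong_iff_dvd_diff by presburger
    next
      show "0 < (2::nat)" by simp
    next
      fix L m assume "L \<in> NN" "L \<subseteq> M" "\<And>x. x \<in> fix_set A L {\<sigma> u} \<Longrightarrow> [fA v T' x = m] (mod int 2)"
       "\<And>x. x \<in> fix_set B L {\<sigma> u} \<Longrightarrow> [fB v T' x = m] (mod int 2)"
      then show ?thesis by (intro exI[of _ L] exI[of _ m]) auto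
    qed
  qed
  then obtain L\<mu> \<mu> where \<mu>: "\<And>v T' u. v \<in> I \<Longrightarrow> T' \<in> TT \<Longrightarrow> u \<in> I - T' \<Longrightarrow> L\<mu> v T' u \<in> NN \<and> L\<mu> v T' u \<subseteq> M \<and>
     (\<forall>x\<in>fix_set A (L\<mu> v T' u) {\<sigma> u}. [fA v T' x = \<mu> v T' u] (mod int 2)) \<and>
     (\<forall>x\<in>fix_set B (L\<mu> v T' u) {\<sigma> u}. [fB v T' x = \<mu> v T' u] (mod int 2))" by metis
  define F where "F = insert M (\<Union>v\<in>I. \<Union>T'\<in>TT. \<Union>u\<in>I - T'. {L\<mu> v T' u})"
  have "finite F" "F \<subseteq> NN" unfolding F_def using fin finTT \<mu> M(1) by auto
  from common_level[OF this] obtain L where L: "L \<in> NN" "\<And>N. N \<in> F \<Longrightarrow> L \<subseteq> N"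
    by (elim bexE) (rule that, assumption, erule bspec)
  have LM: "L \<subseteq> M" using L(2) unfolding F_def by blast
  have \<mu>A: "[fA v T' x = \<mu> v T' u] (mod int 2)" if "v \<in> I" "T' \<in> TT" "u \<in> I - T'" "x \<in> fix_set A L {\<sigma> u}" for v T' u x
  proof -
    have "L \<subseteq> L\<mu> v T' u" using L(2) that unfolding F_def by blast
    then have "x \<in> fix_set A (L\<mu> v T' u) {\<sigma> u}" using subsetD[OF fix_set_mono[OF order_refl _ order_refl] that(4)] by blast
    then show ?thesis using \<mu>[OF that(1-3)] by blast
  qed
  have \<mu>B: "[fB v T' x = \<mu> v T' u] (mod int 2)" if "v \<in> I" "T' \<in> TT" "u \<in> I - T'" "x \<in> fix_set B L {\<sigma> u}" for v T' u x
  proof -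
    have "L \<subseteq> L\<mu> v T' u" using L(2) that unfolding F_def by blast
    then have "x \<in> fix_set B (L\<mu> v T' u) {\<sigma> u}" using subsetD[OF fix_set_mono[OF order_refl _ order_refl] that(4)] by blast
    then show ?thesis using \<mu>[OF that(1-3)] by blast
  qed
  \<comment> \<open>A vertex fixed by both elements lies on both fixed trees and forces the two
    constants to agree.\<close>
  have \<mu>adj: "[\<mu> v T' u = \<mu> v T' w] (mod int 2)" 
    if vT: "v \<in> I" "T' \<in> TT" "u \<in> I - T'" "w \<in> I - T'" "adj u w" for v T' u w
  proof -
    have "fix_nonempty {\<sigma> u, \<sigma> w}" using adjne vT by blast
    then consider (a) x where "x \<in> fix_set A L {\<sigma> u, \<sigma> w}" | (b) x where "x \<in> fix_set B L {\<sigma> u, \<sigma> w}"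
      using L(1) unfolding fix_nonempty_def by blast
    then show ?thesis
    proof cases
      case a
      then have "x \<in> fix_set A L {\<sigma> u}" "x \<in> fix_set A L {\<sigma> w}" by (auto simp: fix_set_def)
      then show ?thesis using \<mu>A[OF vT(1,2,3)] \<mu>A[OF vT(1,2,4)] by (metis cong_sym cong_trans)
    next
      case b
      then have "x \<in> fix_set B L {\<sigma> u}" "x \<in> fix_set B L {\<sigma> w}" by (auto simp: fix_set_def)
      then show ?thesis using \<mu>B[OF vT(1,2,3)] \<mu>B[OF vT(1,2,4)] by (metis cong_sym cong_trans)
    qed
  qed
  define r where "r T' = (SOME u. u \<in> I - T')" for T'
  have rI: "r T' \<in> I - T'" if "u \<in> I - T'" for u T' unfolding r_def using that by (rule someI)
  define m where "m v T' = (if v \<in> T' then 0 else \<mu> v T' (r T'))" for v T'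
  have \<mu>r: "[\<mu> v T' u = \<mu> v T' (r T')] (mod int 2)" if v: "v \<in> I" and T': "T' \<in> TT" and u: "u \<in> I - T'" for v T' u
  proof -
    define Z where "Z = {w \<in> I - T'. [\<mu> v T' w = \<mu> v T' (r T')] (mod int 2)}"
    obtain x where x: "x \<in> carrier G" "T' = T x" using T' unfolding TT_def by auto
    have "Z = I - T'"
    proof (rule conn[OF x(1)])
      show "T' = {v \<in> I. x \<in> fix_set C N0 {\<sigma> v}}" using x(2) unfolding T_def .
      show "Z \<subseteq> I - T'" unfolding Z_def by blast
      have "r T' \<in> Z" unfolding Z_def using rI[OF u] by simp
      then show "Z \<noteq> {}" by blast
      show "w' \<in> Z" if "w \<in> Z" "w' \<in> I - T'" "adj w w'" for w w'
        using that \<mu>adj[OF v T', of w w'] unfolding Z_def by (auto intro: cong_trans[OF cong_sym])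
    qed
    then show ?thesis using u unfolding Z_def by blast
  qed
  have mA: "[fA v T' x = m v T'] (mod int 2)" if "v \<in> I" "T' \<in> TT" "u \<in> I - T'" "x \<in> fix_set A L {\<sigma> u}" for v T' u x
    using cong_trans[OF \<mu>A[OF that] \<mu>r[OF that(1-3)]] q1(5)[OF that(1)] unfolding m_def by simp
  have mB: "[fB v T' x = m v T'] (mod int 2)" if "v \<in> I" "T' \<in> TT" "u \<in> I - T'" "x \<in> fix_set B L {\<sigma> u}" for v T' u x
    using cong_trans[OF \<mu>B[OF that] \<mu>r[OF that(1-3)]] q1(6)[OF that(1)] unfolding m_def by simp
  have vert: "(\<exists>x. x \<in> fix_set A L {\<sigma> v}) \<or> (\<exists>x. x \<in> fix_set B L {\<sigma> v})" if "v \<in> I" for v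
    using gd[OF that] L(1) unfolding fix_tree_def fix_nonempty_def by blast
  have fL: "x \<in> carrier G \<and> x \<in> fix_set S N0 {\<sigma> v}" if "x \<in> fix_set S L {\<sigma> v}" for S v x
    using subsetD[OF fix_set_mono[OF order_refl order_trans[OF LM M(2)] order_refl] that] that unfolding fix_set_def by auto
  \<comment> \<open>Evaluation at a vertex fixed by \<sigma> v, where the indicator of v is
    0.\<close>
  have kv: "[k v = (\<Sum>T'\<in>TT. m v T')] (mod int 2)" if v: "v \<in> I" for v
  proof -
    have *: "[k v = (\<Sum>T'\<in>TT. m v T')] (mod int 2)" 
      if "x \<in> carrier G" "Dx = 0" "[(\<Sum>T'\<in>TT. f T' x) - Dx = k v] (mod int 2)"
       "\<And>T'. T' \<in> TT \<Longrightarrow> v \<notin> T' \<Longrightarrow> [f T' x = m v T'] (mod int 2)" "\<And>T'. v \<in> T' \<Longrightarrow> f T' = (\<lambda>_. 0)" 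
      for x Dx and f :: "'i set \<Rightarrow> 'a \<Rightarrow> int"
    proof -
      have "[(\<Sum>T'\<in>TT. f T' x) = (\<Sum>T'\<in>TT. m v T')] (mod int 2)"
      proof (rule cong_sum)
        fix T' assume "T' \<in> TT"
        then show "[f T' x = m v T'] (mod int 2)" using that(4,5) by (cases "v \<in> T'") (auto simp: m_def)
      qed
      then show ?thesis using that(2,3) by (simp add: cong_def)
    qed
    from vert[OF v] show ?thesis
    proof (elim disjE exE)
      fix x assume x: "x \<in> fix_set A L {\<sigma> v}"
      show ?thesis 
        by (rule *[of x "D A v x" "fA v", OF conjunct1[OF fL[OF x]] D0[OF conjunct2[OF fL[OF x]] eA] k(1)[OF v conjunct1[OF fL[OF x]]]])
          (rule mA[OF v _ _ x] q1(5)[OF v], use v in auto)+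
    next
      fix x assume x: "x \<in> fix_set B L {\<sigma> v}"
      show ?thesis 
        by (rule *[of x "D B v x" "fB v", OF conjunct1[OF fL[OF x]] D0[OF conjunct2[OF fL[OF x]] eB] k(2)[OF v conjunct1[OF fL[OF x]]]])
          (rule mB[OF v _ _ x] q1(6)[OF v], use v in auto)+
    qed
  qed
  \<comment> \<open>Evaluation at a vertex fixed by the element of the chosen index outside T'; if
    there is no such index, all parts for T' are zero.\<close>
  have cT: "[c T' = (\<Sum>v\<in>I. m v T')] (mod int 2)" if T': "T' \<in> TT" for T'
  proof (cases "I - T' = {}")
    case True
    then have "v \<in> T'" if "v \<in> I" for v using that by blast
    then have "(\<Sum>v\<in>I. fA v T' \<one>) = 0" "(\<Sum>v\<in>I. m v T') = 0" using q1(5) unfolding m_def by auto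
    then show ?thesis using c(1)[OF T', of \<one>] by (simp add: cong_sym_eq)
  next
    case False
    then have r: "r T' \<in> I - T'" using rI by blast
    then have "r T' \<in> I" by blast
    from vert[OF this] show ?thesis
    proof (elim disjE exE)
      fix x assume x: "x \<in> fix_set A L {\<sigma> (r T')}"
      have "[(\<Sum>v\<in>I. fA v T' x) = (\<Sum>v\<in>I. m v T')] (mod int 2)"
        by (rule cong_sum) (use mA[OF _ T' r x] in auto)
      then show ?thesis using c(1)[OF T', of x] fL[OF x] by (metis cong_sym cong_trans)
    next
      fix x assume x: "x \<in> fix_set B L {\<sigma> (r T')}"
      have "[(\<Sum>v\<in>I. fB v T' x) = (\<Sum>v\<in>I. m v T')] (mod int 2)"
        by (rule cong_sum) (use mB[OF _ T' r x] in auto)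
      then show ?thesis using c(2)[OF T', of x] fL[OF x] by (metis cong_sym cong_trans)
    qed
  qed
  \<comment> \<open>Double counting at the unit: summed by types, the values of the parts give the
    double sum of the constants m; summed by v, they give the same double sum plus 1, the total of
    the indicators.\<close>
  have "[(\<Sum>v\<in>I. (\<Sum>T'\<in>TT. fA v T' \<one>) - D A v \<one>) = (\<Sum>v\<in>I. \<Sum>T'\<in>TT. m v T')] (mod int 2)"
    by (rule cong_sum) (use k(1)[of _ \<one>] kv in \<open>auto intro: cong_trans\<close>)
  then have 1: "[(\<Sum>v\<in>I. \<Sum>T'\<in>TT. fA v T' \<one>) - 1 = (\<Sum>v\<in>I. \<Sum>T'\<in>TT. m v T')] (mod int 2)"
    unfolding sum_subtractf using Dsum[OF one_closed eA] by simp
  have "[(\<Sum>T'\<in>TT. \<Sum>v\<in>I. fA v T' \<one>) = (\<Sum>T'\<in>TT. \<Sum>v\<in>I. m v T')] (mod int 2)"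
    by (rule cong_sum) (use c(1)[of _ \<one>] cT in \<open>auto intro: cong_trans\<close>)
  then have 2: "[(\<Sum>v\<in>I. \<Sum>T'\<in>TT. fA v T' \<one>) = (\<Sum>v\<in>I. \<Sum>T'\<in>TT. m v T')] (mod int 2)"
    by (subst (1 2) sum.swap)
  show False using dvd_diff[OF 2[unfolded cong_iff_dvd_diff] 1[unfolded cong_iff_dvd_diff]] by simp
qed

end

section \<open>Ends and almost invariant sets\<close>

context group
begin

text \<open>Applied to the inverse of g, the condition also bounds the elements outside D that right
  multiplication by g carries into D; so D and its right translates differ by finite sets.\<close>

definition almost_inv :: "'a set \<Rightarrow> bool" where
  "almost_inv D \<longleftrightarrow> D \<subseteq> carrier G \<and> (\<forall>g\<in>carrier G. finite {x \<in> D. x \<otimes> g \<notin> D})"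

text \<open>At least n ends, expressed without a generating set; this makes the choice hidden in
  \<open>group_ends\<close> harmless.\<close>

definition many_ends :: "nat \<Rightarrow> bool" where
  "many_ends n \<longleftrightarrow> (\<exists>D :: nat \<Rightarrow> 'a set. (\<forall>i<n. infinite (D i) \<and> almost_inv (D i)) \<and>
     (\<forall>i<n. \<forall>j<n. i \<noteq> j \<longrightarrow> D i \<inter> D j = {}))"

lemma finite_right_preimage:
  assumes "finite K" "g \<in> carrier G" "M \<subseteq> carrier G" "\<And>x. x \<in> M \<Longrightarrow> x \<otimes> g \<in> K"
  shows "finite M"
proof (rule inj_on_finite[OF _ _ assms(1)])
  show "inj_on (\<lambda>x. x \<otimes> g) M" using inj_on_subset[OF inj_on_multc[OF assms(2)] assms(3)] .
  show "(\<lambda>x. x \<otimes> g) ` M \<subseteq> K" using assms(4) by auto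
qed

text \<open>Under a product g h a point leaves D either already under g or afterwards under h. Right
  multiplication by g moves the points of the second kind injectively into a finite set.\<close>

lemma almost_inv_generate:
  assumes D: "D \<subseteq> carrier G" and S: "S \<subseteq> carrier G" "generate G S = carrier G"
    and s: "\<And>s. s \<in> S \<Longrightarrow> finite {x \<in> D. x \<otimes> s \<notin> D}" "\<And>s. s \<in> S \<Longrightarrow> finite {x \<in> D. x \<otimes> inv s \<notin> D}"
  shows "almost_inv D"
proof -
  have "finite {x \<in> D. x \<otimes> g \<notin> D}" if "g \<in> generate G S" for g
    using that
  proof (induction rule: generate.induct)
    case one
    have "{x \<in> D. x \<otimes> \<one> \<notin> D} = {}" using D by auto
    then show ?case by (simp only: finite.emptyI)
  next
    case (incl h)
    then show ?case using s by blast
  next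
    case (inv h)
    then show ?case using s by blast
  next
    case (eng g h)
    have c: "g \<in> carrier G" "h \<in> carrier G" using eng.hyps S(2) by auto
    have "finite {x \<in> D. x \<otimes> g \<in> D \<and> x \<otimes> (g \<otimes> h) \<notin> D}"
      by (rule finite_right_preimage[OF eng.IH(2) c(1)]) (use D c in \<open>auto simp: m_assoc\<close>)
    moreover have "{x \<in> D. x \<otimes> (g \<otimes> h) \<notin> D} \<subseteq> {x \<in> D. x \<otimes> g \<notin> D} \<union> {x \<in> D. x \<otimes> g \<in> D \<and> x \<otimes> (g \<otimes> h) \<notin> D}"
      by auto
    ultimately show ?case using eng.IH(1) finite_subset by blast
  qed
  then show ?thesis using D S(2) unfolding almost_inv_def by simp
qed

text \<open>K collects the points at which an edge leaves some D i, so outside K a path stays in its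
  D i. Every component outside K meets the finite neighbourhood of K; if all components inside D i
  were finite, D i would be finite.\<close>

lemma ends_wrt_ge:
  assumes S: "finite S" "S \<subseteq> carrier G" "generate G S = carrier G" and AI: "many_ends n"
  shows "enat n \<le> ends_wrt G S"
proof (cases "n = 0")
  case True
  then show ?thesis by (simp add: zero_enat_def[symmetric])
next
  case False
  obtain D where D: "\<And>i. i < n \<Longrightarrow> infinite (D i) \<and> almost_inv (D i)"
    "\<And>i j. i < n \<Longrightarrow> j < n \<Longrightarrow> i \<noteq> j \<Longrightarrow> D i \<inter> D j = {}"
    using AI unfolding many_ends_def by blast
  have Dc: "D i \<subseteq> carrier G" if "i < n" for i using D(1)[OF that] unfolding almost_inv_def by blast
  \<comment> \<open>The unit is included so that every element is reached by a path that starts in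
    K.\<close>
  define K where "K = insert \<one> (\<Union>i<n. \<Union>s\<in>S. {x \<in> D i. x \<otimes> s \<notin> D i} \<union> {x \<in> D i. x \<otimes> inv s \<notin> D i})"
  have K: "finite K" "K \<subseteq> carrier G"
  proof -
    have "finite {x \<in> D i. x \<otimes> s \<notin> D i}" "finite {x \<in> D i. x \<otimes> inv s \<notin> D i}" if "i < n" "s \<in> S" for i s
      using D(1)[OF that(1)] that(2) S(2) unfolding almost_inv_def by auto
    then show "finite K" unfolding K_def using S(1) by auto
    show "K \<subseteq> carrier G" unfolding K_def using Dc by fastforce
  qed
  define Ed where "Ed = {(x, y) \<in> cayley_edges G S. x \<notin> K \<and> y \<notin> K}"
  define comp where "comp x = {y. (x, y) \<in> Ed\<^sup>*}" for x
  have "symp (\<lambda>x y. (x, y) \<in> Ed)" unfolding Ed_def cayley_edges_def symp_def by auto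
  then have symEd: "sym (Ed\<^sup>*)" by (intro sym_rtrancl) (auto simp: sym_def symp_def)
  have compeq: "comp x = comp y" if "(x, y) \<in> Ed\<^sup>*" for x y
    unfolding comp_def using that symEd by (auto simp: sym_def intro: rtrancl_trans)
  have stay: "y \<in> D i" if "(x, y) \<in> Ed\<^sup>*" "x \<in> D i" "i < n" for x y i
    using that
  proof (induction rule: rtrancl_induct)
    case (step y z)
    then have y: "y \<in> D i" by simp
    from step.hyps(2) obtain s where s: "s \<in> S" "z = y \<otimes> s \<or> y = z \<otimes> s" "y \<notin> K" "y \<in> carrier G" "z \<in> carrier G"
      unfolding Ed_def cayley_edges_def by auto
    have sc: "s \<in> carrier G" using s S by auto
    have "z = y \<otimes> s \<or> z = y \<otimes> inv s" using s sc by (auto simp: m_assoc)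
    then show ?case using s(1,3) y \<open>i < n\<close> unfolding K_def by blast
  qed simp
  define Nb where "Nb = (\<Union>k\<in>K. \<Union>s\<in>S. {k \<otimes> s, k \<otimes> inv s})"
  have finNb: "finite Nb" unfolding Nb_def using K S by auto
  define Q where "Q y \<longleftrightarrow> y \<in> K \<or> (\<exists>z\<in>Nb. (z, y) \<in> Ed\<^sup>*)" for y
  have Qstep: "Q y'" if Qy: "Q y" and e: "(y, y') \<in> cayley_edges G S" "y \<in> K \<Longrightarrow> y' \<in> Nb" for y y'
  proof (cases "y' \<in> K")
    case False
    show ?thesis
    proof (cases "y \<in> K")
      case True
      then show ?thesis using e(2) unfolding Q_def by blast
    next
      case yK: False
      then have "(y, y') \<in> Ed" unfolding Ed_def using e(1) False by auto
      then show ?thesis using Qy yK unfolding Q_def by (meson rtrancl.rtrancl_into_rtrancl)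
    qed
  qed (simp add: Q_def)
  have Qgen: "\<forall>y\<in>carrier G. Q y \<longrightarrow> Q (y \<otimes> g)" if "g \<in> generate G S" for g
    using that
  proof (induction rule: generate.induct)
    case one
    then show ?case by simp
  next
    case (incl s)
    show ?case
    proof (intro ballI impI)
      fix y assume y: "y \<in> carrier G" "Q y"
      have s: "s \<in> carrier G" using incl S by auto
      show "Q (y \<otimes> s)"
        by (rule Qstep[OF y(2)]) (use incl y s in \<open>auto simp: cayley_edges_def Nb_def\<close>)
    qed
  next
    case (inv s)
    show ?case
    proof (intro ballI impI)
      fix y assume y: "y \<in> carrier G" "Q y"
      have s: "s \<in> carrier G" using inv S by auto
      have "y = y \<otimes> inv s \<otimes> s" using y s by (simp add: m_assoc)
      then have "(y, y \<otimes> inv s) \<in> cayley_edges G S" unfolding cayley_edges_def using inv y s by auto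
      then show "Q (y \<otimes> inv s)"
        by (rule Qstep[OF y(2)]) (use inv in \<open>auto simp: Nb_def\<close>)
    qed
  next
    case (eng g h)
    then have c: "g \<in> carrier G" "h \<in> carrier G" using S by auto
    then show ?case using eng.IH by (simp add: m_assoc[symmetric])
  qed
  have Q: "Q x" if "x \<in> carrier G" for x
  proof -
    have "\<forall>y\<in>carrier G. Q y \<longrightarrow> Q (y \<otimes> x)" using Qgen[of x] that S(3) by simp
    moreover have "Q \<one>" unfolding Q_def K_def by simp
    ultimately have "Q (\<one> \<otimes> x)" by blast
    then show ?thesis using that by simp
  qed
  have "\<exists>C. infinite C \<and> C \<in> cayley_components G S K \<and> C \<subseteq> D i" if i: "i < n" for i
  proof (rule ccontr)
    assume none: "\<not> ?thesis"
    have "D i - K \<subseteq> (\<Union>z\<in>{z \<in> Nb. finite (comp z)}. comp z)"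
    proof
      fix x assume x: "x \<in> D i - K"
      then have xc: "x \<in> carrier G" using Dc i by auto
      obtain z where z: "z \<in> Nb" "(z, x) \<in> Ed\<^sup>*" using Q[OF xc] x unfolding Q_def by auto
      have "comp x \<subseteq> D i" using stay i x unfolding comp_def by blast
      moreover have "comp x \<in> cayley_components G S K" 
        unfolding cayley_components_def Let_def comp_def Ed_def using x xc by auto
      ultimately have "finite (comp x)" using none by blast
      then have "finite (comp z)" using compeq[OF z(2)] by simp
      then show "x \<in> (\<Union>z\<in>{z \<in> Nb. finite (comp z)}. comp z)" using z unfolding comp_def by auto
    qed
    then have "finite (D i - K)" by (rule finite_subset) (use finNb in auto)
    then show False using D(1)[OF i] K(1) by (metis Diff_infinite_finite)
  qed
  then obtain C where C: "\<And>i. i < n \<Longrightarrow> infinite (C i) \<and> C i \<in> cayley_components G S K \<and> C i \<subseteq> D i" by metis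
  have inj: "inj_on C {..<n}"
  proof (rule inj_onI)
    fix i j assume ij: "i \<in> {..<n}" "j \<in> {..<n}" "C i = C j"
    have "C i \<noteq> {}" using C[of i] ij by auto
    then have "D i \<inter> D j \<noteq> {}" using C[of i] C[of j] ij by auto
    then show "i = j" using D(2)[of i j] ij by auto
  qed
  have sub: "C ` {..<n} \<subseteq> {C \<in> cayley_components G S K. infinite C}" using C by auto
  have "enat n \<le> ecard {C \<in> cayley_components G S K. infinite C}"
    using card_mono[OF _ sub] card_image[OF inj] unfolding ecard_def by auto
  also have "\<dots> \<le> ends_wrt G S" unfolding ends_wrt_def using K by (intro SUP_upper) auto
  finally show ?thesis .
qed

text \<open>The infinite components outside K are themselves almost invariant, because an edge that
  leaves a component ends in the finite set K.\<close>

lemma ends_wrt_le: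
  assumes S: "finite S" "S \<subseteq> carrier G" "generate G S = carrier G" and le: "enat n \<le> ends_wrt G S"
  shows "many_ends n"
proof (cases "n = 0")
  case True
  then show ?thesis unfolding many_ends_def by simp
next
  case False
  \<comment> \<open>A single K already reaches the count n: otherwise all counts, and with them the
    supremum, would be at most n - 1, which is smaller than n as n is positive.\<close>
  have "\<exists>K. finite K \<and> K \<subseteq> carrier G \<and> enat n \<le> ecard {C \<in> cayley_components G S K. infinite C}"
  proof (rule ccontr)
    assume "\<not> ?thesis"
    then have lt: "ecard {C \<in> cayley_components G S K. infinite C} < enat n" if "finite K" "K \<subseteq> carrier G" for K
      using that by (auto simp: not_le)
    have "ecard {C \<in> cayley_components G S K. infinite C} \<le> enat (n - 1)" if "finite K" "K \<subseteq> carrier G" for K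
      using lt[OF that] by (cases "ecard {C \<in> cayley_components G S K. infinite C}") auto
    then have "ends_wrt G S \<le> enat (n - 1)" unfolding ends_wrt_def by (intro SUP_least) auto
    then have "enat n \<le> enat (n - 1)" using le by (rule order_trans[rotated])
    then show False using False by simp
  qed
  then obtain K where K: "finite K" "K \<subseteq> carrier G" "enat n \<le> ecard {C \<in> cayley_components G S K. infinite C}"
    by blast
  define Ed where "Ed = {(x, y) \<in> cayley_edges G S. x \<notin> K \<and> y \<notin> K}"
  define CC where "CC = {C \<in> cayley_components G S K. infinite C}"
  have "symp (\<lambda>x y. (x, y) \<in> Ed)" unfolding Ed_def cayley_edges_def symp_def by auto
  then have symEd: "sym (Ed\<^sup>*)" by (intro sym_rtrancl) (auto simp: sym_def symp_def)
  have CCE: "\<exists>x\<in>carrier G - K. C = {y. (x, y) \<in> Ed\<^sup>*}" if "C \<in> CC" for C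
    using that unfolding CC_def cayley_components_def Let_def Ed_def by auto
  have disj: "C \<inter> C' = {}" if CC: "C \<in> CC" "C' \<in> CC" "C \<noteq> C'" for C C'
  proof (rule ccontr)
    assume "C \<inter> C' \<noteq> {}"
    then obtain z where z: "z \<in> C" "z \<in> C'" by auto
    obtain x where x: "C = {y. (x, y) \<in> Ed\<^sup>*}" using CCE[OF CC(1)] by auto
    obtain x' where x': "C' = {y. (x', y) \<in> Ed\<^sup>*}" using CCE[OF CC(2)] by auto
    have "(x, z) \<in> Ed\<^sup>*" "(x', z) \<in> Ed\<^sup>*" using z x x' by auto
    then have "(x, x') \<in> Ed\<^sup>*" "(x', x) \<in> Ed\<^sup>*" using symEd unfolding sym_def by (meson rtrancl_trans)+
    then have "C = C'" unfolding x x' by (auto intro: rtrancl_trans)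
    then show False using CC(3) by simp
  qed
  have ai: "almost_inv C" if "C \<in> CC" for C
  proof -
    obtain x where x: "x \<in> carrier G - K" "C = {y. (x, y) \<in> Ed\<^sup>*}" using CCE[OF \<open>C \<in> CC\<close>] by auto
    have Cc: "y \<in> carrier G \<and> y \<notin> K" if "y \<in> C" for y
    proof -
      have "(x, y) \<in> Ed\<^sup>*" using that x by auto
      then show ?thesis using x(1) by (induction rule: rtrancl_induct) (auto simp: Ed_def cayley_edges_def)
    qed
    have out: "z \<in> K" if "y \<in> C" "(y, z) \<in> cayley_edges G S" "z \<notin> C" for y z
    proof (rule ccontr)
      assume "z \<notin> K"
      then have "(y, z) \<in> Ed" using Cc that unfolding Ed_def by auto
      then show False using that x by (auto intro: rtrancl.rtrancl_into_rtrancl)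
    qed
    show ?thesis
    proof (rule almost_inv_generate[OF _ S(2,3)])
      show "C \<subseteq> carrier G" using Cc by auto
      fix s assume s: "s \<in> S"
      then have sc: "s \<in> carrier G" using S by auto
      show "finite {x \<in> C. x \<otimes> s \<notin> C}"
      proof (rule finite_right_preimage[OF K(1) sc])
        fix y assume y: "y \<in> {x \<in> C. x \<otimes> s \<notin> C}"
        then show "y \<otimes> s \<in> K" using Cc sc s by (intro out[of y]) (auto simp: cayley_edges_def)
      qed (use Cc in auto)
      show "finite {x \<in> C. x \<otimes> inv s \<notin> C}"
      proof (rule finite_right_preimage[OF K(1), of "inv s"])
        fix y assume y: "y \<in> {x \<in> C. x \<otimes> inv s \<notin> C}"
        then have yc: "y \<in> carrier G" using Cc by auto
        then have "y = y \<otimes> inv s \<otimes> s" using sc by (simp add: m_assoc)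
        then show "y \<otimes> inv s \<in> K" using Cc sc s y yc by (intro out[of y]) (auto simp: cayley_edges_def)
      qed (use Cc sc in auto)
    qed
  qed
  have "\<exists>f. inj_on f {..<n} \<and> f ` {..<n} \<subseteq> CC"
  proof (cases "finite CC")
    case True
    then have "n \<le> card CC" using K(3) unfolding CC_def[symmetric] ecard_def by simp
    then obtain T where "T \<subseteq> CC" "card T = n" "finite T" by (meson obtain_subset_with_card_n True finite_subset)
    then obtain f where "bij_betw f {..<n} T" using ex_bij_betw_nat_finite[of T] unfolding lessThan_atLeast0[symmetric] by auto
    then show ?thesis using \<open>T \<subseteq> CC\<close> unfolding bij_betw_def by auto
  next
    case False
    then obtain f :: "nat \<Rightarrow> 'a set" where "inj f" "range f \<subseteq> CC" using infinite_countable_subset by blast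
    then show ?thesis by (intro exI[of _ f]) (auto intro: inj_on_subset)
  qed
  then obtain f where f: "inj_on f {..<n}" "f ` {..<n} \<subseteq> CC" by blast
  have fCC: "f i \<in> CC" if "i < n" for i using f(2) that by auto
  show ?thesis unfolding many_ends_def
  proof (intro exI[of _ f] conjI allI impI)
    fix i assume i: "i < n"
    show "infinite (f i)" using fCC[OF i] unfolding CC_def by blast
    show "almost_inv (f i)" using ai[OF fCC[OF i]] .
    fix j assume j: "j < n" "i \<noteq> j"
    then have "f i \<noteq> f j" using f(1) i unfolding inj_on_def by auto
    then show "f i \<inter> f j = {}" using disj[OF fCC[OF i] fCC[OF j(1)]] by blast
  qed
qed

lemma group_ends_ge_iff:
  assumes "\<exists>S. finite S \<and> S \<subseteq> carrier G \<and> generate G S = carrier G"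
  shows "enat n \<le> group_ends G \<longleftrightarrow> many_ends n"
proof -
  define S where "S = (SOME S. finite S \<and> S \<subseteq> carrier G \<and> generate G S = carrier G)"
  have "finite S \<and> S \<subseteq> carrier G \<and> generate G S = carrier G" unfolding S_def by (rule someI_ex[OF assms])
  then have S: "finite S" "S \<subseteq> carrier G" "generate G S = carrier G" by auto
  show ?thesis unfolding group_ends_def S_def[symmetric] using ends_wrt_ge[OF S] ends_wrt_le[OF S] by (rule iffI[rotated])
qed

text \<open>For a fixed exponent this is a law in two variables, so it passes to images and, under
  residual finiteness, back from the finite quotients.\<close>

definition powers_commute :: "nat \<Rightarrow> bool" where
  "powers_commute n \<longleftrightarrow> (\<forall>x\<in>carrier G. \<forall>y\<in>carrier G. x [^] n \<otimes> y [^] n = y [^] n \<otimes> x [^] n)"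

lemma many_ends_0: "many_ends 0"
  unfolding many_ends_def by simp

lemma many_ends_finite: "finite (carrier G) \<Longrightarrow> many_ends n \<Longrightarrow> n = 0"
  unfolding many_ends_def almost_inv_def using finite_subset by (metis gr0I)

lemma many_ends_1: "infinite (carrier G) \<Longrightarrow> many_ends 1"
proof -
  have "{x \<in> carrier G. x \<otimes> g \<notin> carrier G} = {}" if "g \<in> carrier G" for g using that by auto
  then have "almost_inv (carrier G)" unfolding almost_inv_def by (metis finite.emptyI order_refl)
  then show "infinite (carrier G) \<Longrightarrow> many_ends 1" unfolding many_ends_def by (intro exI[of _ "\<lambda>_. carrier G"]) auto
qed

lemma many_ends_mono: "many_ends n \<Longrightarrow> m \<le> n \<Longrightarrow> many_ends m"
  unfolding many_ends_def by (meson order_less_le_trans)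

end

text \<open>Only finitely many points of J have a neighbour outside J. A point of J beyond all of
  them propagates outwards without end.\<close>

lemma int_almost_invariant:
  fixes J :: "int set"
  assumes "infinite J" "finite {i \<in> J. i + 1 \<notin> J}" "finite {i \<in> J. i - 1 \<notin> J}"
  shows "\<exists>i. {i..} \<subseteq> J \<or> {..i} \<subseteq> J"
proof -
  define F where "F = {i \<in> J. i + 1 \<notin> J} \<union> {i \<in> J. i - 1 \<notin> J}"
  have "finite F" unfolding F_def using assms by auto
  then obtain M where M: "\<And>i. i \<in> F \<Longrightarrow> \<bar>i\<bar> \<le> M" 
    by (meson Max_ge finite_imageI imageI)
  have "\<not> J \<subseteq> {-M..M}" using assms(1) finite_subset by blast
  then obtain i where i: "i \<in> J" "i < -M \<or> i > M" by (auto simp: subset_iff not_le)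
  from i(2) show ?thesis
  proof
    assume "i > M"
    have "j \<in> J" if "j \<ge> i" for j
      using that
    proof (induction j rule: int_ge_induct)
      case (step j)
      then have "j \<notin> F" using M[of j] \<open>i > M\<close> by auto
      then show ?case using step unfolding F_def by auto
    qed (rule i(1))
    then show ?thesis by auto
  next
    assume "i < - M"
    have "j \<in> J" if "j \<le> i" for j
      using that
    proof (induction j rule: int_le_induct)
      case (step j)
      then have "j \<notin> F" using M[of j] \<open>i < - M\<close> by auto
      then show ?case using step unfolding F_def by auto
    qed (rule i(1))
    then show ?thesis by auto
  qed
qed

section \<open>Groups with a cyclic subgroup of finite index\<close>

context group
begin

text \<open>Among the powers of x with exponents 0 to card F two have the same representative in F,
  so some power of x with a positive exponent at most card F is a power of t. The factorial is a
  common multiple of all such exponents.\<close>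

lemma virtually_cyclic_powers_commute:
  assumes t: "t \<in> carrier G" and F: "finite F" "F \<subseteq> carrier G"
    and cov: "\<And>x. x \<in> carrier G \<Longrightarrow> \<exists>i::int. \<exists>f\<in>F. x = t [^] i \<otimes> f"
  shows "powers_commute (fact (card F))"
proof -
  have pw: "\<exists>c::int. x [^] (fact (card F) :: nat) = t [^] c" if x: "x \<in> carrier G" for x
  proof -
    obtain a g where ag: "\<And>i::nat. g i \<in> F \<and> x [^] i = t [^] (a i :: int) \<otimes> g i"
      using cov[OF nat_pow_closed[OF x]] by metis
    have "\<not> inj_on g {..card F}"
    proof
      assume "inj_on g {..card F}"
      then have "card {..card F} \<le> card F" using ag F(1) by (intro card_inj_on_le) auto
      then show False by simp
    qed
    then obtain i j where ij: "i < j" "j \<le> card F" "g i = g j"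
      unfolding inj_on_def by (metis atMost_iff nat_neq_iff)
    have gc: "g i \<in> carrier G" using ag F by auto
    have "x [^] (j - i) \<otimes> x [^] i = x [^] j" using x ij by (simp add: nat_pow_mult)
    then have "x [^] (j - i) = x [^] j \<otimes> inv (x [^] i)" using x by (metis inv_solve_right nat_pow_closed)
    also have "\<dots> = t [^] a j \<otimes> g i \<otimes> inv (t [^] a i \<otimes> g i)" using ag[of i] ag[of j] ij(3) by simp
    also have "\<dots> = t [^] a j \<otimes> inv (t [^] a i)" using t gc by (simp add: inv_mult_group m_assoc) (simp add: m_assoc[symmetric])
    also have "\<dots> = t [^] (a j - a i)" using t by (simp add: int_pow_diff)
    finally have e: "x [^] (j - i) = t [^] (a j - a i)" .
    have "(j - i) dvd fact (card F)" using ij by (intro dvd_fact) auto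
    then obtain q where q: "fact (card F) = (j - i) * q" by auto
    have "x [^] (fact (card F) :: nat) = (x [^] (j - i)) [^] q" unfolding q using x by (simp add: nat_pow_pow)
    also have "\<dots> = t [^] ((a j - a i) * int q)" unfolding e using t by (simp add: int_pow_pow int_pow_int[symmetric])
    finally show ?thesis by blast
  qed
  show ?thesis unfolding powers_commute_def
  proof (intro ballI)
    fix x y assume "x \<in> carrier G" "y \<in> carrier G"
    then obtain c d :: int where "x [^] (fact (card F) :: nat) = t [^] c" "y [^] (fact (card F) :: nat) = t [^] d" using pw by blast
    then show "x [^] (fact (card F) :: nat) \<otimes> y [^] (fact (card F) :: nat) = y [^] (fact (card F) :: nat) \<otimes> x [^] (fact (card F) :: nat)"
      using t by (simp add: int_pow_mult[symmetric] add.commute)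
  qed
qed

text \<open>An infinite almost invariant set contains all sufficiently high or all sufficiently low
  powers of t. Disjoint sets cannot share a direction, and there are only two.\<close>

lemma virtually_cyclic_ends:
  assumes t: "t \<in> carrier G" and F: "finite F" "F \<subseteq> carrier G"
    and cov: "\<And>x. x \<in> carrier G \<Longrightarrow> \<exists>i::int. \<exists>f\<in>F. x = t [^] i \<otimes> f"
  shows "\<not> many_ends 3"
proof
  assume "many_ends 3"
  then obtain D where D: "\<And>i. i < 3 \<Longrightarrow> infinite (D i) \<and> almost_inv (D i)"
    "\<And>i j. i < 3 \<Longrightarrow> j < (3::nat) \<Longrightarrow> i \<noteq> j \<Longrightarrow> D i \<inter> D j = {}"
    unfolding many_ends_def by blast
  have "infinite (carrier G)" using D(1)[of 0] unfolding almost_inv_def using finite_subset by auto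
  then have "infinite (range (\<lambda>i::int. t [^] i))"
  proof (rule contrapos_nn)
    assume fr: "finite (range (\<lambda>i::int. t [^] i))"
    have "carrier G \<subseteq> (\<lambda>(x, f). x \<otimes> f) ` (range (\<lambda>i::int. t [^] i) \<times> F)" using cov by fastforce
    then show "finite (carrier G)" using fr F(1) by (meson finite_SigmaI finite_imageI finite_subset)
  qed
  \<comment> \<open>If two powers of t agreed, there would be only finitely many powers, which has
    just been excluded.\<close>
  have inj: "inj (\<lambda>i::int. t [^] i)"
  proof (rule ccontr)
    assume "\<not> inj (\<lambda>i::int. t [^] i)"
    then obtain i j :: int where "i < j" "t [^] i = t [^] j" unfolding inj_def by (metis linorder_neqE)
    then have k: "t [^] (j - i) = \<one>" "j - i > 0" using t by (auto simp: int_pow_diff)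
    have "t [^] m \<in> (\<lambda>i. t [^] i) ` {0..<j - i}" for m :: int
    proof -
      have "t [^] m = t [^] ((j - i) * (m div (j - i)) + m mod (j - i))" by simp
      also have "\<dots> = (t [^] (j - i)) [^] (m div (j - i)) \<otimes> t [^] (m mod (j - i))"
        using t by (simp only: int_pow_mult int_pow_pow)
      also have "\<dots> = t [^] (m mod (j - i))" using t k by simp
      finally show ?thesis using k(2) by auto
    qed
    then have "range (\<lambda>i::int. t [^] i) \<subseteq> (\<lambda>i. t [^] i) ` {0..<j - i}" by auto
    then show False using \<open>infinite (range (\<lambda>i::int. t [^] i))\<close> finite_subset by blast
  qed
  have fin: "finite {i::int. t [^] i \<otimes> g \<in> K}" if "finite K" "g \<in> carrier G" for g K
  proof (rule inj_on_finite[OF _ _ that(1)])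
    show "inj_on (\<lambda>i::int. t [^] i \<otimes> g) {i. t [^] i \<otimes> g \<in> K}"
      using inj that(2) t by (auto simp: inj_on_def)
  qed auto
  have tail: "\<exists>i::int. (\<forall>j\<ge>i. t [^] j \<in> E) \<or> (\<forall>j\<le>i. t [^] j \<in> E)" if E: "infinite E" "almost_inv E" for E
  proof -
    have Ec: "E \<subseteq> carrier G" and Ef: "\<And>g. g \<in> carrier G \<Longrightarrow> finite {x \<in> E. x \<otimes> g \<notin> E}"
      using E(2) unfolding almost_inv_def by auto
    define J where "J = {i::int. t [^] i \<in> E}"
    \<comment> \<open>Some right translate by f of the powers of t meets E infinitely often; almost
      invariance under inv f carries this over to the powers themselves.\<close>
    have "\<exists>f\<in>F. infinite {i::int. t [^] i \<otimes> f \<in> E}"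
    proof (rule ccontr)
      assume "\<not> ?thesis"
      then have "finite (\<Union>f\<in>F. (\<lambda>i. t [^] i \<otimes> f) ` {i::int. t [^] i \<otimes> f \<in> E})" using F(1) by auto
      moreover have "E \<subseteq> (\<Union>f\<in>F. (\<lambda>i. t [^] i \<otimes> f) ` {i::int. t [^] i \<otimes> f \<in> E})"
      proof
        fix x assume x: "x \<in> E"
        then obtain i f where "f \<in> F" "x = t [^] (i::int) \<otimes> f" using cov Ec by blast
        then show "x \<in> (\<Union>f\<in>F. (\<lambda>i. t [^] i \<otimes> f) ` {i::int. t [^] i \<otimes> f \<in> E})" using x by auto
      qed
      ultimately show False using E(1) finite_subset by blast
    qed
    then obtain f where f: "f \<in> F" "infinite {i::int. t [^] i \<otimes> f \<in> E}" by blast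
    then have fc: "f \<in> carrier G" using F by auto
    have "finite {i::int. t [^] i \<otimes> f \<in> {x \<in> E. x \<otimes> inv f \<notin> E}}" using fin[OF Ef fc] fc by simp
    moreover have "{i::int. t [^] i \<otimes> f \<in> E} \<subseteq> J \<union> {i::int. t [^] i \<otimes> f \<in> {x \<in> E. x \<otimes> inv f \<notin> E}}"
      unfolding J_def using t fc by (auto simp: m_assoc)
    ultimately have "infinite J" using f(2) by (meson finite_Un finite_subset)
    moreover have "finite {i \<in> J. i + 1 \<notin> J}"
    proof -
      have "finite {i::int. t [^] i \<otimes> \<one> \<in> {x \<in> E. x \<otimes> t \<notin> E}}" using fin[OF Ef[OF t]] by simp
      moreover have "t [^] (i + 1) = t [^] i \<otimes> t" for i :: int using t by (simp add: int_pow_mult int_pow_1)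
      ultimately show ?thesis unfolding J_def using t by simp
    qed
    moreover have "finite {i \<in> J. i - 1 \<notin> J}"
    proof -
      have "finite {i::int. t [^] i \<otimes> \<one> \<in> {x \<in> E. x \<otimes> inv t \<notin> E}}" using fin[OF Ef[of "inv t"] one_closed] t by simp
      moreover have "t [^] (i - 1) = t [^] i \<otimes> inv t" for i :: int using t by (simp add: int_pow_diff int_pow_1)
      ultimately show ?thesis unfolding J_def using t by simp
    qed
    ultimately show ?thesis using int_almost_invariant[of J] unfolding J_def by (auto simp: subset_iff)
  qed
  have "\<exists>i::int. (\<forall>j\<ge>i. t [^] j \<in> D k) \<or> (\<forall>j\<le>i. t [^] j \<in> D k)" if "k < 3" for k
    using tail D(1)[OF that] by blast
  then obtain N where N: "\<And>k. k < 3 \<Longrightarrow> (\<forall>j\<ge>N k. t [^] (j::int) \<in> D k) \<or> (\<forall>j\<le>N k. t [^] j \<in> D k)" by metis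
  have up: False if "k < 3" "l < 3" "k \<noteq> l" "\<forall>j\<ge>N k. t [^] (j::int) \<in> D k" "\<forall>j\<ge>N l. t [^] (j::int) \<in> D l" for k l
    using that(4)[rule_format, of "max (N k) (N l)"] that(5)[rule_format, of "max (N k) (N l)"] D(2)[OF that(1,2,3)] by auto
  have down: False if "k < 3" "l < 3" "k \<noteq> l" "\<forall>j\<le>N k. t [^] (j::int) \<in> D k" "\<forall>j\<le>N l. t [^] (j::int) \<in> D l" for k l
    using that(4)[rule_format, of "min (N k) (N l)"] that(5)[rule_format, of "min (N k) (N l)"] D(2)[OF that(1,2,3)] by auto
  show False using N[of 0] N[of 1] N[of 2] up[of 0 1] up[of 0 2] up[of 1 2] down[of 0 1] down[of 0 2] down[of 1 2] by auto
qed

end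

section \<open>Splittings over finite subgroups\<close>

text \<open>S and T are the two sides of the edge C in the Bass--Serre tree, pulled back to G.\<close>

locale finite_splitting = group G for G (structure) +
  fixes A B C S T :: "'a set"
  assumes subA: "subgroup A G" and subB: "subgroup B G" and subC: "subgroup C G"
    and CA: "C \<subseteq> A" and CB: "C \<subseteq> B" and finC: "finite C"
    and gen: "generate G (A \<union> B) = carrier G"
    and cover: "carrier G = S \<union> C \<union> T" and SC: "S \<inter> C = {}" and TC: "T \<inter> C = {}" and ST: "S \<inter> T = {}"
    and S_right: "\<And>x a. x \<in> S \<Longrightarrow> a \<in> A \<Longrightarrow> x \<otimes> a \<in> S"
    and T_right: "\<And>x b. x \<in> T \<Longrightarrow> b \<in> B \<Longrightarrow> x \<otimes> b \<in> T"
    and A_proper: "A \<noteq> C" and B_proper: "B \<noteq> C"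
begin

lemma swap: "finite_splitting G B A C T S"
proof (intro finite_splitting.intro finite_splitting_axioms.intro)
  show "generate G (B \<union> A) = carrier G" using gen by (simp add: Un_commute)
  show "carrier G = T \<union> C \<union> S" using cover by blast
  show "T \<inter> S = {}" using ST by blast
qed (fact group_axioms subA subB subC CA CB finC TC SC S_right T_right A_proper B_proper)+

lemma carriers: "A \<subseteq> carrier G" "B \<subseteq> carrier G" "C \<subseteq> carrier G" "S \<subseteq> carrier G" "T \<subseteq> carrier G"
  using subA subB subC subgroup.subset cover by blast+

text \<open>Right multiplication by the generators is transitive on the group, so a nonempty
  invariant set is everything.\<close>

lemma invariant_all:
  assumes D: "D \<subseteq> carrier G" "\<And>x a. x \<in> D \<Longrightarrow> a \<in> A \<Longrightarrow> x \<otimes> a \<in> D" "\<And>x b. x \<in> D \<Longrightarrow> b \<in> B \<Longrightarrow> x \<otimes> b \<in> D"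
    and d: "d \<in> D"
  shows "D = carrier G"
proof -
  have "\<forall>x\<in>D. x \<otimes> g \<in> D" if "g \<in> generate G (A \<union> B)" for g
    using that
  proof (induction rule: generate.induct)
    case one
    then show ?case using D(1) by auto
  next
    case (incl h)
    then show ?case using D(2,3) by blast
  next
    case (inv h)
    then have "inv h \<in> A \<union> B" using subgroup.m_inv_closed[OF subA] subgroup.m_inv_closed[OF subB] by blast
    then show ?case using D(2,3) by blast
  next
    case (eng g h)
    then have "g \<in> carrier G" "h \<in> carrier G" using gen by auto
    then show ?case using eng.IH D(1) by (metis m_assoc subsetD)
  qed
  then have "x \<in> D" if "x \<in> carrier G" for x
  proof -
    have dc: "d \<in> carrier G" using d D(1) by auto
    have "d \<otimes> (inv d \<otimes> x) \<in> D" using \<open>\<And>g. g \<in> generate G (A \<union> B) \<Longrightarrow> \<forall>x\<in>D. x \<otimes> g \<in> D\<close> d dc that gen by simp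
    then show ?thesis using dc that by (simp add: m_assoc[symmetric])
  qed
  then show ?thesis using D(1) by blast
qed

lemma A_S: "x \<in> A \<Longrightarrow> x \<notin> S"
proof
  assume "x \<in> A" "x \<in> S"
  then have "x \<otimes> inv x \<in> S" using S_right subgroup.m_inv_closed[OF subA] by blast
  then have "\<one> \<in> S" using \<open>x \<in> A\<close> carriers(1) by auto
  then show False using SC subgroup.one_closed[OF subC] by blast
qed

text \<open>S \<union> C is the complement of T, and T is right invariant under the group B.\<close>

lemma SC_right: "x \<in> S \<union> C \<Longrightarrow> b \<in> B \<Longrightarrow> x \<otimes> b \<in> S \<union> C"
proof -
  assume x: "x \<in> S \<union> C" "b \<in> B"
  have xc: "x \<in> carrier G" "b \<in> carrier G" using x carriers by auto
  have "x \<otimes> b \<notin> T"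
  proof
    assume "x \<otimes> b \<in> T"
    then have "x \<otimes> b \<otimes> inv b \<in> T" using T_right subgroup.m_inv_closed[OF subB x(2)] by blast
    then have "x \<in> T" using xc by (simp add: m_assoc)
    then show False using x(1) ST TC by blast
  qed
  then show ?thesis using cover xc m_closed by blast
qed

text \<open>The input for ping-pong. Let Z consist of the y in S with inv a y in S as well. Z is
  right invariant under A, and also under B, because neither y b nor inv a y b can drop into C. The
  unit is not in S, so Z is empty.\<close>

lemma move:
  assumes a: "a \<in> A" "a \<notin> C" and x: "x \<in> S \<union> C"
  shows "a \<otimes> x \<in> T"
proof -
  have ac: "a \<in> carrier G" using a carriers by auto
  have ia: "inv a \<in> A" using subgroup.m_inv_closed[OF subA a(1)] .
  have ia': "inv a \<notin> C" using subgroup.m_inv_closed[OF subC, of "inv a"] ac a by auto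
  have AC: "y \<in> A \<Longrightarrow> y \<notin> C \<Longrightarrow> y \<in> T" for y using A_S[of y] carriers(1) cover by blast
  have mulC: "g \<otimes> c \<in> A \<and> g \<otimes> c \<notin> C" if g: "g \<in> A" "g \<notin> C" and c: "c \<in> C" for g c
  proof
    show "g \<otimes> c \<in> A" using g c CA subgroup.m_closed[OF subA] by blast
    show "g \<otimes> c \<notin> C"
    proof
      assume "g \<otimes> c \<in> C"
      then have "g \<otimes> c \<otimes> inv c \<in> C" using subgroup.m_closed[OF subC] subgroup.m_inv_closed[OF subC c] by blast
      moreover have "g \<in> carrier G" "c \<in> carrier G" using g c carriers by auto
      ultimately show False using g(2) by (simp add: m_assoc)
    qed
  qed
  define Z where "Z = {x \<in> S. inv a \<otimes> x \<in> S}"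
  have Zc: "Z \<subseteq> carrier G" unfolding Z_def using carriers by auto
  have ZB: "y \<otimes> b \<in> Z" if y: "y \<in> Z" and b: "b \<in> B" for y b
  proof -
    have yc: "y \<in> carrier G" "b \<in> carrier G" using y b Zc carriers by auto
    have y1: "y \<otimes> b \<in> S \<union> C" using SC_right[OF _ b] y unfolding Z_def by blast
    have "inv a \<otimes> y \<otimes> b \<in> S \<union> C" using SC_right[OF _ b] y unfolding Z_def by blast
    then have y2: "inv a \<otimes> (y \<otimes> b) \<in> S \<union> C" using yc ac by (simp add: m_assoc)
    have "y \<otimes> b \<notin> C" using mulC[OF ia ia'] AC y2 ST TC by blast
    moreover have "inv a \<otimes> (y \<otimes> b) \<notin> C"
    proof
      assume "inv a \<otimes> (y \<otimes> b) \<in> C"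
      then have "a \<otimes> (inv a \<otimes> (y \<otimes> b)) \<in> T" using mulC[OF a] AC by blast
      then have "y \<otimes> b \<in> T" using ac yc by (simp add: m_assoc[symmetric])
      then show False using y1 ST TC by blast
    qed
    ultimately show ?thesis using y1 y2 unfolding Z_def by blast
  qed
  have ZA: "y \<otimes> b \<in> Z" if "y \<in> Z" "b \<in> A" for y b
  proof -
    have "inv a \<otimes> y \<otimes> b \<in> S" "y \<otimes> b \<in> S" using S_right that unfolding Z_def by auto
    moreover have "inv a \<otimes> y \<otimes> b = inv a \<otimes> (y \<otimes> b)" using that Zc carriers ac by (intro m_assoc) auto
    ultimately show ?thesis unfolding Z_def by simp
  qed
  have "Z = {}"
  proof (rule ccontr)
    assume "Z \<noteq> {}"
    then have "Z = carrier G" using invariant_all[OF Zc ZA ZB] by blast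
    then have "\<one> \<in> S" unfolding Z_def by blast
    then show False using SC subgroup.one_closed[OF subC] by blast
  qed
  show ?thesis
  proof (cases "x \<in> C")
    case True
    then show ?thesis using mulC[OF a] AC by blast
  next
    case False
    then have xS: "x \<in> S" using x by blast
    then have xc: "x \<in> carrier G" using carriers by auto
    have e: "inv a \<otimes> (a \<otimes> x) = x" using ac xc by (simp add: m_assoc[symmetric])
    have "a \<otimes> x \<notin> S" using \<open>Z = {}\<close> e xS unfolding Z_def by auto
    moreover have "a \<otimes> x \<notin> C"
    proof
      assume "a \<otimes> x \<in> C"
      then have "inv a \<otimes> (a \<otimes> x) \<in> T" using mulC[OF ia ia'] AC by blast
      then show False using e xS ST by auto
    qed
    ultimately show ?thesis using cover ac xc m_closed by blast
  qed
qed

lemma ex_A: "\<exists>a\<in>A. a \<notin> C" using A_proper CA by blast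

lemma move2:
  assumes "a \<in> A" "a \<notin> C" "b \<in> B" "b \<notin> C" "x \<in> S \<union> C"
  shows "b \<otimes> a \<otimes> x \<in> S"
proof -
  have "a \<otimes> x \<in> T" by (rule move[OF assms(1,2,5)])
  then have "b \<otimes> (a \<otimes> x) \<in> S" using finite_splitting.move[OF swap assms(3,4)] by blast
  then show ?thesis using assms carriers by (subst m_assoc) auto
qed

text \<open>The product b a maps S \<union> C injectively into S, which is impossible for a finite
  S, as C contains the unit.\<close>

lemma infinite_S: "infinite S"
proof
  assume fin: "finite S"
  obtain a b where ab: "a \<in> A" "a \<notin> C" "b \<in> B" "b \<notin> C" 
    using ex_A finite_splitting.ex_A[OF swap] by blast
  have c: "b \<otimes> a \<in> carrier G" using ab carriers by auto
  have "inj_on (\<lambda>x. b \<otimes> a \<otimes> x) (S \<union> C)" using inj_on_subset[OF inj_on_cmult[OF c]] carriers by auto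
  moreover have "(\<lambda>x. b \<otimes> a \<otimes> x) ` (S \<union> C) \<subseteq> S" using move2[OF ab] by auto
  ultimately have "card (S \<union> C) \<le> card S" using fin card_inj_on_le by blast
  moreover have "card (S \<union> C) = card S + card C" using fin finC SC by (rule card_Un_disjoint)
  ultimately have "C = {}" using finC by simp
  then show False using subgroup.one_closed[OF subC] by blast
qed

text \<open>Right multiplication by A preserves S, and right multiplication by B can leave S only
  into the finite set C.\<close>

lemma almost_inv_S: "almost_inv S"
proof (rule almost_inv_generate[OF carriers(4) _ gen])
  show "A \<union> B \<subseteq> carrier G" using carriers by auto
  have f: "finite {x \<in> S. x \<otimes> s \<notin> S}" if s: "s \<in> A \<union> B" for s
  proof (rule finite_right_preimage[OF finC, of s])
    show "s \<in> carrier G" using s carriers by auto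
    show "{x \<in> S. x \<otimes> s \<notin> S} \<subseteq> carrier G" using carriers by auto
    show "x \<otimes> s \<in> C" if "x \<in> {x \<in> S. x \<otimes> s \<notin> S}" for x
      using that s S_right SC_right by blast
  qed
  fix s assume s: "s \<in> A \<union> B"
  show "finite {x \<in> S. x \<otimes> s \<notin> S}" using f[OF s] .
  have "inv s \<in> A \<union> B" using s subgroup.m_inv_closed[OF subA] subgroup.m_inv_closed[OF subB] by blast
  then show "finite {x \<in> S. x \<otimes> inv s \<notin> S}" using f by blast
qed

lemma two_ends: "many_ends 2"
  unfolding many_ends_def
proof (intro exI[of _ "\<lambda>i. if i = 0 then S else T"] conjI allI impI)
  note sw = finite_splitting.infinite_S[OF swap] finite_splitting.almost_inv_S[OF swap]
  fix i :: nat
  show "infinite (if i = 0 then S else T)" "almost_inv (if i = 0 then S else T)"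
    using infinite_S almost_inv_S sw by auto
  fix j assume "i < 2" "j < (2::nat)" "i \<noteq> j"
  then show "(if i = 0 then S else T) \<inter> (if j = 0 then S else T) = {}" using ST by (auto split: if_splits)
qed

lemma almost_inv_left:
  assumes "almost_inv D" "h \<in> carrier G" shows "almost_inv ((\<lambda>x. h \<otimes> x) ` D)"
proof -
  have Dc: "D \<subseteq> carrier G" using assms unfolding almost_inv_def by blast
  have "finite {x \<in> (\<lambda>x. h \<otimes> x) ` D. x \<otimes> g \<notin> (\<lambda>x. h \<otimes> x) ` D}" if g: "g \<in> carrier G" for g
  proof (rule finite_subset)
    show "finite ((\<lambda>x. h \<otimes> x) ` {x \<in> D. x \<otimes> g \<notin> D})" using assms(1) g unfolding almost_inv_def by blast
    show "{x \<in> (\<lambda>x. h \<otimes> x) ` D. x \<otimes> g \<notin> (\<lambda>x. h \<otimes> x) ` D} \<subseteq> (\<lambda>x. h \<otimes> x) ` {x \<in> D. x \<otimes> g \<notin> D}"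
      using Dc g assms(2) by (auto simp: m_assoc subset_iff)
  qed
  then show ?thesis unfolding almost_inv_def using Dc assms(2) by auto
qed

text \<open>Ping-pong for g = b a and g' = b a', where a and a' lie in different cosets of C other
  than C: they map S into disjoint parts of S. The translates of S by g^i g' are then disjoint for
  different i, which gives any number of ends. A product that starts with g never agrees on S with
  one that starts with g', so no powers of them commute.\<close>

lemma big_splitting:
  assumes a: "a \<in> A" "a \<notin> C" and a': "a' \<in> A" "a' \<notin> C" and aa: "inv a \<otimes> a' \<notin> C"
  shows "many_ends n" "0 < k \<Longrightarrow> \<not> powers_commute k"
proof -
  obtain b where b: "b \<in> B" "b \<notin> C" using finite_splitting.ex_A[OF swap] by blast
  have c: "a \<in> carrier G" "a' \<in> carrier G" "b \<in> carrier G" using a a' b carriers by auto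
  define g where "g = b \<otimes> a"
  define g' where "g' = b \<otimes> a'"
  have gc: "g \<in> carrier G" "g' \<in> carrier G" unfolding g_def g'_def using c by auto
  have gS: "g \<otimes> x \<in> S" "g' \<otimes> x \<in> S" if "x \<in> S" for x
    using move2[OF a b] move2[OF a' b] that unfolding g_def g'_def by auto
  have ne: "g \<otimes> x \<noteq> g' \<otimes> y" if xy: "x \<in> S" "y \<in> S" for x y
  proof
    assume e: "g \<otimes> x = g' \<otimes> y"
    have xc: "x \<in> carrier G" "y \<in> carrier G" using xy carriers by auto
    have "b \<otimes> (a \<otimes> x) = b \<otimes> (a' \<otimes> y)" using e c xc unfolding g_def g'_def by (simp add: m_assoc)
    then have "a \<otimes> x = a' \<otimes> y" using c xc by simp
    then have "x = inv a \<otimes> (a' \<otimes> y)" using c xc by (simp add: inv_solve_left)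
    also have "\<dots> = (inv a \<otimes> a') \<otimes> y" using c xc by (simp add: m_assoc)
    also have "\<dots> \<in> T"
      using move[of "inv a \<otimes> a'" y] aa xy subgroup.m_closed[OF subA subgroup.m_inv_closed[OF subA a(1)] a'(1)] by blast
    finally show False using xy ST by blast
  qed
  have pow: "g [^] (i::nat) \<otimes> x \<in> S" "g' [^] i \<otimes> x \<in> S" if "x \<in> S" for i x
  proof -
    have xc: "x \<in> carrier G" using that carriers by auto
    have *: "h [^] i \<otimes> x \<in> S" if h: "h \<in> carrier G" "\<And>y. y \<in> S \<Longrightarrow> h \<otimes> y \<in> S" for h
    proof (induction i)
      case 0
      then show ?case using xc \<open>x \<in> S\<close> by simp
    next
      case (Suc i)
      have "h [^] Suc i \<otimes> x = h \<otimes> (h [^] i \<otimes> x)" using xc h by (metis m_assoc nat_pow_Suc2 nat_pow_closed)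
      then show ?case using h(2)[OF Suc] by simp
    qed
    show "g [^] i \<otimes> x \<in> S" "g' [^] i \<otimes> x \<in> S" using *[OF gc(1) gS(1)] *[OF gc(2) gS(2)] by auto
  qed
  have ne2: "g [^] i \<otimes> (g' \<otimes> x) \<noteq> g [^] j \<otimes> (g' \<otimes> y)" if ij: "i < j" and xy: "x \<in> S" "y \<in> S" for i j :: nat and x y
  proof
    assume e: "g [^] i \<otimes> (g' \<otimes> x) = g [^] j \<otimes> (g' \<otimes> y)"
    have xc: "x \<in> carrier G" "y \<in> carrier G" using xy carriers by auto
    obtain d where d: "j = i + Suc d" using ij less_imp_Suc_add by auto
    have "g [^] j \<otimes> (g' \<otimes> y) = g [^] i \<otimes> (g \<otimes> (g [^] d \<otimes> (g' \<otimes> y)))"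
      unfolding d nat_pow_mult[OF gc(1), symmetric] nat_pow_Suc2[OF gc(1)] using gc xc by (simp add: m_assoc)
    then have "g' \<otimes> x = g \<otimes> (g [^] d \<otimes> (g' \<otimes> y))" using e gc xc by simp
    then show False using ne[OF pow(1)[OF gS(2)[OF xy(2)]] xy(1)] by metis
  qed
  show "many_ends n" unfolding many_ends_def
  proof (intro exI[of _ "\<lambda>i. (\<lambda>x. (g [^] i \<otimes> g') \<otimes> x) ` S"] conjI allI impI)
    fix i :: nat
    have "inj_on (\<lambda>x. (g [^] i \<otimes> g') \<otimes> x) S" using inj_on_subset[OF inj_on_cmult] gc carriers by auto
    then show "infinite ((\<lambda>x. (g [^] i \<otimes> g') \<otimes> x) ` S)" using infinite_S finite_imageD by blast
    show "almost_inv ((\<lambda>x. (g [^] i \<otimes> g') \<otimes> x) ` S)" by (rule almost_inv_left[OF almost_inv_S]) (use gc in auto)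
    fix j :: nat assume "i \<noteq> j"
    have asc: "(g [^] i \<otimes> g') \<otimes> x = g [^] i \<otimes> (g' \<otimes> x)" if "x \<in> S" for x and i :: nat
      using gc that carriers by (intro m_assoc) auto
    have "(g [^] i \<otimes> g') \<otimes> x \<noteq> (g [^] j \<otimes> g') \<otimes> y" if xy: "x \<in> S" "y \<in> S" for x y
      using ne2[of i j, OF _ xy] ne2[of j i, OF _ xy(2,1)] \<open>i \<noteq> j\<close> asc xy by (metis nat_neq_iff)
    then show "(\<lambda>x. (g [^] i \<otimes> g') \<otimes> x) ` S \<inter> (\<lambda>x. (g [^] j \<otimes> g') \<otimes> x) ` S = {}" by auto
  qed
  show "\<not> powers_commute k" if k: "0 < k"
  proof
    assume pc: "powers_commute k"
    obtain x where x: "x \<in> S" using infinite_S by fastforce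
    then have xc: "x \<in> carrier G" using carriers by auto
    obtain d where d: "k = Suc d" using k gr0_implies_Suc by blast
    have "g [^] k \<otimes> g' [^] k = g' [^] k \<otimes> g [^] k" using pc gc unfolding powers_commute_def by blast
    then have "g [^] k \<otimes> g' [^] k \<otimes> x = g' [^] k \<otimes> g [^] k \<otimes> x" by simp
    then have "g [^] k \<otimes> (g' [^] k \<otimes> x) = g' [^] k \<otimes> (g [^] k \<otimes> x)" using gc xc by (simp add: m_assoc del: nat_pow_Suc)
    moreover have "h [^] k \<otimes> y = h \<otimes> (h [^] d \<otimes> y)" if "h \<in> carrier G" "y \<in> carrier G" for h y
      unfolding d using that by (metis m_assoc nat_pow_Suc2 nat_pow_closed)
    ultimately have "g \<otimes> (g [^] d \<otimes> (g' [^] k \<otimes> x)) = g' \<otimes> (g' [^] d \<otimes> (g [^] k \<otimes> x))" using gc xc by simp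
    then show False using ne[OF pow(1)[OF pow(2)[OF x]] pow(2)[OF pow(1)[OF x]]] by metis
  qed
qed

text \<open>Here C has index 2 in A and in B, and t = a b generates a subgroup of finite index: the
  products t^i f with f in the finite group A are closed under right multiplication by A and by
  B.\<close>

lemma small_splitting:
  assumes A2: "\<And>a a'. a \<in> A \<Longrightarrow> a \<notin> C \<Longrightarrow> a' \<in> A \<Longrightarrow> a' \<notin> C \<Longrightarrow> inv a \<otimes> a' \<in> C"
    and B2: "\<And>b b'. b \<in> B \<Longrightarrow> b \<notin> C \<Longrightarrow> b' \<in> B \<Longrightarrow> b' \<notin> C \<Longrightarrow> inv b \<otimes> b' \<in> C"
  shows "\<not> many_ends 3" "\<exists>n>0. powers_commute n"
proof -
  obtain a b where ab: "a \<in> A" "a \<notin> C" "b \<in> B" "b \<notin> C" 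
    using ex_A finite_splitting.ex_A[OF swap] by blast
  have c: "a \<in> carrier G" "b \<in> carrier G" using ab carriers by auto
  have coset: "y = h \<otimes> (inv h \<otimes> y)" if "h \<in> carrier G" "y \<in> carrier G" for h y
    using that by (simp add: m_assoc[symmetric])
  have "A \<subseteq> C \<union> (\<lambda>x. a \<otimes> x) ` C"
  proof
    fix y assume y: "y \<in> A"
    show "y \<in> C \<union> (\<lambda>x. a \<otimes> x) ` C"
      using A2[OF ab(1,2) y] coset[OF c(1), of y] y carriers by blast
  qed
  then have finA: "finite A" using finC by (meson finite_UnI finite_imageI finite_subset)
  define t where "t = a \<otimes> b"
  have tc: "t \<in> carrier G" unfolding t_def using c by simp
  define H where "H = {t [^] i \<otimes> f | (i::int) f. f \<in> A}"
  have Hc: "H \<subseteq> carrier G" unfolding H_def using tc carriers by auto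
  have HA: "x \<otimes> y \<in> H" if xy: "x \<in> H" "y \<in> A" for x y
  proof -
    obtain i :: int and f where f: "f \<in> A" "x = t [^] i \<otimes> f" using xy unfolding H_def by blast
    then have "x \<otimes> y = t [^] i \<otimes> (f \<otimes> y)" using xy tc carriers by (simp add: m_assoc subset_iff)
    moreover have "f \<otimes> y \<in> A" using f xy subgroup.m_closed[OF subA] by blast
    ultimately show ?thesis unfolding H_def by blast
  qed
  have ib: "inv b \<in> B" "inv b \<notin> C"
    using subgroup.m_inv_closed[OF subB ab(3)] subgroup.m_inv_closed[OF subC, of "inv b"] ab c by auto
  have bb: "b \<otimes> b \<in> C" using B2[OF ib ab(3,4)] c by simp
  have HB: "x \<otimes> y \<in> H" if xy: "x \<in> H" "y \<in> B" for x y
  proof -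
    obtain i :: int and f where f: "f \<in> A" "x = t [^] i \<otimes> f" using xy unfolding H_def by blast
    have yc: "y \<in> carrier G" and fc: "f \<in> carrier G" using xy f carriers by auto
    have e: "x \<otimes> y = t [^] i \<otimes> (f \<otimes> y)" using f yc fc tc by (simp add: m_assoc)
    show ?thesis
    proof (cases "f \<in> C")
      case True
      then have fy: "f \<otimes> y \<in> B" using xy(2) CB subgroup.m_closed[OF subB] by blast
      show ?thesis
      proof (cases "f \<otimes> y \<in> C")
        case True
        then show ?thesis unfolding e H_def using CA by blast
      next
        case False
        define c' where "c' = inv b \<otimes> (f \<otimes> y)"
        have c'C: "c' \<in> C" unfolding c'_def using B2[OF ab(3,4) fy False] .
        then have c'c: "c' \<in> carrier G" using carriers by auto
        have fy': "f \<otimes> y = b \<otimes> c'" unfolding c'_def using coset[OF c(2)] fc yc by simp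
        \<comment> \<open>A factor b that no a precedes is absorbed as inv t a (b b), where b b lies
          in C.\<close>
        have "inv t \<otimes> (a \<otimes> (b \<otimes> b \<otimes> c')) = b \<otimes> c'"
          unfolding t_def using c c'c by (simp add: inv_mult_group m_assoc) (simp add: m_assoc[symmetric])
        then have "x \<otimes> y = t [^] i \<otimes> (inv t \<otimes> (a \<otimes> (b \<otimes> b \<otimes> c')))" unfolding e fy' by simp
        also have "\<dots> = t [^] (i - 1) \<otimes> (a \<otimes> (b \<otimes> b \<otimes> c'))" using tc c c'c by (simp add: int_pow_diff int_pow_1 m_assoc)
        finally have "x \<otimes> y = t [^] (i - 1) \<otimes> (a \<otimes> (b \<otimes> b \<otimes> c'))" .
        moreover have "a \<otimes> (b \<otimes> b \<otimes> c') \<in> A"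
          using subgroup.m_closed[OF subA ab(1)] subgroup.m_closed[OF subC bb c'C] CA by blast
        ultimately show ?thesis unfolding H_def by blast
      qed
    next
      case False
      define c' where "c' = inv a \<otimes> f"
      have c'C: "c' \<in> C" unfolding c'_def using A2[OF ab(1,2) f(1) False] .
      then have c'c: "c' \<in> carrier G" using carriers by auto
      have f': "f = a \<otimes> c'" unfolding c'_def using coset[OF c(1) fc] .
      have cy: "c' \<otimes> y \<in> B" using xy(2) CB c'C subgroup.m_closed[OF subB] by blast
      have e2: "f \<otimes> y = a \<otimes> (c' \<otimes> y)" unfolding f' using c c'c yc by (simp add: m_assoc)
      show ?thesis
      proof (cases "c' \<otimes> y \<in> C")
        case True
        then have "f \<otimes> y \<in> A" unfolding e2 using subgroup.m_closed[OF subA ab(1)] CA by blast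
        then show ?thesis unfolding e H_def by blast
      next
        case False
        define c'' where "c'' = inv b \<otimes> (c' \<otimes> y)"
        have c''C: "c'' \<in> C" unfolding c''_def using B2[OF ab(3,4) cy False] .
        then have c''c: "c'' \<in> carrier G" using carriers by auto
        have cy': "c' \<otimes> y = b \<otimes> c''" unfolding c''_def using coset[OF c(2)] c'c yc by simp
        have "x \<otimes> y = t [^] i \<otimes> (t \<otimes> c'')" unfolding e e2 cy' t_def using c c''c by (simp add: m_assoc)
        also have "\<dots> = t [^] (i + 1) \<otimes> c''" using tc c''c by (simp add: int_pow_mult int_pow_1 m_assoc)
        finally show ?thesis unfolding H_def using c''C CA by blast
      qed
    qed
  qed
  have "\<one> \<in> H" unfolding H_def using subgroup.one_closed[OF subA] tc by (auto intro!: exI[of _ "0::int"] exI[of _ \<one>])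
  then have "H = carrier G" using invariant_all[OF Hc HA HB] by blast
  then have cov: "\<exists>i::int. \<exists>f\<in>A. x = t [^] i \<otimes> f" if "x \<in> carrier G" for x using that unfolding H_def by blast
  show "\<not> many_ends 3" by (rule virtually_cyclic_ends[OF tc finA carriers(1) cov])
  have "powers_commute (fact (card A))" by (rule virtually_cyclic_powers_commute[OF tc finA carriers(1) cov])
  then show "\<exists>n>0. powers_commute n" by (intro exI[of _ "fact (card A)"]) simp
qed

text \<open>The cases are index 2 for both inclusions of C and index at least 3 for one of them. The
  answer mentions only the law and not A, B or C, so that it can be compared between groups with
  unrelated splittings.\<close>

theorem splitting_ends:
  "many_ends n \<longleftrightarrow> n \<le> 2 \<or> \<not> (\<exists>k>0. powers_commute k)"
proof (cases "(\<forall>a\<in>A - C. \<forall>a'\<in>A - C. inv a \<otimes> a' \<in> C) \<and> (\<forall>a\<in>B - C. \<forall>a'\<in>B - C. inv a \<otimes> a' \<in> C)")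
  case True
  then have "\<not> many_ends 3" "\<exists>k>0. powers_commute k" using small_splitting by (auto)
  moreover have "n \<le> 2 \<Longrightarrow> many_ends n" using many_ends_mono[OF two_ends] by blast
  moreover have "\<not> n \<le> 2 \<Longrightarrow> many_ends n \<Longrightarrow> many_ends 3" using many_ends_mono[of n 3] by simp
  ultimately show ?thesis by blast
next
  case False
  then consider (a) a a' where "a \<in> A - C" "a' \<in> A - C" "inv a \<otimes> a' \<notin> C" | (b) b b' where "b \<in> B - C" "b' \<in> B - C" "inv b \<otimes> b' \<notin> C"
    by blast
  then show ?thesis
  proof cases
    case a
    then have "many_ends n" "\<not> (\<exists>k>0. powers_commute k)" using big_splitting[of a a'] by auto
    then show ?thesis by blast
  next
    case b
    then have "many_ends n" "\<not> (\<exists>k>0. powers_commute k)" using finite_splitting.big_splitting[OF swap, of b b'] by auto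
    then show ?thesis by blast
  qed
qed

lemma infinite_group: "infinite (carrier G)"
  using infinite_S carriers(4) finite_subset by blast

end

section \<open>Profinite completions\<close>

context group
begin

lemma rcoset_eq_iff:
  assumes "subgroup N G" "x \<in> carrier G" "y \<in> carrier G"
  shows "N #> x = N #> y \<longleftrightarrow> x \<otimes> inv y \<in> N"
proof -
  have Nc: "N \<subseteq> carrier G" using assms(1) subgroup.subset by blast
  have "N #> x = N #> y \<longleftrightarrow> N #> (x \<otimes> inv y) = N"
    using coset_mult_inv1[OF _ assms(2,3) Nc] coset_mult_inv2[OF _ assms(2,3) Nc] by blast
  also have "\<dots> \<longleftrightarrow> x \<otimes> inv y \<in> N" using coset_join1[OF _ _ assms(1)] coset_join2[OF _ assms(1)] assms by auto
  finally show ?thesis .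
qed

lemma finite_indexI:
  assumes "subgroup N G" "finite (f ` carrier G)"
    and "\<And>x y. x \<in> carrier G \<Longrightarrow> y \<in> carrier G \<Longrightarrow> f x = f y \<Longrightarrow> x \<otimes> inv y \<in> N"
  shows "finite (carrier (G Mod N))"
proof -
  have "N #> x = N #> inv_into (carrier G) f (f x)" if "x \<in> carrier G" for x
    using rcoset_eq_iff[OF assms(1)] assms(3) f_inv_into_f[of "f x" f "carrier G"] inv_into_into[of "f x" f "carrier G"] that by auto
  then have "carrier (G Mod N) \<subseteq> (\<lambda>s. N #> inv_into (carrier G) f s) ` (f ` carrier G)"
    unfolding FactGroup_def RCOSETS_def by auto
  then show ?thesis using assms(2) finite_surj by blast
qed

lemma rcosets_carrier: "carrier (G Mod N) = (\<lambda>x. N #> x) ` carrier G"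
  unfolding FactGroup_def RCOSETS_def by auto

text \<open>Finite index is certified by any finite-valued f whose fibres lie in single cosets. Such
  an f may vary within a coset, which leaves room for values that depend on choices.\<close>

lemma fin_normalI:
  assumes "N \<lhd> G" "finite (f ` carrier G)"
    and "\<And>x y. x \<in> carrier G \<Longrightarrow> y \<in> carrier G \<Longrightarrow> f x = f y \<Longrightarrow> x \<otimes> inv y \<in> N"
  shows "N \<in> fin_normal G"
  using assms finite_indexI[OF normal_imp_subgroup[OF assms(1)]] unfolding fin_normal_def by blast

lemma fin_normal_normal: "N \<in> fin_normal G \<Longrightarrow> N \<lhd> G"
  unfolding fin_normal_def by blast

lemma fin_normal_carrier: "carrier G \<in> fin_normal G"
  by (rule fin_normalI[of _ "\<lambda>_. ()"]) (auto intro: normal_invI subgroup_self)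

lemma fin_normal_Int:
  assumes "N \<in> fin_normal G" "M \<in> fin_normal G" shows "N \<inter> M \<in> fin_normal G"
proof (rule fin_normalI[of _ "\<lambda>x. (N #> x, M #> x)"])
  have n: "N \<lhd> G" "M \<lhd> G" using assms fin_normal_normal by auto
  show "N \<inter> M \<lhd> G" using n by (rule normal_subgroup_intersect)
  have "finite (carrier (G Mod N) \<times> carrier (G Mod M))" using assms unfolding fin_normal_def by blast
  then show "finite ((\<lambda>x. (N #> x, M #> x)) ` carrier G)"
    unfolding rcosets_carrier by (rule rev_finite_subset) auto
  fix x y assume "x \<in> carrier G" "y \<in> carrier G" "(N #> x, M #> x) = (N #> y, M #> y)"
  then show "x \<otimes> inv y \<in> N \<inter> M" using rcoset_eq_iff[OF normal_imp_subgroup[OF n(1)]] rcoset_eq_iff[OF normal_imp_subgroup[OF n(2)]] by auto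
qed

lemma rcoset_mem: "subgroup N G \<Longrightarrow> x \<in> carrier G \<Longrightarrow> x \<in> N #> x"
  by (rule rcos_self)

lemma coset_determined:
  assumes "subgroup N G" "c \<in> carrier (G Mod N)" "c' \<in> carrier (G Mod N)" "x \<in> c" "x \<in> c'"
  shows "c = c'"
proof -
  obtain y z where "c = N #> y" "y \<in> carrier G" "c' = N #> z" "z \<in> carrier G" using assms(2,3) unfolding rcosets_carrier by auto
  then show ?thesis using repr_independence[of x N y] repr_independence[of x N z] assms(1,4,5) by metis
qed

abbreviation Ghat where "Ghat \<equiv> profinite_completion G"

definition iota :: "'a \<Rightarrow> 'a set \<Rightarrow> 'a set" where
  "iota x = (\<lambda>N. if N \<in> fin_normal G then N #> x else undefined)"

lemma hat_eval: "f \<in> carrier Ghat \<Longrightarrow> N \<in> fin_normal G \<Longrightarrow> f N \<in> carrier (G Mod N)"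
  unfolding profinite_completion_def by simp

lemma hat_mono: "f \<in> carrier Ghat \<Longrightarrow> N \<in> fin_normal G \<Longrightarrow> M \<in> fin_normal G \<Longrightarrow> N \<subseteq> M \<Longrightarrow> f N \<subseteq> f M"
  unfolding profinite_completion_def by simp

lemma hat_undef: "f \<in> carrier Ghat \<Longrightarrow> N \<notin> fin_normal G \<Longrightarrow> f N = undefined"
  unfolding profinite_completion_def by simp

lemma hat_mult: "N \<in> fin_normal G \<Longrightarrow> (f \<otimes>\<^bsub>Ghat\<^esub> g) N = f N \<otimes>\<^bsub>G Mod N\<^esub> g N"
  unfolding profinite_completion_def by (simp add: FactGroup_def)

lemma hat_one: "N \<in> fin_normal G \<Longrightarrow> \<one>\<^bsub>Ghat\<^esub> N = N"
  unfolding profinite_completion_def by simp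

lemma hat_carrierI:
  assumes "\<And>N. N \<in> fin_normal G \<Longrightarrow> f N \<in> carrier (G Mod N)" "\<And>N. N \<notin> fin_normal G \<Longrightarrow> f N = undefined"
    "\<And>N M. N \<in> fin_normal G \<Longrightarrow> M \<in> fin_normal G \<Longrightarrow> N \<subseteq> M \<Longrightarrow> f N \<subseteq> f M"
  shows "f \<in> carrier Ghat"
  unfolding profinite_completion_def using assms by simp

lemma hat_ext:
  assumes "f \<in> carrier Ghat" "g \<in> carrier Ghat" "\<And>N. N \<in> fin_normal G \<Longrightarrow> f N = g N" shows "f = g"
proof
  fix N show "f N = g N" 
    using assms(3)[of N] hat_undef[OF assms(1), of N] hat_undef[OF assms(2), of N] by (cases "N \<in> fin_normal G") simp_all
qed

lemma Mod_group: "N \<in> fin_normal G \<Longrightarrow> group (G Mod N)"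
  by (rule normal.factorgroup_is_group[OF fin_normal_normal])

lemma hat_group: "group Ghat"
proof (rule groupI)
  show mc: "f \<otimes>\<^bsub>Ghat\<^esub> g \<in> carrier Ghat" if fg: "f \<in> carrier Ghat" "g \<in> carrier Ghat" for f g
  proof (rule hat_carrierI)
    fix N assume N: "N \<in> fin_normal G"
    show "(f \<otimes>\<^bsub>Ghat\<^esub> g) N \<in> carrier (G Mod N)" unfolding hat_mult[OF N]
      by (rule monoid.m_closed[OF group.is_monoid[OF Mod_group[OF N]] hat_eval[OF fg(1) N] hat_eval[OF fg(2) N]])
    fix M assume M: "M \<in> fin_normal G" "N \<subseteq> M"
    show "(f \<otimes>\<^bsub>Ghat\<^esub> g) N \<subseteq> (f \<otimes>\<^bsub>Ghat\<^esub> g) M" unfolding hat_mult[OF N] hat_mult[OF M(1)]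
      using mono_set_mult[OF hat_mono[OF fg(1) N M] hat_mono[OF fg(2) N M]] by (simp add: FactGroup_def)
  qed (simp add: profinite_completion_def)
  show "\<one>\<^bsub>Ghat\<^esub> \<in> carrier Ghat"
  proof (rule hat_carrierI)
    show "\<one>\<^bsub>Ghat\<^esub> N \<in> carrier (G Mod N)" if "N \<in> fin_normal G" for N
      unfolding hat_one[OF that] using monoid.one_closed[OF group.is_monoid[OF Mod_group[OF that]]] by (simp add: FactGroup_def)
  qed (auto simp: profinite_completion_def)
  fix f assume f: "f \<in> carrier Ghat"
  show "\<one>\<^bsub>Ghat\<^esub> \<otimes>\<^bsub>Ghat\<^esub> f = f"
  proof (rule hat_ext[OF mc[OF \<open>\<one>\<^bsub>Ghat\<^esub> \<in> carrier Ghat\<close> f] f])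
    fix N assume N: "N \<in> fin_normal G"
    show "(\<one>\<^bsub>Ghat\<^esub> \<otimes>\<^bsub>Ghat\<^esub> f) N = f N" unfolding hat_mult[OF N] hat_one[OF N]
      using monoid.l_one[OF group.is_monoid[OF Mod_group[OF N]] hat_eval[OF f N]] by (simp add: FactGroup_def)
  qed
  define f' where "f' N = (if N \<in> fin_normal G then inv\<^bsub>G Mod N\<^esub> (f N) else undefined)" for N
  have f': "f' \<in> carrier Ghat"
  proof (rule hat_carrierI)
    fix N assume N: "N \<in> fin_normal G"
    show "f' N \<in> carrier (G Mod N)" unfolding f'_def using N group.inv_closed[OF Mod_group[OF N] hat_eval[OF f N]] by simp
    fix M assume M: "M \<in> fin_normal G" "N \<subseteq> M"
    show "f' N \<subseteq> f' M" unfolding f'_def 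
      using N M normal.inv_FactGroup[OF fin_normal_normal[OF N] hat_eval[OF f N]] 
        normal.inv_FactGroup[OF fin_normal_normal[OF M(1)] hat_eval[OF f M(1)]] hat_mono[OF f N M]
      by (auto simp: SET_INV_def)
  qed (simp add: f'_def)
  show "\<exists>g\<in>carrier Ghat. g \<otimes>\<^bsub>Ghat\<^esub> f = \<one>\<^bsub>Ghat\<^esub>"
  proof (rule bexI[OF _ f'], rule hat_ext[OF mc[OF f' f] \<open>\<one>\<^bsub>Ghat\<^esub> \<in> carrier Ghat\<close>])
    fix N assume N: "N \<in> fin_normal G"
    show "(f' \<otimes>\<^bsub>Ghat\<^esub> f) N = \<one>\<^bsub>Ghat\<^esub> N" unfolding hat_mult[OF N] hat_one[OF N]
      using group.l_inv[OF Mod_group[OF N] hat_eval[OF f N]] N by (simp add: f'_def FactGroup_def)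
  qed
  fix g h assume g: "g \<in> carrier Ghat" and h: "h \<in> carrier Ghat"
  show "f \<otimes>\<^bsub>Ghat\<^esub> g \<otimes>\<^bsub>Ghat\<^esub> h = f \<otimes>\<^bsub>Ghat\<^esub> (g \<otimes>\<^bsub>Ghat\<^esub> h)"
  proof (rule hat_ext[OF mc[OF mc[OF f g] h] mc[OF f mc[OF g h]]])
    fix N assume N: "N \<in> fin_normal G"
    show "(f \<otimes>\<^bsub>Ghat\<^esub> g \<otimes>\<^bsub>Ghat\<^esub> h) N = (f \<otimes>\<^bsub>Ghat\<^esub> (g \<otimes>\<^bsub>Ghat\<^esub> h)) N" unfolding hat_mult[OF N]
      by (rule monoid.m_assoc[OF group.is_monoid[OF Mod_group[OF N]] hat_eval[OF f N] hat_eval[OF g N] hat_eval[OF h N]])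
  qed
qed

lemma iota_eval: "N \<in> fin_normal G \<Longrightarrow> iota x N = N #> x"
  unfolding iota_def by simp

lemma iota_carrier: "x \<in> carrier G \<Longrightarrow> iota x \<in> carrier Ghat"
  by (rule hat_carrierI) (auto simp: iota_def rcosets_carrier r_coset_def)

lemma iota_hom: "iota \<in> hom G Ghat"
proof (rule homI)
  fix x y assume xy: "x \<in> carrier G" "y \<in> carrier G"
  show "iota (x \<otimes> y) = iota x \<otimes>\<^bsub>Ghat\<^esub> iota y"
  proof (rule hat_ext)
    show "iota (x \<otimes> y) \<in> carrier Ghat" "iota x \<otimes>\<^bsub>Ghat\<^esub> iota y \<in> carrier Ghat"
      using xy iota_carrier group.is_monoid[OF hat_group] by (auto intro: monoid.m_closed)
    fix N assume N: "N \<in> fin_normal G"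
    show "iota (x \<otimes> y) N = (iota x \<otimes>\<^bsub>Ghat\<^esub> iota y) N"
      unfolding hat_mult[OF N] iota_eval[OF N] using normal.rcos_sum[OF fin_normal_normal[OF N] xy] by (simp add: FactGroup_def)
  qed
qed (rule iota_carrier)

lemma hat_eval_rep: "f \<in> carrier Ghat \<Longrightarrow> N \<in> fin_normal G \<Longrightarrow> \<exists>w\<in>carrier G. f N = iota w N"
  using hat_eval[of f N] iota_eval[of N] unfolding rcosets_carrier by auto

text \<open>For an intersection of open sets, the value of f at N \<inter> N' has to determine its
  values at N and N'. A representative of the coset at N \<inter> N' lies in both larger cosets and
  so determines them.\<close>

lemma istopology_profinite:
  "istopology (\<lambda>U. U \<subseteq> carrier Ghat \<and> (\<forall>f\<in>U. \<exists>N\<in>fin_normal G. {g \<in> carrier Ghat. g N = f N} \<subseteq> U))"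
  unfolding istopology_def
proof (intro conjI allI impI ballI)
  fix U U' f
  assume U: "U \<subseteq> carrier Ghat \<and> (\<forall>f\<in>U. \<exists>N\<in>fin_normal G. {g \<in> carrier Ghat. g N = f N} \<subseteq> U)"
    and U': "U' \<subseteq> carrier Ghat \<and> (\<forall>f\<in>U'. \<exists>N\<in>fin_normal G. {g \<in> carrier Ghat. g N = f N} \<subseteq> U')"
  show "U \<inter> U' \<subseteq> carrier Ghat" using U by blast
  assume f: "f \<in> U \<inter> U'"
  then have fc: "f \<in> carrier Ghat" using U by blast
  obtain N N' where N: "N \<in> fin_normal G" "{g \<in> carrier Ghat. g N = f N} \<subseteq> U"
    and N': "N' \<in> fin_normal G" "{g \<in> carrier Ghat. g N' = f N'} \<subseteq> U'" using f U U' by blast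
  have I: "N \<inter> N' \<in> fin_normal G" using fin_normal_Int N N' by blast
  have *: "g M = f M" if g: "g \<in> carrier Ghat" "g (N \<inter> N') = f (N \<inter> N')" and M: "M \<in> fin_normal G" "N \<inter> N' \<subseteq> M" for g M
  proof -
    obtain w where w: "w \<in> carrier G" "f (N \<inter> N') = iota w (N \<inter> N')" using hat_eval_rep[OF fc I] by blast
    then have "w \<in> f (N \<inter> N')" using rcoset_mem[OF normal_imp_subgroup[OF fin_normal_normal[OF I]]] iota_eval[OF I] by simp
    then have "w \<in> f M" "w \<in> g M" using hat_mono[OF fc I M] hat_mono[OF g(1) I M] g(2) by auto
    then show ?thesis using coset_determined[OF normal_imp_subgroup[OF fin_normal_normal[OF M(1)]] hat_eval[OF g(1) M(1)] hat_eval[OF fc M(1)]] by blast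
  qed
  show "\<exists>N\<in>fin_normal G. {g \<in> carrier Ghat. g N = f N} \<subseteq> U \<inter> U'"
  proof (rule bexI[OF _ I], rule subsetI)
    fix g assume "g \<in> {g \<in> carrier Ghat. g (N \<inter> N') = f (N \<inter> N')}"
    then have g: "g \<in> carrier Ghat" "g (N \<inter> N') = f (N \<inter> N')" by auto
    have "g N = f N" "g N' = f N'" using *[OF g N(1)] *[OF g N'(1)] by auto
    then show "g \<in> U \<inter> U'" using g(1) N(2) N'(2) by blast
  qed
next
  fix \<K> f assume K: "\<forall>U\<in>\<K>. U \<subseteq> carrier Ghat \<and> (\<forall>f\<in>U. \<exists>N\<in>fin_normal G. {g \<in> carrier Ghat. g N = f N} \<subseteq> U)"
  then show "\<Union>\<K> \<subseteq> carrier Ghat" by blast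
  assume "f \<in> \<Union>\<K>"
  then obtain U where U: "U \<in> \<K>" "f \<in> U" by blast
  then obtain N where "N \<in> fin_normal G" "{g \<in> carrier Ghat. g N = f N} \<subseteq> U" using K by blast
  then show "\<exists>N\<in>fin_normal G. {g \<in> carrier Ghat. g N = f N} \<subseteq> \<Union>\<K>" using U by blast
qed

lemma openin_profinite:
  "openin (profinite_topology G) U \<longleftrightarrow> U \<subseteq> carrier Ghat \<and> (\<forall>f\<in>U. \<exists>N\<in>fin_normal G. {g \<in> carrier Ghat. g N = f N} \<subseteq> U)"
  unfolding profinite_topology_def topology_inverse'[OF istopology_profinite] ..

lemma topspace_profinite: "topspace (profinite_topology G) = carrier Ghat"
proof -
  have "openin (profinite_topology G) (carrier Ghat)" unfolding openin_profinite using fin_normal_carrier by blast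
  then show ?thesis using openin_profinite openin_topspace[of "profinite_topology G"] openin_subset by blast
qed

lemma openin_fibre: "N \<in> fin_normal G \<Longrightarrow> openin (profinite_topology G) {g \<in> carrier Ghat. g N = c}"
  unfolding openin_profinite by blast

end

text \<open>The inverse homeomorphism and the inverse group isomorphism come from separate existence
  statements; they agree on the carrier, which is also the underlying space.\<close>

lemma profinite_iso_sym:
  assumes "group G" "group H" "profinite_iso G H" shows "profinite_iso H G"
proof -
  obtain \<phi> where \<phi>: "\<phi> \<in> iso (profinite_completion G) (profinite_completion H)"
    "homeomorphic_map (profinite_topology G) (profinite_topology H) \<phi>" using assms(3) unfolding profinite_iso_def by blast
  note tG = group.topspace_profinite[OF assms(1)] and tH = group.topspace_profinite[OF assms(2)]
  obtain \<psi> where \<psi>: "homeomorphic_maps (profinite_topology G) (profinite_topology H) \<phi> \<psi>"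
    using \<phi>(2) unfolding homeomorphic_map_maps by blast
  have inj: "inj_on \<phi> (carrier (profinite_completion G))" 
    and im: "\<phi> ` carrier (profinite_completion G) = carrier (profinite_completion H)"
    using \<phi>(1) unfolding iso_def bij_betw_def by auto
  have e: "\<psi> y = inv_into (carrier (profinite_completion G)) \<phi> y" if y: "y \<in> carrier (profinite_completion H)" for y
  proof -
    obtain x where x: "x \<in> carrier (profinite_completion G)" "y = \<phi> x" using y im by blast
    then have "\<psi> y = x" using \<psi> tG unfolding homeomorphic_maps_def by simp
    then show ?thesis using x inj by simp
  qed
  define \<psi>' where "\<psi>' = inv_into (carrier (profinite_completion G)) \<phi>"
  have "\<psi>' \<in> iso (profinite_completion H) (profinite_completion G)" unfolding \<psi>'_def
    by (rule group.iso_set_sym[OF group.hat_group[OF assms(1)] \<phi>(1)])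
  then have c: "\<psi>' \<in> hom (profinite_completion H) (profinite_completion G)"
    "bij_betw \<psi>' (carrier (profinite_completion H)) (carrier (profinite_completion G))" unfolding iso_def by auto
  note mc = monoid.m_closed[OF group.is_monoid[OF group.hat_group[OF assms(2)]]]
  have "\<psi> \<in> hom (profinite_completion H) (profinite_completion G)"
    by (rule homI) (use e[folded \<psi>'_def] c(1) mc in \<open>auto simp: hom_def Pi_iff\<close>)
  moreover have "bij_betw \<psi> (carrier (profinite_completion H)) (carrier (profinite_completion G))"
    using c(2) e[folded \<psi>'_def] bij_betw_cong[of "carrier (profinite_completion H)" \<psi> \<psi>'] by blast
  ultimately have "\<psi> \<in> iso (profinite_completion H) (profinite_completion G)" unfolding iso_def by blast
  moreover have "homeomorphic_map (profinite_topology H) (profinite_topology G) \<psi>"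
    using \<psi> homeomorphic_maps_sym homeomorphic_map_maps by blast
  ultimately show ?thesis unfolding profinite_iso_def by blast
qed

text \<open>All that is used of an isomorphism: by continuity H maps to the completion of G with
  dense image, and by openness the topology induced on H is no coarser than the profinite topology
  of H.\<close>

lemma profinite_iso_dense:
  assumes G: "group G" and H: "group H" and iso: "profinite_iso H G"
  obtains \<sigma> where "\<sigma> \<in> hom H (profinite_completion G)"
    "\<And>N c. N \<in> fin_normal G \<Longrightarrow> c \<in> carrier (G Mod N) \<Longrightarrow> \<exists>h\<in>carrier H. \<sigma> h N = c"
    "\<And>M. M \<in> fin_normal H \<Longrightarrow> \<exists>N\<in>fin_normal G. \<forall>h\<in>carrier H. \<sigma> h N = N \<longrightarrow> h \<in> M"
proof -
  interpret G: group G by (rule G)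
  interpret H: group H by (rule H)
  obtain \<psi> where \<psi>: "\<psi> \<in> iso H.Ghat G.Ghat" "homeomorphic_map (profinite_topology H) (profinite_topology G) \<psi>"
    using iso unfolding profinite_iso_def by blast
  have inj: "inj_on \<psi> (carrier H.Ghat)" and im: "\<psi> ` carrier H.Ghat = carrier G.Ghat" and hm: "\<psi> \<in> hom H.Ghat G.Ghat"
    using \<psi>(1) unfolding iso_def bij_betw_def by auto
  have cont: "continuous_map (profinite_topology H) (profinite_topology G) \<psi>" 
    and opn: "open_map (profinite_topology H) (profinite_topology G) \<psi>"
    using \<psi>(2) homeomorphic_imp_continuous_map homeomorphic_imp_open_map by blast+
  show thesis
  proof (rule that[of "\<psi> \<circ> H.iota"])
    show "\<psi> \<circ> H.iota \<in> hom H G.Ghat" using H.iota_hom hm by (rule Group.hom_compose)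
  next
    fix N c assume N: "N \<in> fin_normal G" and c: "c \<in> carrier (G Mod N)"
    obtain x where x: "x \<in> carrier G" "c = N #>\<^bsub>G\<^esub> x" using c unfolding G.rcosets_carrier by auto
    obtain y where y: "y \<in> carrier H.Ghat" "\<psi> y = G.iota x" using G.iota_carrier[OF x(1)] im by (metis imageE)
    define P where "P = {y \<in> topspace (profinite_topology H). \<psi> y \<in> {g \<in> carrier G.Ghat. g N = c}}"
    have o: "openin (profinite_topology H) P" unfolding P_def
      by (rule openin_continuous_map_preimage[OF cont G.openin_fibre[OF N]])
    have yP: "y \<in> P" unfolding P_def
      using y x G.iota_carrier[OF x(1)] G.iota_eval[OF N] H.topspace_profinite by simp
    have "\<exists>M\<in>fin_normal H. {g \<in> carrier H.Ghat. g M = y M} \<subseteq> P"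
      by (rule bspec[OF conjunct2[OF o[unfolded H.openin_profinite]] yP])
    then obtain M where M: "M \<in> fin_normal H" "{g \<in> carrier H.Ghat. g M = y M} \<subseteq> P" by blast
    obtain h where h: "h \<in> carrier H" "y M = H.iota h M" using H.hat_eval_rep[OF y(1) M(1)] by blast
    then have "H.iota h \<in> {g \<in> carrier H.Ghat. g M = y M}" using H.iota_carrier by simp
    then have "\<psi> (H.iota h) N = c" using M(2) unfolding P_def by blast
    then show "\<exists>h\<in>carrier H. (\<psi> \<circ> H.iota) h N = c" using h(1) by auto
  next
    fix M assume M: "M \<in> fin_normal H"
    define U where "U = {g \<in> carrier H.Ghat. g M = M}"
    have "openin (profinite_topology G) (\<psi> ` U)" using opn H.openin_fibre[OF M] unfolding open_map_def U_def by blast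
    moreover have "\<one>\<^bsub>H.Ghat\<^esub> \<in> U" unfolding U_def using H.hat_one[OF M] monoid.one_closed[OF group.is_monoid[OF H.hat_group]] by simp
    moreover have "\<psi> \<one>\<^bsub>H.Ghat\<^esub> = \<one>\<^bsub>G.Ghat\<^esub>" using hom_one[OF hm H.hat_group G.hat_group] .
    ultimately have o: "openin (profinite_topology G) (\<psi> ` U)" "\<one>\<^bsub>G.Ghat\<^esub> \<in> \<psi> ` U" by (auto intro: rev_image_eqI)
    have "\<exists>N\<in>fin_normal G. {g \<in> carrier G.Ghat. g N = \<one>\<^bsub>G.Ghat\<^esub> N} \<subseteq> \<psi> ` U"
      by (rule bspec[OF conjunct2[OF o(1)[unfolded G.openin_profinite]] o(2)])
    then obtain N where N: "N \<in> fin_normal G" "{g \<in> carrier G.Ghat. g N = \<one>\<^bsub>G.Ghat\<^esub> N} \<subseteq> \<psi> ` U" by blast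
    have "h \<in> M" if h: "h \<in> carrier H" "\<psi> (H.iota h) N = N" for h
    proof -
      have ic: "H.iota h \<in> carrier H.Ghat" using H.iota_carrier[OF h(1)] .
      then have "\<psi> (H.iota h) \<in> \<psi> ` U" using N h(2) G.hat_one[OF N(1)] im by auto
      then have "H.iota h \<in> U" using inj ic unfolding U_def inj_on_def by auto
      then have "M #>\<^bsub>H\<^esub> h = M" unfolding U_def using H.iota_eval[OF M] by simp
      then show ?thesis using H.rcoset_mem[OF normal_imp_subgroup[OF H.fin_normal_normal[OF M]] h(1)] by simp
    qed
    then show "\<exists>N\<in>fin_normal G. \<forall>h\<in>carrier H. (\<psi> \<circ> H.iota) h N = N \<longrightarrow> h \<in> M" using N(1) by auto
  qed
qed

section \<open>The coset graphs of a splitting in the completion\<close>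

context group
begin

text \<open>The kernel of the projection to the quotient by N. These open normal subgroups are the
  levels of the tower.\<close>

definition hat_kernel :: "'a set \<Rightarrow> ('a set \<Rightarrow> 'a set) set" where
  "hat_kernel N = {f \<in> carrier Ghat. f N = N}"

lemma level_fun_coset:
  assumes "N \<lhd> G" "right_inv N g" "w \<in> carrier G" "w' \<in> carrier G" "N #> w = N #> w'"
  shows "g w = g w'"
proof -
  define n where "n = w \<otimes> inv w'"
  have Ns: "subgroup N G" using assms(1) normal_imp_subgroup by blast
  have n: "n \<in> N" "n \<in> carrier G" unfolding n_def using rcoset_eq_iff[OF Ns assms(3,4)] assms(3-5) by auto
  have c: "inv w' \<otimes> n \<otimes> w' \<in> N" using normal.inv_op_closed1[OF assms(1,4) n(1)] .
  have "w = w' \<otimes> (inv w' \<otimes> n \<otimes> w')" unfolding n_def using assms(3,4)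
    by (simp add: m_assoc) (simp add: m_assoc[symmetric])
  then show ?thesis using assms(2,4) c unfolding right_inv_def by metis
qed

lemma Mod_one: "\<one>\<^bsub>G Mod N\<^esub> = N"
  unfolding FactGroup_def by simp

lemma hat_kernel_normal:
  assumes N: "N \<in> fin_normal G" shows "hat_kernel N \<lhd> Ghat"
proof -
  interpret h: group_hom Ghat "G Mod N" "\<lambda>f. f N"
  proof (intro group_hom.intro hat_group Mod_group[OF N] group_hom_axioms.intro homI)
    show "f N \<in> carrier (G Mod N)" if "f \<in> carrier Ghat" for f using hat_eval[OF that N] .
    show "(f \<otimes>\<^bsub>Ghat\<^esub> g) N = f N \<otimes>\<^bsub>G Mod N\<^esub> g N" for f g by (rule hat_mult[OF N])
  qed
  have "hat_kernel N = kernel Ghat (G Mod N) (\<lambda>f. f N)" unfolding hat_kernel_def kernel_def Mod_one ..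
  then show ?thesis using h.normal_kernel by simp
qed

lemma hat_kernel_mono:
  assumes "N \<in> fin_normal G" "M \<in> fin_normal G" "N \<subseteq> M" shows "hat_kernel N \<subseteq> hat_kernel M"
proof
  fix f assume "f \<in> hat_kernel N"
  then have f: "f \<in> carrier Ghat" "f N = N" unfolding hat_kernel_def by auto
  have Ms: "subgroup M G" using fin_normal_normal[OF assms(2)] normal_imp_subgroup by blast
  have "\<one> \<in> f M" using hat_mono[OF f(1) assms] f(2) subgroup.one_closed[OF normal_imp_subgroup[OF fin_normal_normal[OF assms(1)]]] by auto
  moreover have "M \<in> carrier (G Mod M)" using monoid.one_closed[OF group.is_monoid[OF Mod_group[OF assms(2)]]] unfolding Mod_one .
  ultimately have "f M = M" using coset_determined[OF Ms hat_eval[OF f(1) assms(2)]] subgroup.one_closed[OF Ms] by blast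
  then show "f \<in> hat_kernel M" unfolding hat_kernel_def using f by simp
qed

text \<open>At level M the completion and G have the same finite quotient, so level functions go
  back and forth through \<open>iota\<close> and coset representatives. The images of A, B and C
  need not be closed; only their products with open kernels occur, so they serve as well as their
  closures.\<close>

lemma profinite_tower:
  assumes sub: "subgroup A G" "subgroup B G" "subgroup C G" and CAB: "C \<subseteq> A" "C \<subseteq> B"
    and gen: "generate G (A \<union> B) = carrier G"
    and split: "\<And>(p::nat) N (f :: 'a \<Rightarrow> int). 0 < p \<Longrightarrow> N \<in> fin_normal G \<Longrightarrow> level_fun C N f \<Longrightarrow>
      \<exists>M\<in>fin_normal G. \<exists>gA gB. level_fun A M gA \<and> level_fun B M gB \<and> (\<forall>x\<in>carrier G. [f x = gA x - gB x] (mod int p))"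
  shows "tree_tower Ghat (hat_kernel ` fin_normal G) (iota ` A) (iota ` B) (iota ` C)"
proof -
  interpret hat: group Ghat by (rule hat_group)
  interpret i: group_hom G Ghat iota by (intro group_hom.intro group_axioms hat_group group_hom_axioms.intro iota_hom)
  have mulk: "(x \<otimes>\<^bsub>Ghat\<^esub> k) N = x N" if "N \<in> fin_normal G" "x \<in> carrier Ghat" "k \<in> hat_kernel N" for x k N
    unfolding hat_mult[OF that(1)] using that(3) monoid.r_one[OF group.is_monoid[OF Mod_group[OF that(1)]] hat_eval[OF that(2,1)]]
    unfolding Mod_one hat_kernel_def by simp
  have muli: "(x \<otimes>\<^bsub>Ghat\<^esub> iota a) N = iota (w \<otimes> a) N" if "N \<in> fin_normal G" "x N = iota w N" "w \<in> carrier G" "a \<in> carrier G" for x a w N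
    unfolding hat_mult[OF that(1)] that(2) i.hom_mult[OF that(3,4)] ..
  define rep where "rep x M = (SOME w. w \<in> carrier G \<and> x M = iota w M)" for x :: "'a set \<Rightarrow> 'a set" and M
  have rep: "rep x M \<in> carrier G \<and> x M = iota (rep x M) M" if "x \<in> carrier Ghat" "M \<in> fin_normal G" for x M
    unfolding rep_def by (rule someI_ex) (use hat_eval_rep[OF that] in \<open>simp add: Bex_def\<close>)
  have rep_eq: "g (rep x M) = g w" if "x \<in> carrier Ghat" "M \<in> fin_normal G" "right_inv M g" "w \<in> carrier G" "x M = iota w M" for g :: "'a \<Rightarrow> int" and x M w
  proof (rule level_fun_coset[OF fin_normal_normal[OF that(2)] that(3) _ that(4)])
    show "rep x M \<in> carrier G" using rep[OF that(1,2)] by blast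
    have "iota (rep x M) M = iota w M" using rep[OF that(1,2)] that(5) by metis
    then show "M #> rep x M = M #> w" unfolding iota_eval[OF that(2)] .
  qed
  have lift: "hat.level_fun (iota ` S) (hat_kernel M) (\<lambda>x. g (rep x M))"
    if S: "S \<subseteq> carrier G" and M: "M \<in> fin_normal G" and g: "level_fun S M g" for S M and g :: "'a \<Rightarrow> int"
    unfolding hat.level_fun_def hat.right_inv_def
  proof (intro conjI ballI)
    have gM: "right_inv M g" using g unfolding level_fun_def by blast
    fix x assume x: "x \<in> carrier Ghat"
    fix y assume "y \<in> iota ` S"
    then obtain a where a: "a \<in> S" "y = iota a" by blast
    then have ac: "a \<in> carrier G" using S by auto
    have w: "rep x M \<in> carrier G" "x M = iota (rep x M) M" using rep[OF x M] by auto
    have "g (rep (x \<otimes>\<^bsub>Ghat\<^esub> y) M) = g (rep x M \<otimes> a)"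
      by (rule rep_eq[OF _ M gM]) (use x a ac w muli[of M x "rep x M" a, OF M w(2,1) ac] iota_carrier in auto)
    then show "g (rep (x \<otimes>\<^bsub>Ghat\<^esub> y) M) = g (rep x M)" using g w(1) a(1) unfolding level_fun_def right_inv_def by simp
  next
    fix x k assume x: "x \<in> carrier Ghat" and k: "k \<in> hat_kernel M"
    have "rep (x \<otimes>\<^bsub>Ghat\<^esub> k) M = rep x M" unfolding rep_def mulk[OF M x k] ..
    then show "g (rep (x \<otimes>\<^bsub>Ghat\<^esub> k) M) = g (rep x M)" by simp
  qed
  have cA: "A \<subseteq> carrier G" "B \<subseteq> carrier G" "C \<subseteq> carrier G" using sub subgroup.subset by blast+
  show ?thesis
  proof (intro tree_tower.intro tree_tower_axioms.intro hat_group)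
    fix N assume "N \<in> hat_kernel ` fin_normal G"
    then show "N \<lhd> Ghat" using hat_kernel_normal by blast
  next
    show "hat_kernel ` fin_normal G \<noteq> {}" using fin_normal_carrier by blast
  next
    fix N M assume "N \<in> hat_kernel ` fin_normal G" "M \<in> hat_kernel ` fin_normal G"
    then obtain N' M' where NM: "N = hat_kernel N'" "N' \<in> fin_normal G" "M = hat_kernel M'" "M' \<in> fin_normal G" by blast
    have I: "N' \<inter> M' \<in> fin_normal G" using fin_normal_Int NM by blast
    have "hat_kernel (N' \<inter> M') \<subseteq> N \<inter> M" unfolding NM using hat_kernel_mono[OF I NM(2)] hat_kernel_mono[OF I NM(4)] by blast
    then show "\<exists>L\<in>hat_kernel ` fin_normal G. L \<subseteq> N \<inter> M" using I by blast
  next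
    show "subgroup (iota ` A) Ghat" "subgroup (iota ` B) Ghat" "subgroup (iota ` C) Ghat"
      using sub i.subgroup_img_is_subgroup by blast+
    show "iota ` C \<subseteq> iota ` A" "iota ` C \<subseteq> iota ` B" using CAB by blast+
  next
    fix N D x assume "N \<in> hat_kernel ` fin_normal G" and lA: "hat.level_fun (iota ` A) N (D :: ('a set \<Rightarrow> 'a set) \<Rightarrow> bool)"
      and lB: "hat.level_fun (iota ` B) N D" and x: "x \<in> carrier Ghat"
    then obtain M where M: "N = hat_kernel M" "M \<in> fin_normal G" by blast
    have inv: "\<forall>y\<in>carrier Ghat. D (y \<otimes>\<^bsub>Ghat\<^esub> iota g) = D y" if "g \<in> generate G (A \<union> B)" for g
      using that
    proof (induction rule: generate.induct)
      case one
      then show ?case by simp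
    next
      case (incl h)
      then show ?case using lA lB unfolding hat.level_fun_def hat.right_inv_def by blast
    next
      case (inv h)
      then have "inv h \<in> A \<union> B" using subgroup.m_inv_closed[OF sub(1)] subgroup.m_inv_closed[OF sub(2)] by blast
      then show ?case using lA lB unfolding hat.level_fun_def hat.right_inv_def by blast
    next
      case (eng g h)
      then have c: "g \<in> carrier G" "h \<in> carrier G" using gen by auto
      show ?case
      proof
        fix y assume y: "y \<in> carrier Ghat"
        have "y \<otimes>\<^bsub>Ghat\<^esub> iota (g \<otimes> h) = (y \<otimes>\<^bsub>Ghat\<^esub> iota g) \<otimes>\<^bsub>Ghat\<^esub> iota h"
          using y c iota_carrier by (simp add: i.hom_mult hat.m_assoc)
        then show "D (y \<otimes>\<^bsub>Ghat\<^esub> iota (g \<otimes> h)) = D y" using eng.IH y c iota_carrier hat.m_closed by metis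
      qed
    qed
    obtain w where w: "w \<in> carrier G" "x M = iota w M" using hat_eval_rep[OF x M(2)] by blast
    define k where "k = inv\<^bsub>Ghat\<^esub> (iota w) \<otimes>\<^bsub>Ghat\<^esub> x"
    have ic: "iota w \<in> carrier Ghat" using w iota_carrier by blast
    have kc: "k \<in> carrier Ghat" unfolding k_def using ic x by simp
    have xk: "x = iota w \<otimes>\<^bsub>Ghat\<^esub> k" unfolding k_def using ic x by (simp add: hat.m_assoc[symmetric])
    have "k M = (inv\<^bsub>Ghat\<^esub> (iota w) \<otimes>\<^bsub>Ghat\<^esub> iota w) M" unfolding k_def hat_mult[OF M(2)] w(2) ..
    then have "k \<in> hat_kernel M" unfolding hat_kernel_def using kc ic hat_one[OF M(2)] by simp
    then have "D x = D (iota w)" using lA ic unfolding xk hat.level_fun_def hat.right_inv_def M(1) by blast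
    also have "\<dots> = D (\<one>\<^bsub>Ghat\<^esub> \<otimes>\<^bsub>Ghat\<^esub> iota w)" using ic by simp
    also have "\<dots> = D \<one>\<^bsub>Ghat\<^esub>" by (rule bspec[OF inv hat.one_closed]) (use w(1) gen in simp)
    finally show "D x = D \<one>\<^bsub>Ghat\<^esub>" .
  next
    fix p :: nat and N f assume p: "0 < p" and "N \<in> hat_kernel ` fin_normal G" and f: "hat.level_fun (iota ` C) N (f :: ('a set \<Rightarrow> 'a set) \<Rightarrow> int)"
    then obtain M where M: "N = hat_kernel M" "M \<in> fin_normal G" by blast
    have "level_fun C M (\<lambda>w. f (iota w))" unfolding level_fun_def right_inv_def
    proof (intro conjI ballI)
      fix x y assume x: "x \<in> carrier G" and y: "y \<in> C"
      then have yc: "y \<in> carrier G" using cA by auto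
      have "f (iota x \<otimes>\<^bsub>Ghat\<^esub> iota y) = f (iota x)"
        using f[unfolded hat.level_fun_def hat.right_inv_def, THEN conjunct1, THEN bspec, OF iota_carrier[OF x], THEN bspec, OF imageI[OF y]] .
      then show "f (iota (x \<otimes> y)) = f (iota x)" unfolding i.hom_mult[OF x yc] .
    next
      fix x y assume x: "x \<in> carrier G" and y: "y \<in> M"
      have Ms: "subgroup M G" using normal_imp_subgroup[OF fin_normal_normal[OF M(2)]] .
      have yc: "y \<in> carrier G" by (rule subgroup.mem_carrier[OF Ms y])
      have "iota y \<in> hat_kernel M" unfolding hat_kernel_def using iota_carrier[OF yc] iota_eval[OF M(2), of y] coset_join2[OF yc Ms y] by simp
      then have "f (iota x \<otimes>\<^bsub>Ghat\<^esub> iota y) = f (iota x)"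
        using f[unfolded M hat.level_fun_def hat.right_inv_def, THEN conjunct2, THEN bspec, OF iota_carrier[OF x], THEN bspec] by blast
      then show "f (iota (x \<otimes> y)) = f (iota x)" unfolding i.hom_mult[OF x yc] .
    qed
    from split[OF p M(2) this] obtain L gA gB where L: "L \<in> fin_normal G" "level_fun A L gA" "level_fun B L gB" 
      "\<forall>w\<in>carrier G. [f (iota w) = gA w - gB w] (mod int p)" by (elim bexE exE conjE) (rule that)
    have "[f x = gA (rep x L) - gB (rep x L)] (mod int p)" if x: "x \<in> carrier Ghat" for x
    proof -
      \<comment> \<open>One representative w has to compute f at level M and the two parts at level
        L at the same time.\<close>
      have I: "M \<inter> L \<in> fin_normal G" using fin_normal_Int M L by blast
      obtain w where w: "w \<in> carrier G" "x (M \<inter> L) = iota w (M \<inter> L)" using hat_eval_rep[OF x I] by blast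
      have ic: "iota w \<in> carrier Ghat" using w iota_carrier by blast
      define k where "k = inv\<^bsub>Ghat\<^esub> (iota w) \<otimes>\<^bsub>Ghat\<^esub> x"
      have kc: "k \<in> carrier Ghat" unfolding k_def using ic x by simp
      have xk: "x = iota w \<otimes>\<^bsub>Ghat\<^esub> k" unfolding k_def using ic x by (simp add: hat.m_assoc[symmetric])
      have "k (M \<inter> L) = (inv\<^bsub>Ghat\<^esub> (iota w) \<otimes>\<^bsub>Ghat\<^esub> iota w) (M \<inter> L)" unfolding k_def hat_mult[OF I] w(2) ..
      then have k: "k \<in> hat_kernel (M \<inter> L)" unfolding hat_kernel_def using kc ic hat_one[OF I] by simp
      have kM: "k \<in> hat_kernel M" "k \<in> hat_kernel L" using k hat_kernel_mono[OF I M(2)] hat_kernel_mono[OF I L(1)] by auto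
      have fx: "f x = f (iota w)" unfolding xk
        by (rule f[unfolded M(1) hat.level_fun_def hat.right_inv_def, THEN conjunct2, THEN bspec, OF ic, THEN bspec, OF kM(1)])
      have "x L = iota w L" unfolding xk mulk[OF L(1) ic kM(2)] ..
      then have "gA (rep x L) = gA w" "gB (rep x L) = gB w"
        using rep_eq[OF x L(1) _ w(1)] L(2,3) unfolding level_fun_def by auto
      then show ?thesis using L(4) w(1) fx by simp
    qed
    then show "\<exists>M\<in>hat_kernel ` fin_normal G. \<exists>fA fB. hat.level_fun (iota ` A) M fA \<and> hat.level_fun (iota ` B) M fB \<and>
      (\<forall>x\<in>carrier Ghat. [f x = fA x - fB x] (mod int p))"
      using lift[OF cA(1) L(1,2)] lift[OF cA(2) L(1,3)] L(1) 
      by (intro bexI[of _ "hat_kernel L"] exI[of _ "\<lambda>x. gA (rep x L)"] exI[of _ "\<lambda>x. gB (rep x L)"]) auto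
  qed
qed

definition residually_finite :: bool where
  "residually_finite \<longleftrightarrow> (\<forall>g\<in>carrier G. g \<noteq> \<one> \<longrightarrow> (\<exists>N\<in>fin_normal G. g \<notin> N))"

lemma residually_finite_avoid:
  assumes "residually_finite" "finite F" "F \<subseteq> carrier G - {\<one>}"
  shows "\<exists>N\<in>fin_normal G. F \<inter> N = {}"
  using assms(2,3)
proof (induction F rule: finite_induct)
  case empty
  then show ?case using fin_normal_carrier by blast
next
  case (insert g F)
  then obtain N where N: "N \<in> fin_normal G" "F \<inter> N = {}" by blast
  obtain M where "M \<in> fin_normal G" "g \<notin> M" using assms(1) insert.prems unfolding residually_finite_def by blast
  then show ?case using fin_normal_Int[OF N(1), of M] N(2) by (intro bexI[of _ "N \<inter> M"]) auto
qed

end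

text \<open>Connectedness of the induced graph through sets closed under adjacency, the form in
  which it is applied. The empty set counts as connected.\<close>

definition connected_in :: "('i \<Rightarrow> 'i \<Rightarrow> bool) \<Rightarrow> 'i set \<Rightarrow> bool" where
  "connected_in adj J \<longleftrightarrow> (\<forall>Z\<subseteq>J. Z \<noteq> {} \<longrightarrow> (\<forall>v\<in>Z. \<forall>w\<in>J. adj v w \<longrightarrow> w \<in> Z) \<longrightarrow> Z = J)"

text \<open>The group H, mapped densely into the profinite completion of G, would fix a vertex of the profinite tree of the
  splitting, and then A or B would be dense.\<close>

theorem splitting_not_profinite_iso:
  fixes G :: "('a, 'b) monoid_scheme" (structure) and H :: "('c, 'd) monoid_scheme" and s :: "'i \<Rightarrow> 'c"
  assumes G: "group G" and H: "group H"
    and sub: "subgroup A G" "subgroup B G" "subgroup C G" and CAB: "C \<subseteq> A" "C \<subseteq> B" and finC: "finite C"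
    and gen: "generate G (A \<union> B) = carrier G"
    and split: "\<And>(p::nat) N (f :: 'a \<Rightarrow> int). 0 < p \<Longrightarrow> N \<in> fin_normal G \<Longrightarrow> group.level_fun G C N f \<Longrightarrow>
      \<exists>M\<in>fin_normal G. \<exists>gA gB. group.level_fun G A M gA \<and> group.level_fun G B M gB \<and> (\<forall>x\<in>carrier G. [f x = gA x - gB x] (mod int p))"
    and NA: "NA \<in> fin_normal G" "A <#> NA \<noteq> carrier G" and NB: "NB \<in> fin_normal G" "B <#> NB \<noteq> carrier G"
    and I: "finite I" "s ` I \<subseteq> carrier H" "generate H (s ` I) = carrier H"
    and invol: "\<And>v. v \<in> I \<Longrightarrow> s v \<otimes>\<^bsub>H\<^esub> s v = \<one>\<^bsub>H\<^esub>"
    and adj: "\<And>v w. v \<in> I \<Longrightarrow> w \<in> I \<Longrightarrow> adj v w \<Longrightarrow> \<exists>m>0. (s v \<otimes>\<^bsub>H\<^esub> s w) [^]\<^bsub>H\<^esub> (m::nat) = \<one>\<^bsub>H\<^esub>"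
    and rf: "group.residually_finite H"
    and conn: "\<And>J. J \<subseteq> I \<Longrightarrow> finite (generate H (s ` J)) \<Longrightarrow> connected_in adj (I - J)"
  shows "\<not> profinite_iso H G"
proof
  assume iso: "profinite_iso H G"
  interpret G: group G by (rule G)
  interpret H: group H by (rule H)
  interpret T: tree_tower G.Ghat "G.hat_kernel ` fin_normal G" "G.iota ` A" "G.iota ` B" "G.iota ` C"
    by (rule G.profinite_tower[OF sub CAB gen split])
  obtain \<sigma> where hom: "\<sigma> \<in> hom H G.Ghat"
    and dense: "\<And>N c. N \<in> fin_normal G \<Longrightarrow> c \<in> carrier (G Mod N) \<Longrightarrow> \<exists>h\<in>carrier H. \<sigma> h N = c"
    and dom: "\<And>M. M \<in> fin_normal H \<Longrightarrow> \<exists>N\<in>fin_normal G. \<forall>h\<in>carrier H. \<sigma> h N = N \<longrightarrow> h \<in> M"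
    by (rule profinite_iso_dense[OF G H iso]) (rule that)
  interpret \<sigma>: group_hom H G.Ghat \<sigma> by (intro group_hom.intro H G.hat_group group_hom_axioms.intro hom)
  have sc: "s v \<in> carrier H" if "v \<in> I" for v using I(2) that by auto
  \<comment> \<open>One element more than C has: if such a set is conjugated into C modulo the
    kernel, two of its members become equal.\<close>
  define Big where "Big J F \<longleftrightarrow> F \<subseteq> generate H (s ` J) \<and> finite F \<and> card F = Suc (card C)" for J F
  have "\<exists>F. Big J F" if "infinite (generate H (s ` J))" for J
    unfolding Big_def using infinite_arbitrarily_large[OF that, of "Suc (card C)"] by blast
  then obtain F where F: "\<And>J. infinite (generate H (s ` J)) \<Longrightarrow> Big J (F J)" by metis
  \<comment> \<open>These quotients have to survive in one finite quotient of H. There are finitely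
    many of them, because there are finitely many J.\<close>
  define E where "E = (\<Union>J\<in>{J. J \<subseteq> I \<and> infinite (generate H (s ` J))}. (\<lambda>(h, h'). inv\<^bsub>H\<^esub> h \<otimes>\<^bsub>H\<^esub> h') ` (F J \<times> F J)) - {\<one>\<^bsub>H\<^esub>}"
  have Fc: "F J \<subseteq> carrier H" if "J \<subseteq> I" "infinite (generate H (s ` J))" for J
  proof -
    have "s ` J \<subseteq> carrier H" using that(1) I(2) by auto
    from H.generate_incl[OF this] show ?thesis using F[OF that(2)] unfolding Big_def by blast
  qed
  define \<J> where "\<J> = {J. J \<subseteq> I \<and> infinite (generate H (s ` J))}"
  have "finite \<J>" unfolding \<J>_def using I(1) by (rule finite_subset[rotated, OF finite_Pow_iff[THEN iffD2]]) auto
  moreover have "finite (F J)" if "J \<in> \<J>" for J using F[of J] that unfolding \<J>_def Big_def by simp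
  ultimately have "finite E" unfolding E_def \<J>_def[symmetric] by (intro finite_Diff finite_UN_I finite_imageI finite_cartesian_product)
  moreover have "inv\<^bsub>H\<^esub> h \<otimes>\<^bsub>H\<^esub> h' \<in> carrier H" if "J \<in> \<J>" "h \<in> F J" "h' \<in> F J" for J h h'
    using Fc[of J] that unfolding \<J>_def by (auto dest: subsetD)
  then have "E \<subseteq> carrier H - {\<one>\<^bsub>H\<^esub>}" unfolding E_def \<J>_def[symmetric] by auto
  ultimately obtain M where M: "M \<in> fin_normal H" "E \<inter> M = {}" using H.residually_finite_avoid[OF rf] by blast
  obtain N1 where N1: "N1 \<in> fin_normal G" "\<forall>h\<in>carrier H. \<sigma> h N1 = N1 \<longrightarrow> h \<in> M" using dom[OF M(1)] by blast
  define N0 where "N0 = N1 \<inter> (NA \<inter> NB)"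
  have N0: "N0 \<in> fin_normal G" unfolding N0_def using G.fin_normal_Int N1 NA NB by blast
  note kn = G.hat_kernel_normal[OF N0]
  note ks = normal_imp_subgroup[OF kn]
  have k1: "h \<in> M" if "h \<in> carrier H" "\<sigma> h \<in> G.hat_kernel N0" for h
  proof -
    have "G.hat_kernel N0 \<subseteq> G.hat_kernel N1" by (rule G.hat_kernel_mono[OF N0 N1(1)]) (auto simp: N0_def)
    then have "\<sigma> h N1 = N1" using that(2) unfolding G.hat_kernel_def by auto
    then show ?thesis using N1(2) that(1) by blast
  qed
  \<comment> \<open>The subgroup generated by elements fixing an edge at level N0 is conjugated into
    C times the kernel. If it were infinite, the pigeonhole principle would put a member of
    \<open>E\<close> into the kernel and hence into M.\<close>
  have small: "finite (generate H (s ` J))" if J: "J \<subseteq> I" and x: "x \<in> T.fix_set (G.iota ` C) (G.hat_kernel N0) (\<sigma> ` s ` J)" for J x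
  proof (rule ccontr)
    assume inf: "infinite (generate H (s ` J))"
    have xc: "x \<in> carrier G.Ghat" using x unfolding T.fix_set_def by blast
    have sJ: "s ` J \<subseteq> carrier H" using J I(2) by auto
    define Y where "Y = G.iota ` C <#>\<^bsub>G.Ghat\<^esub> G.hat_kernel N0"
    interpret Y: subgroup Y G.Ghat unfolding Y_def by (rule T.setmult_subgroup[OF T.subC kn])
    define cj where "cj h = inv\<^bsub>G.Ghat\<^esub> x \<otimes>\<^bsub>G.Ghat\<^esub> \<sigma> h \<otimes>\<^bsub>G.Ghat\<^esub> x" for h
    have cjm: "cj (g \<otimes>\<^bsub>H\<^esub> h) = cj g \<otimes>\<^bsub>G.Ghat\<^esub> cj h" if "g \<in> carrier H" "h \<in> carrier H" for g h
      unfolding cj_def using that xc by (simp add: T.m_assoc) (simp add: T.m_assoc[symmetric])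
    have cjc: "cj g \<in> carrier G.Ghat" if "g \<in> carrier H" for g unfolding cj_def using that xc by simp
    have cj1: "cj \<one>\<^bsub>H\<^esub> = \<one>\<^bsub>G.Ghat\<^esub>" unfolding cj_def using xc by simp
    have cji: "cj (inv\<^bsub>H\<^esub> g) = inv\<^bsub>G.Ghat\<^esub> (cj g)" if "g \<in> carrier H" for g
    proof -
      have "cj (inv\<^bsub>H\<^esub> g) \<otimes>\<^bsub>G.Ghat\<^esub> cj g = \<one>\<^bsub>G.Ghat\<^esub>" using cjm[of "inv\<^bsub>H\<^esub> g" g] cj1 that by simp
      then show ?thesis using T.inv_equality[of "cj (inv\<^bsub>H\<^esub> g)" "cj g"] cjc that by simp
    qed
    have inY: "cj g \<in> Y" if "g \<in> generate H (s ` J)" for g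
      using that
    proof (induction rule: generate.induct)
      case one
      then show ?case using cj1 by simp
    next
      case (incl h)
      then show ?case using x unfolding T.fix_set_def Y_def cj_def by auto
    next
      case (inv h)
      then have "cj h \<in> Y" using x unfolding T.fix_set_def Y_def cj_def by auto
      then show ?case using cji[of h] sJ inv by auto
    next
      case (eng g h)
      then have "g \<in> carrier H" "h \<in> carrier H" using H.generate_incl[OF sJ] by auto
      then show ?case using cjm eng.IH by simp
    qed
    have FB: "F J \<subseteq> generate H (s ` J)" "finite (F J)" "card (F J) = Suc (card C)" using F[OF inf] unfolding Big_def by auto
    have "\<exists>c\<in>G.iota ` C. \<exists>k\<in>G.hat_kernel N0. cj g = c \<otimes>\<^bsub>G.Ghat\<^esub> k" if "g \<in> F J" for g
    proof -
      have "cj g \<in> Y" using inY FB(1) that by blast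
      then show ?thesis unfolding Y_def set_mult_def by blast
    qed
    then obtain c k where ck: "\<And>g. g \<in> F J \<Longrightarrow> c g \<in> G.iota ` C \<and> k g \<in> G.hat_kernel N0 \<and> cj g = c g \<otimes>\<^bsub>G.Ghat\<^esub> k g" by metis
    have "\<not> inj_on c (F J)"
    proof
      assume "inj_on c (F J)"
      then have "card (F J) \<le> card (G.iota ` C)" using ck finC by (intro card_inj_on_le[of c]) auto
      also have "\<dots> \<le> card C" using finC by (rule card_image_le)
      finally show False using FB(3) by simp
    qed
    then obtain g h where gh: "g \<in> F J" "h \<in> F J" "g \<noteq> h" "c g = c h" unfolding inj_on_def by blast
    have ghc: "g \<in> carrier H" "h \<in> carrier H" using gh Fc[OF J inf] by auto
    define d where "d = inv\<^bsub>H\<^esub> g \<otimes>\<^bsub>H\<^esub> h"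
    have dc: "d \<in> carrier H" unfolding d_def using ghc by simp
    have kc: "k g \<in> carrier G.Ghat" "k h \<in> carrier G.Ghat" "c h \<in> carrier G.Ghat"
      using ck[OF gh(1)] ck[OF gh(2)] subgroup.mem_carrier[OF ks] subgroup.mem_carrier[OF T.subC] by auto
    have "cj d = inv\<^bsub>G.Ghat\<^esub> (c h \<otimes>\<^bsub>G.Ghat\<^esub> k g) \<otimes>\<^bsub>G.Ghat\<^esub> (c h \<otimes>\<^bsub>G.Ghat\<^esub> k h)"
      unfolding d_def using cjm[of "inv\<^bsub>H\<^esub> g" h] cji ghc ck[OF gh(1)] ck[OF gh(2)] gh(4) by simp
    also have "\<dots> = inv\<^bsub>G.Ghat\<^esub> (k g) \<otimes>\<^bsub>G.Ghat\<^esub> k h"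
      using kc by (simp add: T.inv_mult_group T.m_assoc) (simp add: T.m_assoc[symmetric])
    also have "\<dots> \<in> G.hat_kernel N0" using ck[OF gh(1)] ck[OF gh(2)] ks by (simp add: subgroup.m_closed subgroup.m_inv_closed)
    finally have "x \<otimes>\<^bsub>G.Ghat\<^esub> cj d \<otimes>\<^bsub>G.Ghat\<^esub> inv\<^bsub>G.Ghat\<^esub> x \<in> G.hat_kernel N0" using normal.inv_op_closed2[OF kn xc] by blast
    moreover have "x \<otimes>\<^bsub>G.Ghat\<^esub> cj d \<otimes>\<^bsub>G.Ghat\<^esub> inv\<^bsub>G.Ghat\<^esub> x = \<sigma> d"
      unfolding cj_def using xc dc by (simp add: T.m_assoc) (simp add: T.m_assoc[symmetric])
    ultimately have "d \<in> M" using k1[OF dc] by simp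
    moreover have "d \<noteq> \<one>\<^bsub>H\<^esub>" unfolding d_def using ghc gh(3) by (metis H.inv_closed H.inv_equality H.inv_inv)
    then have "d \<in> E" unfolding E_def using J inf gh(1,2) d_def by auto
    ultimately show False using M(2) by blast
  qed
  \<comment> \<open>A vertex fixed by the generators at level N0 is fixed by all of H and, by
    density, by the whole completion.\<close>
  have big: "S <#> N0 = carrier G" if S: "subgroup S G" and x: "x \<in> T.fix_set (G.iota ` S) (G.hat_kernel N0) ((\<lambda>v. \<sigma> (s v)) ` I)" for S x
  proof -
    have xc: "x \<in> carrier G.Ghat" using x unfolding T.fix_set_def by blast
    define Y where "Y = G.iota ` S <#>\<^bsub>G.Ghat\<^esub> G.hat_kernel N0"
    interpret i: group_hom G G.Ghat G.iota by (intro group_hom.intro G G.hat_group group_hom_axioms.intro G.iota_hom)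
    interpret Y: subgroup Y G.Ghat unfolding Y_def by (rule T.setmult_subgroup[OF i.subgroup_img_is_subgroup[OF S] kn])
    define cj where "cj h = inv\<^bsub>G.Ghat\<^esub> x \<otimes>\<^bsub>G.Ghat\<^esub> \<sigma> h \<otimes>\<^bsub>G.Ghat\<^esub> x" for h
    have cjm: "cj (g \<otimes>\<^bsub>H\<^esub> h) = cj g \<otimes>\<^bsub>G.Ghat\<^esub> cj h" if "g \<in> carrier H" "h \<in> carrier H" for g h
      unfolding cj_def using that xc by (simp add: T.m_assoc) (simp add: T.m_assoc[symmetric])
    have cjc: "cj g \<in> carrier G.Ghat" if "g \<in> carrier H" for g unfolding cj_def using that xc by simp
    have cj1: "cj \<one>\<^bsub>H\<^esub> = \<one>\<^bsub>G.Ghat\<^esub>" unfolding cj_def using xc by simp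
    have inY: "cj g \<in> Y" if "g \<in> generate H (s ` I)" for g
      using that
    proof (induction rule: generate.induct)
      case one
      then show ?case using cj1 by simp
    next
      case (incl h)
      then show ?case using x unfolding T.fix_set_def Y_def cj_def by auto
    next
      case (inv h)
      then obtain v where v: "v \<in> I" "h = s v" by blast
      have "inv\<^bsub>H\<^esub> h = h" using invol[OF v(1)] sc[OF v(1)] v(2) H.inv_equality by blast
      then show ?case using x inv unfolding T.fix_set_def Y_def cj_def by auto
    next
      case (eng g h)
      then have "g \<in> carrier H" "h \<in> carrier H" using I(3) by auto
      then show ?case using cjm eng.IH by simp
    qed
    have "w \<in> S <#> N0" if w: "w \<in> carrier G" for w
    proof -
      have iw: "G.iota w \<in> carrier G.Ghat" using w by simp
      \<comment> \<open>Density is applied to the conjugate u, so that conjugating back by x yields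
        the image of w.\<close>
      define u where "u = x \<otimes>\<^bsub>G.Ghat\<^esub> G.iota w \<otimes>\<^bsub>G.Ghat\<^esub> inv\<^bsub>G.Ghat\<^esub> x"
      have uc: "u \<in> carrier G.Ghat" unfolding u_def using xc iw by simp
      obtain h where h: "h \<in> carrier H" "\<sigma> h N0 = u N0" using dense[OF N0 G.hat_eval[OF uc N0]] by blast
      have "cj h N0 = (inv\<^bsub>G.Ghat\<^esub> x \<otimes>\<^bsub>G.Ghat\<^esub> u \<otimes>\<^bsub>G.Ghat\<^esub> x) N0"
        unfolding cj_def G.hat_mult[OF N0] h(2) ..
      also have "inv\<^bsub>G.Ghat\<^esub> x \<otimes>\<^bsub>G.Ghat\<^esub> u \<otimes>\<^bsub>G.Ghat\<^esub> x = G.iota w"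
        unfolding u_def using xc iw by (simp add: T.m_assoc) (simp add: T.m_assoc[symmetric])
      finally have e: "cj h N0 = N0 #> w" using G.iota_eval[OF N0] by simp
      have "cj h \<in> Y" using inY h(1) I(3) by blast
      then obtain a k where ak: "a \<in> S" "k \<in> G.hat_kernel N0" "cj h = G.iota a \<otimes>\<^bsub>G.Ghat\<^esub> k" unfolding Y_def set_mult_def by blast
      have ac: "a \<in> carrier G" using ak(1) subgroup.mem_carrier[OF S] by blast
      have "k N0 = N0" using ak(2) unfolding G.hat_kernel_def by blast
      then have "cj h N0 = N0 #> a"
        unfolding ak(3) G.hat_mult[OF N0] G.iota_eval[OF N0]
        using monoid.r_one[OF group.is_monoid[OF G.Mod_group[OF N0]], of "N0 #> a"] ac G.Mod_one G.rcosets_carrier by auto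
      then have "N0 #> w = N0 #> a" using e by simp
      then have "w \<in> N0 #> a" using G.rcoset_mem[OF normal_imp_subgroup[OF G.fin_normal_normal[OF N0]] w] by simp
      then have "w \<in> a <# N0" using normal.coset_eq[OF G.fin_normal_normal[OF N0]] ac by blast
      then show ?thesis using ak(1) unfolding l_coset_def set_mult_def by blast
    qed
    moreover have "S <#> N0 \<subseteq> carrier G"
      using subgroup.subset[OF S] subgroup.subset[OF normal_imp_subgroup[OF G.fin_normal_normal[OF N0]]] by (rule G.set_mult_closed)
    ultimately show ?thesis by blast
  qed
  have "T.fix_set (G.iota ` A) (G.hat_kernel N0) ((\<lambda>v. \<sigma> (s v)) ` I) \<noteq> {} \<or> T.fix_set (G.iota ` B) (G.hat_kernel N0) ((\<lambda>v. \<sigma> (s v)) ` I) \<noteq> {}"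
  proof (rule T.common_fixed_vertex[where adj = adj])
    show "finite I" by fact
    show "G.hat_kernel N0 \<in> G.hat_kernel ` fin_normal G" using N0 by blast
    show c: "\<sigma> (s v) \<in> carrier G.Ghat" if "v \<in> I" for v using sc[OF that] by simp
    have vv: "\<sigma> (s v) \<otimes>\<^bsub>G.Ghat\<^esub> \<sigma> (s v) = \<one>\<^bsub>G.Ghat\<^esub>" if "v \<in> I" for v
      using \<sigma>.hom_mult[OF sc[OF that] sc[OF that]] invol[OF that] by simp
    show "T.fix_tree {\<sigma> (s v)}" if "v \<in> I" for v
      by (rule T.fix_tree_finite_order[of _ 2]) (use c[OF that] vv[OF that] in \<open>auto simp: numeral_2_eq_2\<close>)
    show "T.fix_nonempty {\<sigma> (s v), \<sigma> (s w)}" if vw: "v \<in> I" "w \<in> I" "adj v w" for v w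
    proof -
      obtain m where m: "m > 0" "(s v \<otimes>\<^bsub>H\<^esub> s w) [^]\<^bsub>H\<^esub> (m::nat) = \<one>\<^bsub>H\<^esub>" using adj[OF vw] by blast
      have "(\<sigma> (s v) \<otimes>\<^bsub>G.Ghat\<^esub> \<sigma> (s w)) [^]\<^bsub>G.Ghat\<^esub> m = \<sigma> ((s v \<otimes>\<^bsub>H\<^esub> s w) [^]\<^bsub>H\<^esub> m)"
        using sc vw by (simp add: \<sigma>.hom_nat_pow)
      then have "T.fix_tree {\<sigma> (s v), \<sigma> (s w)}"
        using T.fix_tree_dihedral[OF c[OF vw(1)] vv[OF vw(1)] c[OF vw(2)] vv[OF vw(2)] m(1)] m(2) by simp
      then show ?thesis unfolding T.fix_tree_def by blast
    qed
    fix x Z J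
    assume x: "x \<in> carrier G.Ghat" and J: "J = {v \<in> I. x \<in> T.fix_set (G.iota ` C) (G.hat_kernel N0) {\<sigma> (s v)}}"
      and Z: "Z \<subseteq> I - J" "Z \<noteq> {}" "\<And>v w. v \<in> Z \<Longrightarrow> w \<in> I - J \<Longrightarrow> adj v w \<Longrightarrow> w \<in> Z"
    have JI: "J \<subseteq> I" unfolding J by blast
    have "x \<in> T.fix_set (G.iota ` C) (G.hat_kernel N0) (\<sigma> ` s ` J)" unfolding J using x by (auto simp: T.fix_set_def)
    then have "connected_in adj (I - J)" using conn[OF JI small[OF JI]] by blast
    then show "Z = I - J" using Z unfolding connected_in_def by blast
  qed
  then have "A <#> N0 = carrier G \<or> B <#> N0 = carrier G" using big[OF sub(1)] big[OF sub(2)] by blast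
  moreover have "A <#> N0 \<subseteq> A <#> NA" "B <#> N0 \<subseteq> B <#> NB" using mono_set_mult[of _ _ N0 _ G] unfolding N0_def by blast+
  moreover have "A <#> NA \<subseteq> carrier G" "B <#> NB \<subseteq> carrier G"
    using sub NA NB G.fin_normal_normal normal_imp_subgroup subgroup.subset G.set_mult_closed by metis+
  ultimately show False using NA NB by blast
qed

section \<open>Coxeter groups and the reflection representation\<close>

declare in_lists_conv_set [simp]

lemma word_eq_context: "word_eq R x y \<Longrightarrow> word_eq R (u @ x @ w) (u @ y @ w)"
proof (induction rule: word_eq.induct)
  case (rel r a b)
  show ?case using word_eq.rel[OF rel, of "u @ a" "b @ w"] by simp
qed (auto intro: word_eq.intros)

lemma word_eq_append: "word_eq R x x' \<Longrightarrow> word_eq R y y' \<Longrightarrow> word_eq R (x @ y) (x' @ y')"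
  using word_eq_context[of R x x' "[]" y] word_eq_context[of R y y' x' "[]"] word_eq.trans by fastforce

lemma word_eq_foldr:
  assumes "word_eq R x y" "\<And>r. r \<in> R \<Longrightarrow> foldr f r = id"
  shows "foldr f x = foldr f y"
  using assms(1) by (induction rule: word_eq.induct) (auto simp: assms(2) foldr_append)

locale coxeter =
  fixes V :: "'v set" and E :: "'v set set" and m :: "'v set \<Rightarrow> nat"
  assumes graph: "coxeter_graph V E m"
begin

abbreviation R where "R \<equiv> coxeter_relators V E m"
abbreviation W where "W \<equiv> coxeter_group V E m"
abbreviation weq (infix "\<doteq>" 50) where "x \<doteq> y \<equiv> word_eq R x y"

definition cls :: "'v list \<Rightarrow> 'v list set" where "cls x = word_class V R x"

lemma finV: "finite V"
  using graph unfolding coxeter_graph_def by blast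

lemma edgeD: "{s, t} \<in> E \<Longrightarrow> s \<in> V \<and> t \<in> V \<and> s \<noteq> t"
  using graph unfolding coxeter_graph_def by (metis doubleton_eq_iff)

lemma edge_label: "e \<in> E \<Longrightarrow> 2 \<le> m e"
  using graph unfolding coxeter_graph_def by blast

lemma relE:
  assumes "r \<in> R"
  obtains (sq) v where "v \<in> V" "r = [v, v]"
    | (br) v w where "{v, w} \<in> E" "v \<noteq> w" "v \<in> V" "w \<in> V" "r = concat (replicate (m {v, w}) [v, w])"
  using assms edgeD unfolding coxeter_relators_def by blast

lemma alternating_lists: "v \<in> J \<Longrightarrow> w \<in> J \<Longrightarrow> concat (replicate k [v, w]) \<in> lists J"
  by (induction k) auto

lemma rel_lists: "r \<in> R \<Longrightarrow> r \<in> lists V"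
  by (erule relE) (auto simp only: alternating_lists lists.intros)

lemma weq_lists: "x \<doteq> y \<Longrightarrow> x \<in> lists V \<longleftrightarrow> y \<in> lists V"
  by (induction rule: word_eq.induct) (use rel_lists in auto)

lemma weq_refl: "x \<doteq> x" by (rule word_eq.refl)
lemma weq_sym: "x \<doteq> y \<Longrightarrow> y \<doteq> x" by (rule word_eq.sym)
lemma weq_trans: "x \<doteq> y \<Longrightarrow> y \<doteq> z \<Longrightarrow> x \<doteq> z" by (rule word_eq.trans)

lemma weq_square: "v \<in> V \<Longrightarrow> u @ [v, v] @ w \<doteq> u @ w"
  by (rule word_eq.rel) (auto simp: coxeter_relators_def)

lemma weq_braid: "{v, w} \<in> E \<Longrightarrow> concat (replicate (m {v, w}) [v, w]) \<doteq> []"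
  using word_eq.rel[of "concat (replicate (m {v, w}) [v, w])" R "[]" "[]"] edgeD[of v w]
  unfolding coxeter_relators_def by auto

lemma weq_rev: "x \<in> lists V \<Longrightarrow> x @ rev x \<doteq> []"
proof (induction x)
  case (Cons v x)
  have "[v] @ (x @ rev x) @ [v] \<doteq> [v] @ [] @ [v]" using Cons by (intro word_eq_context) auto
  moreover have "[v] @ [] @ [v] \<doteq> []" using weq_square[of v "[]" "[]"] Cons.prems by simp
  ultimately show ?case by (auto intro: weq_trans)
qed (simp add: weq_refl)

lemma weq_rev': "x \<in> lists V \<Longrightarrow> rev x @ x \<doteq> []"
  using weq_rev[of "rev x"] by auto

lemma weq_cancel_right:
  assumes "y \<in> lists V" "x @ y \<doteq> z @ y" shows "x \<doteq> z"
proof -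
  have e: "u @ y @ rev y \<doteq> u" for u using word_eq_context[OF weq_rev[OF assms(1)], of u "[]"] by simp
  have "(x @ y) @ rev y \<doteq> (z @ y) @ rev y" by (rule word_eq_append[OF assms(2) weq_refl])
  then show ?thesis using e[of x] e[of z] weq_sym weq_trans by (metis append_assoc)
qed

lemma weq_inverse:
  assumes "y \<in> lists V" "x @ y \<doteq> []" shows "x \<doteq> rev y"
  by (rule weq_cancel_right[OF assms(1)], rule weq_trans[OF assms(2)], rule weq_sym, rule weq_rev'[OF assms(1)])

text \<open>All relators have even length. Consequently a letter always changes the length of an
  element, and every letter is either an ascent or a descent.\<close>

lemma weq_parity: "x \<doteq> y \<Longrightarrow> even (length x) \<longleftrightarrow> even (length y)"
proof (induction rule: word_eq.induct)
  case (rel r u w)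
  have "even (length (concat (replicate n [v, w])))" for n and v w :: 'v
    by (induction n) auto
  then have "even (length r)" using rel by (auto elim!: relE)
  then show ?case by auto
qed auto

lemma cls_self: "x \<in> lists V \<Longrightarrow> x \<in> cls x"
  unfolding cls_def word_class_def using weq_refl by auto

lemma cls_eq: "x \<in> lists V \<Longrightarrow> y \<in> lists V \<Longrightarrow> cls x = cls y \<longleftrightarrow> x \<doteq> y"
proof
  assume "x \<in> lists V" "y \<in> lists V" "cls x = cls y"
  then show "x \<doteq> y" using cls_self[of y] unfolding cls_def word_class_def by auto
next
  assume "x \<doteq> y"
  then show "cls x = cls y" unfolding cls_def word_class_def by (auto intro: weq_trans weq_sym)
qed

definition rep :: "'v list set \<Rightarrow> 'v list" where "rep g = (SOME x. x \<in> g)"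

lemma rep_cls: "x \<in> lists V \<Longrightarrow> rep (cls x) \<in> lists V \<and> x \<doteq> rep (cls x)"
  using someI[of "\<lambda>y. y \<in> cls x", OF cls_self] unfolding rep_def cls_def word_class_def by auto

lemma carrier_W: "carrier W = cls ` lists V"
  unfolding coxeter_group_def Let_def cls_def by simp

lemma one_W: "\<one>\<^bsub>W\<^esub> = cls []"
  unfolding coxeter_group_def Let_def cls_def by simp

lemma mult_W: "x \<in> lists V \<Longrightarrow> y \<in> lists V \<Longrightarrow> cls x \<otimes>\<^bsub>W\<^esub> cls y = cls (x @ y)"
proof -
  assume x: "x \<in> lists V" and y: "y \<in> lists V"
  have "cls x \<otimes>\<^bsub>W\<^esub> cls y = cls (rep (cls x) @ rep (cls y))"
    unfolding coxeter_group_def Let_def rep_def cls_def by simp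
  also have "\<dots> = cls (x @ y)"
    using rep_cls[OF x] rep_cls[OF y] x y word_eq_append[of R x "rep (cls x)" y "rep (cls y)"] 
    by (subst cls_eq) (auto intro: weq_sym)
  finally show ?thesis .
qed

lemma rep_carrier:
  assumes "g \<in> carrier W" shows "rep g \<in> lists V \<and> cls (rep g) = g"
proof -
  obtain x where x: "x \<in> lists V" "g = cls x" using assms unfolding carrier_W by auto
  then have "cls (rep g) = cls x" using rep_cls[OF x(1)] cls_eq weq_sym by metis
  then show ?thesis using rep_cls[OF x(1)] x(2) by simp
qed

lemma group_W: "group W"
proof (rule groupI)
  fix g h k assume "g \<in> carrier W" "h \<in> carrier W" "k \<in> carrier W"
  then obtain x y z where c: "x \<in> lists V" "y \<in> lists V" "z \<in> lists V" and e: "g = cls x" "h = cls y" "k = cls z" 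
    unfolding carrier_W by (elim imageE) (rule that)
  have l: "x @ y \<in> lists V" "y @ z \<in> lists V" using c by auto
  show "g \<otimes>\<^bsub>W\<^esub> h \<in> carrier W" unfolding e mult_W[OF c(1,2)] carrier_W using l by (intro imageI)
  show "g \<otimes>\<^bsub>W\<^esub> h \<otimes>\<^bsub>W\<^esub> k = g \<otimes>\<^bsub>W\<^esub> (h \<otimes>\<^bsub>W\<^esub> k)"
    unfolding e mult_W[OF c(1,2)] mult_W[OF c(2,3)] mult_W[OF l(1) c(3)] mult_W[OF c(1) l(2)] by simp
next
  show "\<one>\<^bsub>W\<^esub> \<in> carrier W" unfolding carrier_W one_W by auto
next
  fix g assume "g \<in> carrier W"
  then obtain x where x: "x \<in> lists V" "g = cls x" unfolding carrier_W by auto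
  show "\<one>\<^bsub>W\<^esub> \<otimes>\<^bsub>W\<^esub> g = g" using x by (simp add: one_W mult_W)
  show "\<exists>h\<in>carrier W. h \<otimes>\<^bsub>W\<^esub> g = \<one>\<^bsub>W\<^esub>"
    by (rule bexI[of _ "cls (rev x)"]) (use x weq_rev'[of x] in \<open>auto simp: one_W mult_W carrier_W cls_eq\<close>)
qed

sublocale W: group W by (rule group_W)

definition gn :: "'v \<Rightarrow> 'v list set" where "gn v = cls [v]"

lemma gn_carrier: "v \<in> V \<Longrightarrow> gn v \<in> carrier W"
  unfolding gn_def carrier_W by auto

lemma gn_invol: "v \<in> V \<Longrightarrow> gn v \<otimes>\<^bsub>W\<^esub> gn v = \<one>\<^bsub>W\<^esub>"
  unfolding gn_def one_W using weq_square[of v "[]" "[]"] by (simp add: mult_W cls_eq)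

lemma gn_pow: "{v, w} \<in> E \<Longrightarrow> (gn v \<otimes>\<^bsub>W\<^esub> gn w) [^]\<^bsub>W\<^esub> m {v, w} = \<one>\<^bsub>W\<^esub>"
proof -
  assume e: "{v, w} \<in> E"
  then have V: "v \<in> V" "w \<in> V" using edgeD by auto
  have l: "concat (replicate k [v, w]) \<in> lists V" for k by (rule alternating_lists[OF V])
  have "(gn v \<otimes>\<^bsub>W\<^esub> gn w) [^]\<^bsub>W\<^esub> k = cls (concat (replicate k [v, w]))" for k :: nat
  proof (induction k)
    case (Suc k)
    have r: "concat (replicate (Suc k) [v, w]) = concat (replicate k [v, w]) @ [v, w]"
      by (induction k) auto
    show ?case unfolding r using Suc V l by (simp add: gn_def mult_W)
  qed (simp add: one_W)
  then show ?thesis using weq_braid[OF e] l by (simp add: one_W cls_eq)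
qed

definition special :: "'v set \<Rightarrow> 'v list set set" where "special J = cls ` lists J"

lemma special_carrier: "J \<subseteq> V \<Longrightarrow> special J \<subseteq> carrier W"
  unfolding special_def carrier_W using lists_mono by blast

lemma special_V: "special V = carrier W"
  unfolding special_def carrier_W ..

lemma inv_W: "x \<in> lists V \<Longrightarrow> inv\<^bsub>W\<^esub> (cls x) = cls (rev x)"
  by (rule W.inv_equality) (use weq_rev'[of x] in \<open>auto simp: one_W mult_W carrier_W cls_eq\<close>)

lemma special_subgroup: "J \<subseteq> V \<Longrightarrow> subgroup (special J) W"
proof
  assume J: "J \<subseteq> V"
  then have l: "x \<in> lists V" if "x \<in> lists J" for x using that by auto
  show "special J \<subseteq> carrier W" by (rule special_carrier[OF J])
  show "\<one>\<^bsub>W\<^esub> \<in> special J" unfolding special_def one_W by auto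
  fix g assume "g \<in> special J"
  then obtain x where x: "x \<in> lists J" "g = cls x" unfolding special_def by auto
  show "inv\<^bsub>W\<^esub> g \<in> special J" using x l[OF x(1)] by (auto simp: inv_W special_def)
  fix h assume "h \<in> special J"
  then obtain y where y: "y \<in> lists J" "h = cls y" unfolding special_def by auto
  show "g \<otimes>\<^bsub>W\<^esub> h \<in> special J" unfolding x(2) y(2) mult_W[OF l[OF x(1)] l[OF y(1)]] special_def using x y by (intro imageI) (simp add: ball_Un)
qed

lemma special_generate: "J \<subseteq> V \<Longrightarrow> generate W (gn ` J) = special J"
proof
  assume J: "J \<subseteq> V"
  have gJ: "gn ` J \<subseteq> special J" unfolding special_def gn_def by auto
  show "generate W (gn ` J) \<subseteq> special J"
    by (rule W.generate_subgroup_incl[OF gJ special_subgroup[OF J]])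
  have "cls x \<in> generate W (gn ` J)" if "x \<in> lists J" for x
    using that
  proof (induction x)
    case Nil
    show ?case unfolding one_W[symmetric] by (rule generate.one)
  next
    case (Cons v x)
    have "cls (v # x) = gn v \<otimes>\<^bsub>W\<^esub> cls x" unfolding gn_def using Cons J by (subst mult_W) auto
    then show ?case using Cons by (auto intro: generate.eng generate.incl)
  qed
  then show "special J \<subseteq> generate W (gn ` J)" unfolding special_def by auto
qed

lemma special_mono: "J \<subseteq> K \<Longrightarrow> special J \<subseteq> special K"
  unfolding special_def using lists_mono by blast

text \<open>Twice the Gram matrix of the simple roots in the geometric representation. A missing
  edge stands for the label infinity, with cos 0 = 1.\<close>

definition cc :: "'v \<Rightarrow> 'v \<Rightarrow> real" where
  "cc s t = (if s = t then 2 else if {s, t} \<in> E then - 2 * cos (pi / real (m {s, t})) else - 2)"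

definition lin :: "'v \<Rightarrow> ('v \<Rightarrow> real) \<Rightarrow> real" where "lin s x = (\<Sum>t\<in>V. cc s t * x t)"

text \<open>The reflection x - 2 B(x, root s) root s, written in the basis of simple roots, where it
  changes the single coordinate s.\<close>

definition refl_act :: "'v \<Rightarrow> ('v \<Rightarrow> real) \<Rightarrow> 'v \<Rightarrow> real" where
  "refl_act s x = x(s := x s - lin s x)"

definition act :: "'v list \<Rightarrow> ('v \<Rightarrow> real) \<Rightarrow> 'v \<Rightarrow> real" where "act w = foldr refl_act w"

definition root :: "'v \<Rightarrow> 'v \<Rightarrow> real" where "root s = (\<lambda>t. if t = s then 1 else 0)"

lemma cc_sym: "cc s t = cc t s"
  unfolding cc_def by (auto simp: insert_commute)

lemma lin_upd: "v \<in> V \<Longrightarrow> lin s (x(v := x v - c)) = lin s x - cc s v * c"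
proof -
  assume v: "v \<in> V"
  have "lin s (x(v := x v - c)) = (\<Sum>t\<in>V. cc s t * x t - (if t = v then cc s v * c else 0))"
    unfolding lin_def by (intro sum.cong) (auto simp: algebra_simps)
  also have "\<dots> = lin s x - cc s v * c" unfolding lin_def sum_subtractf using v finV by simp
  finally show ?thesis .
qed

lemma refl_act_invol: "v \<in> V \<Longrightarrow> refl_act v (refl_act v x) = x"
  unfolding refl_act_def[of v x] unfolding refl_act_def using lin_upd[of v v x "lin v x"] by (simp add: cc_def)

lemma act_simps [simp]: "act [] = id" "act (v # w) = refl_act v \<circ> act w" "act (u @ w) = act u \<circ> act w"
  unfolding act_def by (auto simp: foldr_append)

lemma sum_roots_unity:
  assumes "2 \<le> (n::nat)" shows "(\<Sum>i<n. cis (pi / real n) ^ (2 * i)) = 0"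
proof -
  define w where "w = cis (pi / real n) ^ 2"
  have w: "w = cis (2 * pi / real n)" unfolding w_def power2_eq_square cis_mult by (simp add: field_simps)
  have "w ^ n = cis (real n * (2 * pi / real n))" unfolding w by (rule Complex.DeMoivre)
  then have "w ^ n = 1" using assms by simp
  moreover have "w \<noteq> 1"
  proof
    assume "w = 1"
    then have "cos (2 * pi / real n) = 1" unfolding w by (metis cis.simps(1) one_complex.simps(1))
    moreover have "cos (2 * pi / real n) < cos 0"
      by (rule cos_monotone_0_pi) (use assms in \<open>auto simp: field_simps\<close>)
    ultimately show False by simp
  qed
  ultimately have "(\<Sum>i<n. w ^ i) = 0" by (simp add: sum_gp_strict)
  then show ?thesis unfolding w_def by (simp add: power_mult)
qed

text \<open>For every x, also outside the plane of the two roots, the values of \<open>lin\<close>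
  met along the alternating product satisfy l (k + 2) = q l (k + 1) - l k with q = 2 cos \<theta>,
  so that l k is the real part of z \<omega>^k. The total change of each coordinate over n rounds is
  a sum of such values in steps of 2, and the powers of the root of unity \<omega>^2 add up to
  0.\<close>

lemma refl_act_braid:
  assumes e: "{s, t} \<in> E" shows "(refl_act s \<circ> refl_act t) ^^ m {s, t} = id"
proof
  fix x
  define n where "n = m {s, t}"
  have n: "2 \<le> n" unfolding n_def using edge_label[OF e] .
  have st: "s \<in> V" "t \<in> V" "s \<noteq> t" using edgeD[OF e] by auto
  define \<theta> where "\<theta> = pi / real n"
  define \<omega> where "\<omega> = cis \<theta>"
  define q where "q = 2 * cos \<theta>"
  have cst: "cc s t = - q" "cc t s = - q" "cc s s = 2" "cc t t = 2"
    using st e unfolding cc_def q_def \<theta>_def n_def by (auto simp: insert_commute)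
  have sin: "sin \<theta> > 0" unfolding \<theta>_def by (rule sin_gt_zero) (use n in \<open>auto simp: field_simps\<close>)
  \<comment> \<open>z is fitted to l 0 = \<open>lin t x\<close> and to l 1, the value of
    \<open>lin s\<close> after the reflection in t; this needs sin \<theta> \<noteq> 0.\<close>
  define z where "z = Complex (lin t x) ((lin t x * cos \<theta> - (lin s x + q * lin t x)) / sin \<theta>)"
  define l where "l k = Re (z * \<omega> ^ k)" for k :: nat
  have l0: "l 0 = lin t x" unfolding l_def z_def by simp
  have l1: "l 1 = lin s x + q * lin t x" unfolding l_def z_def \<omega>_def using sin by (simp add: field_simps)
  have rec: "l (Suc (Suc k)) = q * l (Suc k) - l k" for k
  proof -
    have "\<omega> * \<omega> = complex_of_real q * \<omega> - 1"
      unfolding \<omega>_def cis_mult q_def complex_eq_iff using cos_double_cos[of \<theta>] sin_double[of \<theta>] by (simp add: power2_eq_square algebra_simps)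
    then have "z * \<omega> ^ k * (\<omega> * \<omega>) = z * \<omega> ^ k * (complex_of_real q * \<omega> - 1)" by simp
    then have "z * \<omega> ^ Suc (Suc k) = complex_of_real q * (z * \<omega> ^ Suc k) - z * \<omega> ^ k"
      by (simp add: algebra_simps)
    then show ?thesis unfolding l_def by simp
  qed
  define T where "T = refl_act s \<circ> refl_act t"
  have key: "(T ^^ j) x = x(t := x t - (\<Sum>i<j. l (2 * i)), s := x s - (\<Sum>i<j. l (2 * i + 1)))
     \<and> lin t ((T ^^ j) x) = l (2 * j) \<and> lin s ((T ^^ j) x) = l (2 * j + 1) - q * l (2 * j)" for j
  proof (induction j)
    case 0
    then show ?case using l0 l1 by simp
  next
    case (Suc j)
    define y where "y = (T ^^ j) x"
    have y: "y = x(t := x t - (\<Sum>i<j. l (2 * i)), s := x s - (\<Sum>i<j. l (2 * i + 1)))" "lin t y = l (2 * j)"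
      "lin s y = l (2 * j + 1) - q * l (2 * j)" using Suc[folded y_def] by blast+
    define y' where "y' = refl_act t y"
    have y': "y' = y(t := y t - l (2 * j))" unfolding y'_def refl_act_def y(2) ..
    have ls: "lin s y' = l (2 * j + 1)" unfolding y' lin_upd[OF st(2)] y(3) cst by simp
    have lt: "lin t y' = - l (2 * j)" unfolding y' lin_upd[OF st(2)] y(2) cst by simp
    define y'' where "y'' = refl_act s y'"
    have y'': "y'' = y'(s := y' s - l (2 * j + 1))" unfolding y''_def refl_act_def ls ..
    have "lin t y'' = l (2 * Suc j)" unfolding y'' lin_upd[OF st(1)] lt cst using rec[of "2 * j"] by simp
    moreover have "lin s y'' = l (2 * Suc j + 1) - q * l (2 * Suc j)"
      unfolding y'' lin_upd[OF st(1)] ls cst using rec[of "2 * j + 1"] by simp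
    moreover have "y'' = x(t := x t - (\<Sum>i<Suc j. l (2 * i)), s := x s - (\<Sum>i<Suc j. l (2 * i + 1)))"
      unfolding y'' y' y(1) using st(3) by (auto simp: fun_eq_iff)
    moreover have Tx: "(T ^^ Suc j) x = y''" unfolding y''_def y'_def y_def T_def by simp
    ultimately show ?case unfolding Tx by blast
  qed
  have sum0: "(\<Sum>i<n. l (2 * i + d)) = 0" for d
  proof -
    have "(\<Sum>i<n. l (2 * i + d)) = Re (z * \<omega> ^ d * (\<Sum>i<n. \<omega> ^ (2 * i)))"
      unfolding l_def Re_sum[symmetric] sum_distrib_left by (simp add: power_add mult_ac)
    also have "\<dots> = 0" using sum_roots_unity[OF n] unfolding \<omega>_def \<theta>_def by simp
    finally show ?thesis .
  qed
  show "((refl_act s \<circ> refl_act t) ^^ m {s, t}) x = id x"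
    using key[of n] sum0[of 0] sum0[of 1] unfolding n_def T_def[symmetric] by simp
qed

lemma act_concat: "act (concat (replicate k [s, t])) = (refl_act s \<circ> refl_act t) ^^ k"
  by (induction k) (simp_all add: o_assoc)

lemma act_weq: "x \<doteq> y \<Longrightarrow> act x = act y"
  unfolding act_def
proof (erule word_eq_foldr)
  fix r assume "r \<in> R"
  then show "foldr refl_act r = id"
  proof (cases rule: relE)
    case (sq v)
    then show ?thesis using refl_act_invol by (auto simp: fun_eq_iff)
  next
    case (br v w)
    then show ?thesis using act_concat[of "m {v, w}" v w] refl_act_braid[of v w] unfolding act_def by simp
  qed
qed

lemma refl_act_linear: "refl_act v (\<lambda>t. a * x t + b * y t) = (\<lambda>t. a * refl_act v x t + b * refl_act v y t)"
proof -
  have "lin v (\<lambda>t. a * x t + b * y t) = a * lin v x + b * lin v y"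
    unfolding lin_def sum_distrib_left by (simp add: sum.distrib[symmetric] algebra_simps)
  then show ?thesis unfolding refl_act_def by (auto simp: fun_eq_iff algebra_simps)
qed

lemma act_linear: "act w (\<lambda>t. a * x t + b * y t) = (\<lambda>t. a * act w x t + b * act w y t)"
  by (induction w) (simp_all add: refl_act_linear)

lemma act_zero: "act w (\<lambda>t. 0) = (\<lambda>t. 0)"
  using act_linear[of w 0 "\<lambda>t. 0" 0 "\<lambda>t. 0"] by simp

lemma act_sum: "finite J \<Longrightarrow> act w (\<lambda>t. \<Sum>a\<in>J. p a * x a t) = (\<lambda>t. \<Sum>a\<in>J. p a * act w (x a) t)"
proof (induction J rule: finite_induct)
  case empty
  then show ?case using act_zero by simp
next
  case (insert a J)
  then show ?case using act_linear[of w "p a" "x a" 1 "\<lambda>t. \<Sum>a\<in>J. p a * x a t"] by simp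
qed

lemma act_support: "w \<in> lists J \<Longrightarrow> t \<notin> J \<Longrightarrow> act w x t = x t"
  by (induction w) (auto simp: refl_act_def)

lemma refl_act_root: "s \<in> V \<Longrightarrow> refl_act t (root s) = (\<lambda>u. root s u - cc t s * root t u)"
proof -
  assume s: "s \<in> V"
  have "lin t (root s) = (\<Sum>u\<in>V. if u = s then cc t s else 0)" unfolding lin_def root_def by (intro sum.cong) auto
  also have "\<dots> = cc t s" using s finV by simp
  finally show ?thesis unfolding refl_act_def root_def by (auto simp: fun_eq_iff)
qed

lemma refl_act_root_self: "s \<in> V \<Longrightarrow> refl_act s (root s) = (\<lambda>u. - root s u)"
  using refl_act_root[of s s] by (simp add: cc_def fun_eq_iff)

lemma root_expand:
  assumes "J \<subseteq> V" "\<And>t. t \<notin> J \<Longrightarrow> x t = 0"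
  shows "x = (\<lambda>t. \<Sum>a\<in>J. x a * root a t)"
proof
  fix t
  have fJ: "finite J" using assms(1) finV finite_subset by blast
  have "(\<Sum>a\<in>J. x a * root a t) = (\<Sum>a\<in>J. if a = t then x t else 0)" unfolding root_def by (intro sum.cong) auto
  also have "\<dots> = x t" using assms(2) fJ by simp
  finally show "x t = (\<Sum>a\<in>J. x a * root a t)" ..
qed

end

section \<open>Lengths and positive roots\<close>

context coxeter
begin

definition ell :: "'v list \<Rightarrow> nat" where "ell x = (LEAST n. \<exists>y. x \<doteq> y \<and> length y = n)"

lemma ell_reduced: "\<exists>y. x \<doteq> y \<and> length y = ell x"
  unfolding ell_def by (rule LeastI_ex) (use weq_refl in blast)

lemma ell_le: "x \<doteq> y \<Longrightarrow> ell x \<le> length y"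
  unfolding ell_def by (rule Least_le) blast

lemma ell_weq: "x \<doteq> y \<Longrightarrow> ell x = ell y"
  by (metis ell_reduced ell_le weq_sym weq_trans le_antisym)

lemma ell_append: "ell (x @ y) \<le> ell x + ell y"
proof -
  obtain x' y' where "x \<doteq> x'" "length x' = ell x" "y \<doteq> y'" "length y' = ell y" using ell_reduced by metis
  then show ?thesis using ell_le[OF word_eq_append[of R x x' y y']] by simp
qed

lemma ell_length: "ell x \<le> length x"
  by (rule ell_le) (rule weq_refl)

lemma ell_parity: "even (ell x) \<longleftrightarrow> even (length x)"
  using ell_reduced[of x] weq_parity by metis

lemma weq_snoc2: "s \<in> V \<Longrightarrow> (x @ [s]) @ [s] \<doteq> x"
  using weq_square[of s x "[]"] by simp

lemma ell_snoc: "s \<in> V \<Longrightarrow> ell (x @ [s]) = Suc (ell x) \<or> ell x = Suc (ell (x @ [s]))"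
proof -
  assume s: "s \<in> V"
  have "ell (x @ [s]) \<le> ell x + 1" using ell_append[of x "[s]"] ell_length[of "[s]"] by simp
  moreover have "ell x \<le> ell (x @ [s]) + 1"
    using ell_append[of "x @ [s]" "[s]"] ell_length[of "[s]"] ell_weq[OF weq_snoc2[OF s, of x]] by simp
  moreover have "ell (x @ [s]) \<noteq> ell x" using ell_parity[of x] ell_parity[of "x @ [s]"] by auto
  ultimately show ?thesis by linarith
qed

lemma ell_0: "ell x = 0 \<Longrightarrow> x \<doteq> []"
  using ell_reduced[of x] by auto

text \<open>The alternating word whose last letter is t. Letters are added in front, so the parity
  of k decides the first letter while the end stays fixed.\<close>

primrec alt :: "'v \<Rightarrow> 'v \<Rightarrow> nat \<Rightarrow> 'v list" where
  "alt s t 0 = []"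
| "alt s t (Suc k) = (if even k then t else s) # alt s t k"

lemma alt_length [simp]: "length (alt s t k) = k" by (induction k) auto

lemma alt_set: "set (alt s t k) \<subseteq> {s, t}" by (induction k) auto

lemma alt_last: "\<exists>u. alt s t (Suc k) = u @ [t]" 
  by (induction k) auto

lemma alt_suffix: "j \<le> k \<Longrightarrow> \<exists>u. set u \<subseteq> {s, t} \<and> length u = k - j \<and> alt s t k = u @ alt s t j"
proof (induction k)
  case (Suc k)
  show ?case
  proof (cases "j = Suc k")
    case False
    then obtain u where "set u \<subseteq> {s, t}" "length u = k - j" "alt s t k = u @ alt s t j" using Suc by auto
    then show ?thesis using Suc.prems False by (intro exI[of _ "(if even k then t else s) # u"]) auto
  qed (auto intro: exI[of _ "[]"])
qed auto

lemma concat_shift: "a # concat (replicate k [b, a]) @ [b] = concat (replicate (Suc k) [a, b])"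
  by (induction k) auto

lemma alt_rev: "alt s t k @ rev (alt t s k) = (if even k then concat (replicate k [s, t]) else concat (replicate k [t, s]))"
proof (induction k)
  case (Suc k)
  have "alt s t (Suc k) @ rev (alt t s (Suc k)) = (if even k then t else s) # (alt s t k @ rev (alt t s k)) @ [if even k then s else t]"
    by simp
  then show ?case unfolding Suc using concat_shift[of t k s] concat_shift[of s k t] by (simp only: even_Suc if_split) auto
qed simp

text \<open>The relator is cut in the middle and its second half is moved to the other side.\<close>

lemma alt_braid:
  assumes "{s, t} \<in> E" shows "alt s t (m {s, t}) \<doteq> alt t s (m {s, t})"
proof -
  have V: "s \<in> V" "t \<in> V" using edgeD[OF assms] by auto
  have l: "alt t s k \<in> lists V" for k using alt_set[of t s k] V by auto
  have e: "{t, s} \<in> E" "m {t, s} = m {s, t}" using assms by (auto simp: insert_commute)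
  have "alt s t (m {s, t}) @ rev (alt t s (m {s, t})) \<doteq> []"
    unfolding alt_rev using weq_braid[OF assms] weq_braid[OF e(1)] e(2) by auto
  then have "alt s t (m {s, t}) \<doteq> rev (rev (alt t s (m {s, t})))" by (intro weq_inverse) (use l in auto)
  then show ?thesis by simp
qed

lemma alt_eqI:
  assumes "set z \<subseteq> {s, t}" "s \<noteq> t" "\<And>u a w. z \<noteq> u @ [a, a] @ w" "\<And>u. z \<noteq> u @ [s]"
  shows "z = alt s t (length z)"
  using assms
proof (induction z)
  case (Cons a z)
  have IH: "z = alt s t (length z)"
  proof (rule Cons.IH)
    show "z \<noteq> u @ [b, b] @ w" for u b w using Cons.prems(3)[of "a # u" b w] by auto
    show "z \<noteq> u @ [s]" for u using Cons.prems(4)[of "a # u"] by auto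
  qed (use Cons.prems in auto)
  show ?case
  proof (cases "length z")
    case 0
    then show ?thesis using Cons.prems(1) Cons.prems(4)[of "[]"] by auto
  next
    case (Suc k)
    then have z: "z = (if even k then t else s) # alt s t k" using IH by simp
    have "a \<noteq> (if even k then t else s)" using Cons.prems(3)[of "[]" a "alt s t k"] z by auto
    then have "a = (if even (Suc k) then t else s)" using Cons.prems(1) by auto
    then show ?thesis using Suc IH by simp
  qed
qed simp

definition qq :: "'v \<Rightarrow> 'v \<Rightarrow> real" where "qq s t = - cc s t"

text \<open>A pair of consecutive Chebyshev values.\<close>

primrec cheb :: "real \<Rightarrow> nat \<Rightarrow> real \<times> real" where
  "cheb q 0 = (1, 0)"
| "cheb q (Suc k) = (q * fst (cheb q k) - snd (cheb q k), fst (cheb q k))"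

lemma act_alt_root:
  assumes "s \<in> V" "t \<in> V" "s \<noteq> t"
  shows "act (alt s t k) (root s) = (\<lambda>u. fst (cheb (qq s t) k) * root (if even k then s else t) u + snd (cheb (qq s t) k) * root (if even k then t else s) u)"
proof (induction k)
  case 0
  then show ?case by simp
next
  case (Suc k)
  define a where "a = (if even k then s else t)"
  define b where "b = (if even k then t else s)"
  have ab: "a \<in> V" "b \<in> V" "cc b a = - qq s t" using assms cc_sym[of s t] unfolding a_def b_def qq_def by auto
  have "act (alt s t (Suc k)) (root s) = refl_act b (act (alt s t k) (root s))" unfolding b_def by simp
  also have "\<dots> = (\<lambda>u. fst (cheb (qq s t) k) * refl_act b (root a) u + snd (cheb (qq s t) k) * refl_act b (root b) u)"
    unfolding Suc a_def[symmetric] b_def[symmetric] refl_act_linear ..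
  also have "\<dots> = (\<lambda>u. fst (cheb (qq s t) (Suc k)) * root b u + snd (cheb (qq s t) (Suc k)) * root a u)"
    unfolding refl_act_root[OF ab(1)] refl_act_root_self[OF ab(2)] ab(3) by (simp add: fun_eq_iff algebra_simps)
  finally show ?case unfolding a_def b_def by (simp only: even_Suc if_not_P) (simp split: if_splits)
qed

lemma cheb_sin:
  assumes "sin \<theta> \<noteq> 0"
  shows "fst (cheb (2 * cos \<theta>) k) = sin (real (Suc k) * \<theta>) / sin \<theta> \<and> snd (cheb (2 * cos \<theta>) k) = sin (real k * \<theta>) / sin \<theta>"
proof (induction k)
  case (Suc k)
  have "sin (real (Suc (Suc k)) * \<theta>) = 2 * cos \<theta> * sin (real (Suc k) * \<theta>) - sin (real k * \<theta>)"
  proof -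
    have "real (Suc (Suc k)) * \<theta> = real (Suc k) * \<theta> + \<theta>" "real k * \<theta> = real (Suc k) * \<theta> - \<theta>"
      by (simp_all add: algebra_simps)
    then show ?thesis by (simp only: sin_add sin_diff) simp
  qed
  then show ?case using Suc by (simp add: diff_divide_distrib)
qed (use assms in simp)

text \<open>The coefficients are sin ((k + 1) \<theta>) / sin \<theta> and sin (k \<theta>) / sin
  \<theta> with \<theta> = \<pi> / m; the bound k < m keeps both angles within [0, \<pi>]. Without
  an edge they are k + 1 and k.\<close>

lemma cheb_pos:
  assumes "s \<in> V" "t \<in> V" "s \<noteq> t" "{s, t} \<in> E \<Longrightarrow> k < m {s, t}"
  shows "0 \<le> fst (cheb (qq s t) k) \<and> 0 \<le> snd (cheb (qq s t) k)"
proof (cases "{s, t} \<in> E")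
  case True
  define n where "n = m {s, t}"
  define \<theta> where "\<theta> = pi / real n"
  have n: "2 \<le> n" "k < n" unfolding n_def using edge_label[OF True] assms(4)[OF True] by auto
  have q: "qq s t = 2 * cos \<theta>" unfolding qq_def cc_def \<theta>_def n_def using True assms by simp
  have sin: "sin \<theta> > 0" unfolding \<theta>_def by (rule sin_gt_zero) (use n in \<open>auto simp: field_simps\<close>)
  have "sin (real j * \<theta>) \<ge> 0" if "j \<le> n" for j
  proof (rule sin_ge_zero)
    show "real j * \<theta> \<le> pi" unfolding \<theta>_def using that n by (simp add: field_simps mult_left_mono)
    show "0 \<le> real j * \<theta>" unfolding \<theta>_def by simp
  qed
  then show ?thesis using cheb_sin[of \<theta> k] sin n unfolding q by (simp del: of_nat_Suc)
next
  case False
  then have q: "qq s t = 2" unfolding qq_def cc_def using assms by simp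
  have "fst (cheb 2 k) = real (Suc k) \<and> snd (cheb 2 k) = real k" by (induction k) auto
  then show ?thesis unfolding q by simp
qed

text \<open>The theorem of Tits. Let t end a reduced word of x, and write x = v z with z in the
  letters s and t, with lengths adding up and v as short as possible. Then s and t lengthen v, so by
  induction v sends both roots to nonnegative vectors. The word z is alternating, does not end in s
  and is shorter than a side of the braid relation, so it sends the root of s to a nonnegative
  combination of the two roots.\<close>

theorem tits_positive:
  assumes "x \<in> lists V" "s \<in> V" "ell (x @ [s]) > ell x"
  shows "act x (root s) u \<ge> 0"
  using assms
proof (induction "ell x" arbitrary: x s u rule: less_induct)
  case less
  note x = less.prems(1) and s = less.prems(2) and up = less.prems(3)
  show ?case
  proof (cases "ell x = 0")
    case True
    then have "act x = id" using act_weq[OF ell_0] by simp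
    then show ?thesis by (simp add: root_def)
  next
    case False
    obtain y where y: "x \<doteq> y" "length y = ell x" using ell_reduced by blast
    have yl: "y \<in> lists V" using weq_lists[OF y(1)] x by blast
    obtain y' t where y': "y = y' @ [t]" using y(2) False by (cases y rule: rev_cases) auto
    have t: "t \<in> V" and y'l: "y' \<in> lists V" using yl y' by auto
    have st: "s \<noteq> t"
    proof
      assume "s = t"
      then have "x @ [s] \<doteq> (y' @ [t]) @ [t]" using word_eq_append[OF y(1) weq_refl, of "[s]"] y' by simp
      then have "x @ [s] \<doteq> y'" using weq_snoc2[OF t] weq_trans by blast
      then have "ell (x @ [s]) \<le> length y'" by (rule ell_le)
      then show False using up y(2) y' by simp
    qed
    define P where "P n \<longleftrightarrow> (\<exists>v z. v \<in> lists V \<and> set z \<subseteq> {s, t} \<and> x \<doteq> v @ z \<and> ell v + length z = ell x \<and> ell v = n)" for n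
    have "ell y' + 1 = ell x"
      using ell_length[of y'] y(2) y' ell_weq[OF y(1)] ell_append[of y' "[t]"] ell_length[of "[t]"] by simp
    then have P0: "P (ell y')" unfolding P_def using y'l y(1) y' by (intro exI[of _ y'] exI[of _ "[t]"]) auto
    define n where "n = (LEAST n. P n)"
    have "P n" unfolding n_def using P0 by (rule LeastI)
    then obtain v z where v: "v \<in> lists V" "set z \<subseteq> {s, t}" "x \<doteq> v @ z" "ell v + length z = ell x" "ell v = n" unfolding P_def by blast
    have nx: "n < ell x" using Least_le[of P, OF P0] \<open>ell y' + 1 = ell x\<close> unfolding n_def by simp
    have upv: "ell (v @ [a]) > ell v" if a: "a \<in> {s, t}" for a
    proof (rule ccontr)
      have aV: "a \<in> V" using a s t by auto
      assume "\<not> ?thesis"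
      then have d: "ell v = Suc (ell (v @ [a]))" using ell_snoc[OF aV, of v] by auto
      have "(v @ [a]) @ (a # z) \<doteq> v @ z" using weq_square[OF aV, of v z] by simp
      then have "x \<doteq> (v @ [a]) @ (a # z)" using v(3) weq_sym weq_trans by blast
      then have "P (ell (v @ [a]))" unfolding P_def using v d a aV
        by (intro exI[of _ "v @ [a]"] exI[of _ "a # z"]) auto
      then have "n \<le> ell (v @ [a])" unfolding n_def by (rule Least_le)
      then show False using d v(5) by simp
    qed
    have pos: "act v (root s) u \<ge> 0" "act v (root t) u \<ge> 0" for u
      using less.hyps[OF _ v(1) s upv[of s]] less.hyps[OF _ v(1) t upv[of t]] nx v(5) by auto
    have shorter: "ell x \<le> ell v + length z'" if "x \<doteq> v @ z'" for z'
      using ell_weq[OF that] ell_append[of v z'] ell_length[of z'] by linarith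
    have shorter': "ell x < ell v + length z'" if "x @ [s] \<doteq> v @ z'" for z'
      using ell_weq[OF that] ell_append[of v z'] ell_length[of z'] up by linarith
    \<comment> \<open>An expression of x that is no longer than v @ z and ends in s would make x @
      [s] too short.\<close>
    have nos: "\<not> x \<doteq> v @ z' @ [s]" if "length z' < length z" for z'
    proof
      assume "x \<doteq> v @ z' @ [s]"
      then have "x @ [s] \<doteq> ((v @ z') @ [s]) @ [s]" using word_eq_append[OF _ weq_refl, of x "v @ z' @ [s]" "[s]"] by simp
      then have "x @ [s] \<doteq> v @ z'" using weq_snoc2[OF s, of "v @ z'"] weq_trans by blast
      then show False using shorter'[of z'] that v(4) by simp
    qed
    have za: "z = alt s t (length z)"
    proof (rule alt_eqI[OF v(2) st])
      fix u a w
      show "z \<noteq> u @ [a, a] @ w"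
      proof
        assume z: "z = u @ [a, a] @ w"
        then have aV: "a \<in> V" using v(2) s t by auto
        have "v @ z \<doteq> v @ (u @ w)" using weq_square[OF aV, of "v @ u" w] z by simp
        then have "x \<doteq> v @ (u @ w)" using v(3) weq_trans by blast
        then show False using shorter[of "u @ w"] v(4) z by simp
      qed
      show "z \<noteq> u @ [s]" using nos[of u] v(3) by auto
    qed
    define k where "k = length z"
    \<comment> \<open>An alternating word of length at least m contains a full side of the braid
      relation, and exchanging the sides yields an expression that ends in s.\<close>
    have k: "k < m {s, t}" if e: "{s, t} \<in> E"
    proof (rule ccontr)
      assume "\<not> k < m {s, t}"
      then obtain w where w: "length w = k - m {s, t}" "alt s t k = w @ alt s t (m {s, t})" using alt_suffix[of "m {s, t}" k s t] by auto
      obtain j where j: "m {s, t} = Suc j" using edge_label[OF e] by (cases "m {s, t}") auto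
      obtain w' where w': "alt t s (Suc j) = w' @ [s]" using alt_last by blast
      then have lw': "length w' = j" using alt_length[of t s "Suc j"] by simp
      have "v @ z \<doteq> v @ w @ w' @ [s]"
        using word_eq_context[OF alt_braid[OF e], of "v @ w" "[]"] w(2) za w' unfolding k_def[symmetric] j by simp
      then have "x \<doteq> v @ (w @ w') @ [s]" using v(3) weq_trans by fastforce
      moreover have "length (w @ w') < length z" using w(1) lw' j \<open>\<not> k < m {s, t}\<close> unfolding k_def by simp
      ultimately show False using nos by blast
    qed
    note cp = cheb_pos[OF s t st k]
    have "act x (root s) = act v (act (alt s t k) (root s))"
      unfolding act_weq[OF v(3)] k_def using za by (metis act_simps(3) o_apply)
    also have "\<dots> = (\<lambda>u. fst (cheb (qq s t) k) * act v (root (if even k then s else t)) u + snd (cheb (qq s t) k) * act v (root (if even k then t else s)) u)"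
      unfolding act_alt_root[OF s t st] act_linear ..
    finally show ?thesis using cp pos by simp
  qed
qed

lemma tits_negative:
  assumes "x \<in> lists V" "s \<in> V" "ell (x @ [s]) < ell x"
  shows "act x (root s) u \<le> 0"
proof -
  have "ell ((x @ [s]) @ [s]) > ell (x @ [s])" using assms(3) ell_weq[OF weq_snoc2[OF assms(2), of x]] by simp
  then have "act (x @ [s]) (root s) u \<ge> 0" using tits_positive[of "x @ [s]" s] assms by simp
  moreover have "act (x @ [s]) (root s) = (\<lambda>u. - act x (root s) u)"
    using act_linear[of x "-1" "root s" 0 "root s"] refl_act_root_self[OF assms(2)] by simp
  ultimately show ?thesis by simp
qed

lemma act_inj: "x \<in> lists V \<Longrightarrow> act (rev x) (act x y) = y"
  using act_weq[OF weq_rev'[of x]] by (metis act_simps(1,3) comp_apply id_apply)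

lemma root_nonzero: "x \<in> lists V \<Longrightarrow> \<exists>u. act x (root s) u \<noteq> 0"
proof (rule ccontr)
  assume x: "x \<in> lists V" and "\<not> (\<exists>u. act x (root s) u \<noteq> 0)"
  then have "act x (root s) = (\<lambda>u. 0)" by auto
  then have "root s = (\<lambda>u. 0)" using act_inj[OF x, of "root s"] act_zero by simp
  then show False unfolding root_def by (metis zero_neq_one)
qed

text \<open>A nontrivial x is shortened by some t and so sends the root of t to a nonpositive
  vector, whereas this root has coordinate 1.\<close>

theorem tits_faithful:
  assumes x: "x \<in> lists V" and id: "\<And>s. s \<in> V \<Longrightarrow> act x (root s) = root s"
  shows "x \<doteq> []"
proof (rule ccontr)
  assume "\<not> ?thesis"
  then have "ell x \<noteq> 0" using ell_0 by blast
  obtain y where y: "x \<doteq> y" "length y = ell x" using ell_reduced by blast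
  have yl: "y \<in> lists V" using weq_lists[OF y(1)] x by blast
  obtain y' t where y': "y = y' @ [t]" using y(2) \<open>ell x \<noteq> 0\<close> by (cases y rule: rev_cases) auto
  have t: "t \<in> V" using yl y' by auto
  have "x @ [t] \<doteq> (y' @ [t]) @ [t]" using word_eq_append[OF y(1) weq_refl, of "[t]"] y' by simp
  then have "x @ [t] \<doteq> y'" using weq_snoc2[OF t] weq_trans by blast
  then have "ell (x @ [t]) \<le> length y'" by (rule ell_le)
  then have "ell (x @ [t]) < ell x" using y(2) y' by simp
  then have "act x (root t) t \<le> 0" by (rule tits_negative[OF x t])
  then have "root t t \<le> 0" unfolding id[OF t] .
  then show False unfolding root_def by simp
qed

section \<open>Lengths in cosets of special subgroups\<close>

lemma ell_up_iff:
  assumes "x \<in> lists V" "s \<in> V"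
  shows "ell (x @ [s]) > ell x \<longleftrightarrow> (\<forall>u. act x (root s) u \<ge> 0)"
    and "ell (x @ [s]) < ell x \<longleftrightarrow> (\<forall>u. act x (root s) u \<le> 0)"
proof -
  obtain u where u: "act x (root s) u \<noteq> 0" using root_nonzero[OF assms(1)] by blast
  have up: "(\<forall>u. act x (root s) u \<ge> 0)" if "ell (x @ [s]) > ell x" using tits_positive[OF assms that] by blast
  have dn: "(\<forall>u. act x (root s) u \<le> 0)" if "ell (x @ [s]) < ell x" using tits_negative[OF assms that] by blast
  show "ell (x @ [s]) > ell x \<longleftrightarrow> (\<forall>u. act x (root s) u \<ge> 0)"
    and "ell (x @ [s]) < ell x \<longleftrightarrow> (\<forall>u. act x (root s) u \<le> 0)"
    using up dn u ell_snoc[OF assms(2), of x] by (smt (verit) lessI)+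
qed

lemma root_combination:
  assumes J: "J \<subseteq> V" and y: "y \<in> lists J" and c: "c \<in> J"
  shows "act (w @ y) (root c) = (\<lambda>u. \<Sum>a\<in>J. act y (root c) a * act w (root a) u)"
proof -
  have "act y (root c) = (\<lambda>t. \<Sum>a\<in>J. act y (root c) a * root a t)"
    by (rule root_expand[OF J]) (use act_support[OF y] c in \<open>auto simp: root_def\<close>)
  then have "act w (act y (root c)) = act w (\<lambda>t. \<Sum>a\<in>J. act y (root c) a * root a t)" by simp
  also have "\<dots> = (\<lambda>u. \<Sum>a\<in>J. act y (root c) a * act w (root a) u)"
    by (rule act_sum) (use J finV finite_subset in blast)
  finally show ?thesis by simp
qed

text \<open>w sends the simple roots of J to nonnegative vectors, so the image of a root under w y
  has the sign of its image under y: a letter lengthens w y exactly when it lengthens y.\<close>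

lemma parabolic_up:
  assumes J: "J \<subseteq> V" and w: "w \<in> lists V" and up: "\<And>a. a \<in> J \<Longrightarrow> ell (w @ [a]) > ell w" and y: "y \<in> lists J"
  shows "ell (w @ y) = ell w + ell y"
  using y
proof (induction y rule: rev_induct)
  case Nil
  then show ?case using ell_length[of "[]"] by simp
next
  case (snoc c y)
  have c: "c \<in> J" "c \<in> V" and yJ: "y \<in> lists J" and yV: "y \<in> lists V" "w @ y \<in> lists V" using snoc.prems J w by auto
  have IH: "ell (w @ y) = ell w + ell y" using snoc.IH yJ by blast
  note rc = root_combination[OF J yJ c(1), of w]
  have wp: "act w (root a) u \<ge> 0" if "a \<in> J" for a u using tits_positive[OF w _ up[OF that]] that J by auto
  show ?case
  proof (cases "ell (y @ [c]) > ell y")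
    case True
    then have "act y (root c) u \<ge> 0" for u by (rule tits_positive[OF yV(1) c(2)])
    then have "\<forall>u. act (w @ y) (root c) u \<ge> 0" unfolding rc using wp by (auto intro!: sum_nonneg)
    then have "ell ((w @ y) @ [c]) > ell (w @ y)" using ell_up_iff(1)[OF yV(2) c(2)] by blast
    then show ?thesis using IH True ell_snoc[OF c(2), of y] ell_snoc[OF c(2), of "w @ y"] by simp
  next
    case False
    then have lt: "ell (y @ [c]) < ell y" using ell_snoc[OF c(2), of y] by auto
    then have "act y (root c) u \<le> 0" for u by (rule tits_negative[OF yV(1) c(2)])
    then have "\<forall>u. act (w @ y) (root c) u \<le> 0" unfolding rc using wp by (auto intro!: sum_nonpos mult_nonpos_nonneg)
    then have "ell ((w @ y) @ [c]) < ell (w @ y)" using ell_up_iff(2)[OF yV(2) c(2)] by blast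
    then show ?thesis using IH lt ell_snoc[OF c(2), of y] ell_snoc[OF c(2), of "w @ y"] by simp
  qed
qed

text \<open>The mirror image for the longest element of a coset: w reverses the signs of the roots
  of J, so a letter that lengthens y shortens w y. In particular no y is longer than w.\<close>

lemma parabolic_down:
  assumes J: "J \<subseteq> V" and w: "w \<in> lists V" and dn: "\<And>a. a \<in> J \<Longrightarrow> ell (w @ [a]) < ell w" and y: "y \<in> lists J"
  shows "ell (w @ y) + ell y = ell w"
  using y
proof (induction y rule: rev_induct)
  case Nil
  then show ?case using ell_length[of "[]"] by simp
next
  case (snoc c y)
  have c: "c \<in> J" "c \<in> V" and yJ: "y \<in> lists J" and yV: "y \<in> lists V" "w @ y \<in> lists V" using snoc.prems J w by auto
  have IH: "ell (w @ y) + ell y = ell w" using snoc.IH yJ by blast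
  note rc = root_combination[OF J yJ c(1), of w]
  have wp: "act w (root a) u \<le> 0" if "a \<in> J" for a u using tits_negative[OF w _ dn[OF that]] that J by auto
  show ?case
  proof (cases "ell (y @ [c]) > ell y")
    case True
    then have "act y (root c) u \<ge> 0" for u by (rule tits_positive[OF yV(1) c(2)])
    then have "\<forall>u. act (w @ y) (root c) u \<le> 0" unfolding rc using wp by (auto intro!: sum_nonpos mult_nonneg_nonpos)
    then have "ell ((w @ y) @ [c]) < ell (w @ y)" using ell_up_iff(2)[OF yV(2) c(2)] by blast
    then show ?thesis using IH True ell_snoc[OF c(2), of y] ell_snoc[OF c(2), of "w @ y"] by simp
  next
    case False
    then have lt: "ell (y @ [c]) < ell y" using ell_snoc[OF c(2), of y] by auto
    then have "act y (root c) u \<le> 0" for u by (rule tits_negative[OF yV(1) c(2)])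
    then have "\<forall>u. act (w @ y) (root c) u \<ge> 0" unfolding rc using wp by (auto intro!: sum_nonneg mult_nonpos_nonpos)
    then have "ell ((w @ y) @ [c]) > ell (w @ y)" using ell_up_iff(1)[OF yV(2) c(2)] by blast
    then show ?thesis using IH lt ell_snoc[OF c(2), of y] ell_snoc[OF c(2), of "w @ y"] by simp
  qed
qed

lemma finite_ball: "finite {g \<in> carrier W. ell (rep g) \<le> n}"
proof (rule finite_subset)
  show "finite (cls ` {x. set x \<subseteq> V \<and> length x \<le> n})" using finite_lists_length_le[OF finV] by blast
  show "{g \<in> carrier W. ell (rep g) \<le> n} \<subseteq> cls ` {x. set x \<subseteq> V \<and> length x \<le> n}"
  proof
    fix g assume "g \<in> {g \<in> carrier W. ell (rep g) \<le> n}"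
    then have g: "rep g \<in> lists V" "cls (rep g) = g" "ell (rep g) \<le> n" using rep_carrier by auto
    obtain y where y: "rep g \<doteq> y" "length y = ell (rep g)" using ell_reduced by blast
    have yl: "y \<in> lists V" using weq_lists[OF y(1)] g(1) by blast
    then have "g = cls y" using cls_eq[OF g(1) yl] y(1) g(2) by simp
    then show "g \<in> cls ` {x. set x \<subseteq> V \<and> length x \<le> n}" using yl y(2) g(3) by auto
  qed
qed

lemma ell_rep: "x \<in> lists V \<Longrightarrow> ell (rep (cls x)) = ell x"
  using rep_cls ell_weq by metis

text \<open>By \<open>parabolic_down\<close> no element of this special subgroup is longer than w,
  so the subgroup lies in a finite ball.\<close>

lemma finite_descents:
  assumes w: "w \<in> lists V" shows "finite (special {a \<in> V. ell (w @ [a]) < ell w})"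
proof (rule finite_subset[OF _ finite_ball[of "ell w"]])
  define J where "J = {a \<in> V. ell (w @ [a]) < ell w}"
  have J: "J \<subseteq> V" unfolding J_def by blast
  show "special J \<subseteq> {g \<in> carrier W. ell (rep g) \<le> ell w}"
  proof
    fix g assume "g \<in> special J"
    then obtain y where y: "y \<in> lists J" "g = cls y" unfolding special_def by blast
    then have yV: "y \<in> lists V" using J by auto
    have "ell (w @ y) + ell y = ell w" by (rule parabolic_down[OF J w _ y(1)]) (simp add: J_def)
    then show "g \<in> {g \<in> carrier W. ell (rep g) \<le> ell w}" using y(2) yV ell_rep[OF yV] unfolding carrier_W by auto
  qed
qed

end

section \<open>Coxeter groups with at most one end\<close>

text \<open>A rational linear functional \<phi> with \<phi> r = 1 is read off from a basis
  containing r. If D is a common denominator of the \<phi> (e k), divisibility of r by n makes D a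
  multiple of n, and n = D + 1 is too large for that. This supplies the moduli of the congruence
  subgroups.\<close>

lemma not_infinitely_divisible:
  fixes e :: "nat \<Rightarrow> real" and r :: real
  assumes "r \<noteq> 0"
  shows "\<exists>n>0. \<not> (\<exists>a :: nat \<Rightarrow> int. r = real n * (\<Sum>k<K. of_int (a k) * e k))"
proof -
  interpret Q: vector_space "\<lambda>(q::rat) (x::real). of_rat q * x"
    by unfold_locales (auto simp: algebra_simps of_rat_add of_rat_mult)
  have ind: "Q.independent {r}" using assms by (simp add: Q.dependent_single)
  define B where "B = Q.extend_basis {r}"
  have B: "Q.independent B" "Q.span B = UNIV" "r \<in> B"
    unfolding B_def using Q.independent_extend_basis[OF ind] Q.span_extend_basis[OF ind] Q.extend_basis_superset[OF ind] by auto
  define \<phi> where "\<phi> x = Q.representation B x r" for x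
  have \<phi>1: "\<phi> r = 1" unfolding \<phi>_def using Q.representation_basis[OF B(1,3)] by simp
  have \<phi>s: "\<phi> (of_rat q * x) = q * \<phi> x" for q x
    unfolding \<phi>_def using Q.representation_scale[OF B(1), of x q] B(2) by simp
  have \<phi>sum: "\<phi> (\<Sum>k<K. f k) = (\<Sum>k<K. \<phi> (f k))" for f :: "nat \<Rightarrow> real"
    unfolding \<phi>_def using Q.representation_sum[OF B(1), of "{..<K}" f] B(2) by simp
  have "\<exists>d::int. d > 0 \<and> of_int d * q \<in> \<int>" for q :: rat
  proof -
    obtain a b where ab: "quotient_of q = (a, b)" by fastforce
    then have "b > 0" "q = of_int a / of_int b" using quotient_of_denom_pos quotient_of_div by blast+
    then show ?thesis by (intro exI[of _ b]) auto
  qed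
  then obtain d where d: "\<And>q::rat. (d q :: int) > 0 \<and> of_int (d q) * q \<in> \<int>" by metis
  define D where "D = (\<Prod>k<K. d (\<phi> (e k)))"
  have D0: "D > 0" unfolding D_def using d by (intro prod_pos) auto
  have DZ: "of_int D * \<phi> (e k) \<in> \<int>" if "k < K" for k
  proof -
    have "D = (\<Prod>j\<in>{..<K} - {k}. d (\<phi> (e j))) * d (\<phi> (e k))" unfolding D_def using that 
      by (subst prod.remove[of _ k]) (auto simp: mult.commute)
    then have "of_int D * \<phi> (e k) = of_int (\<Prod>j\<in>{..<K} - {k}. d (\<phi> (e j))) * (of_int (d (\<phi> (e k))) * \<phi> (e k))" by simp
    also have "\<dots> \<in> \<int>" by (rule Ints_mult[OF Ints_of_int]) (use d[of "\<phi> (e k)"] in blast)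
    finally show ?thesis .
  qed
  define n where "n = nat (D + 1)"
  have n: "n > 0" "int n = D + 1" unfolding n_def using D0 by auto
  have "\<not> (\<exists>a :: nat \<Rightarrow> int. r = real n * (\<Sum>k<K. of_int (a k) * e k))"
  proof
    assume "\<exists>a :: nat \<Rightarrow> int. r = real n * (\<Sum>k<K. of_int (a k) * e k)"
    then obtain a :: "nat \<Rightarrow> int" where "r = real n * (\<Sum>k<K. of_int (a k) * e k)" by blast
    then have "r = of_rat (of_nat n) * (\<Sum>k<K. of_rat (of_int (a k)) * e k)" by simp
    then have "1 = of_nat n * (\<Sum>k<K. of_int (a k) * \<phi> (e k))" using \<phi>1 by (simp only: \<phi>s \<phi>sum)
    then have "of_int D = of_nat n * (\<Sum>k<K. of_int (a k) * (of_int D * \<phi> (e k)))"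
      by (simp add: sum_distrib_left sum_distrib_right algebra_simps) (simp add: sum_distrib_left[symmetric] algebra_simps)
    moreover have Z: "(\<Sum>k<K. of_int (a k) * (of_int D * \<phi> (e k))) \<in> \<int>" by (rule Ints_sum, rule Ints_mult[OF Ints_of_int], rule DZ) simp
    obtain z where "(\<Sum>k<K. of_int (a k) * (of_int D * \<phi> (e k))) = of_int z" using Z by (rule Ints_cases)
    ultimately have "of_int D = (of_nat n :: rat) * of_int z" by simp
    then have "(of_int D :: rat) = of_int (int n * z)" by simp
    then have "D = int n * z" using of_int_eq_iff by blast
    then have "int n dvd D" by simp
    then show False using zdvd_imp_le[of "int n" D] D0 n(2) by simp
  qed
  then show ?thesis using n(1) by blast
qed

context coxeter
begin

abbreviation adj where "adj v w \<equiv> {v, w} \<in> E"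

lemma weq_cls: "x \<doteq> y \<Longrightarrow> cls x = cls y"
  unfolding cls_def word_class_def by (auto intro: weq_trans weq_sym)

lemma rev_alt_even: "rev (alt w v (2 * k)) = concat (replicate k [v, w])"
proof (induction k)
  case (Suc k)
  have "concat (replicate (Suc k) [v, w]) = concat (replicate k [v, w]) @ [v, w]" by (induction k) auto
  then show ?case using Suc by simp
qed simp

text \<open>The polygon of the finite dihedral coset of x is traversed on the side that avoids x.\<close>

lemma link_around:
  assumes x: "x \<in> lists V" and e: "{v, w} \<in> E" and up: "ell (x @ [v]) > ell x" "ell (x @ [w]) > ell x"
    and d: "\<And>x y. x \<doteq> y \<Longrightarrow> d x = d y"
    and step: "\<And>y u. y \<in> lists V \<Longrightarrow> u \<in> V \<Longrightarrow> ell y > ell x \<Longrightarrow> ell (y @ [u]) > ell x \<Longrightarrow> d y = (d (y @ [u]) :: bool)"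
  shows "d (x @ [v]) = d (x @ [w])"
proof -
  have V: "v \<in> V" "w \<in> V" using edgeD[OF e] by auto
  define p where "p k = rev (alt w v k)" for k
  have pS: "p (Suc k) = p k @ [if even k then v else w]" for k unfolding p_def by simp
  have pl: "p k \<in> lists {v, w}" "p k \<in> lists V" "length (p k) = k" for k 
    unfolding p_def using alt_set[of w v k] V by auto
  have "0 < 2 * m {v, w} \<and> p (2 * m {v, w}) \<doteq> []"
    using edge_label[OF e] weq_braid[OF e] unfolding p_def rev_alt_even by simp
  \<comment> \<open>The least positive k is taken to ensure that the proper nonempty prefixes are
    nontrivial; the relation of length 2 m alone does not say so.\<close>
  then obtain k where k: "0 < k" "p k \<doteq> []" and least: "\<And>j. j < k \<Longrightarrow> \<not> (0 < j \<and> p j \<doteq> [])"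
    using exists_least_iff[of "\<lambda>k. 0 < k \<and> p k \<doteq> []"] by blast
  have "even k" using weq_parity[OF k(2)] pl(3) by simp
  \<comment> \<open>As k is even, the last of its letters is w; the walk that starts with v
    therefore arrives at w after j = k - 1 steps.\<close>
  then obtain j where j: "k = Suc j" "odd j" using k(1) by (cases k) auto
  have "p j @ [w] \<doteq> []" using k(2) j unfolding j(1) pS by simp
  then have pj: "p j \<doteq> [w]" using weq_inverse[of "[w]" "p j"] V by simp
  have big: "ell (x @ p i) > ell x" if "0 < i" "i \<le> j" for i
  proof -
    have "\<not> p i \<doteq> []" using least[of i] that j by auto
    then have "ell (p i) \<noteq> 0" using ell_0 by blast
    moreover have "ell (x @ p i) = ell x + ell (p i)"
      by (rule parabolic_up[of "{v, w}", OF _ x _ pl(1)]) (use V up in auto)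
    ultimately show ?thesis by simp
  qed
  have "d (x @ p (Suc i)) = d (x @ [v])" if "Suc i \<le> j" for i
    using that
  proof (induction i)
    case 0
    then show ?case unfolding pS by (simp add: p_def)
  next
    case (Suc i)
    have "d (x @ p (Suc i)) = d ((x @ p (Suc i)) @ [if even (Suc i) then v else w])"
      by (rule step) (use big[of "Suc i"] big[of "Suc (Suc i)"] Suc.prems x pl(2) V pS[of "Suc i"] in auto)
    then show ?case using Suc pS[of "Suc i"] by simp
  qed
  from this[of "j - 1"] have "d (x @ p j) = d (x @ [v])" using j(2) by (cases j) auto
  moreover have "d (x @ p j) = d (x @ [w])" by (rule d, rule word_eq_append[OF weq_refl pj])
  ultimately show ?thesis by simp
qed

text \<open>Induction on n: a function that is locally constant on the elements of length at least n
  + 1 is extended to length n by its value at any longer neighbour. These neighbours agree: the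
  ascents of z form the graph without its descents, which generate a finite group, so it is
  connected, and \<open>link_around\<close> passes along its edges. For n = 0 the whole Cayley graph
  is connected.\<close>

lemma ball_complement_connected:
  assumes nonsep: "\<And>J. J \<subseteq> V \<Longrightarrow> finite (special J) \<Longrightarrow> connected_in adj (V - J)"
    and d: "\<And>x y. x \<doteq> y \<Longrightarrow> d x = (d y :: bool)"
    and step: "\<And>x v. x \<in> lists V \<Longrightarrow> v \<in> V \<Longrightarrow> ell x \<ge> n \<Longrightarrow> ell (x @ [v]) \<ge> n \<Longrightarrow> d x = d (x @ [v])"
    and xy: "x \<in> lists V" "y \<in> lists V" "ell x \<ge> n" "ell y \<ge> n"
  shows "d x = d y"
  using d step xy
proof (induction n arbitrary: d x y)
  case 0
  have "d z = d []" if "z \<in> lists V" for z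
    using that
  proof (induction z rule: rev_induct)
    case (snoc v z)
    then show ?case using "0.prems"(2)[of z v] by simp
  qed simp
  then show ?case using "0.prems" by metis
next
  case (Suc n)
  note d = Suc.prems(1) and step = Suc.prems(2)
  have same: "d (z @ [v]) = d (z @ [w])"
    if z: "z \<in> lists V" "ell z = n" and v: "v \<in> V" "ell (z @ [v]) > ell z" and w: "w \<in> V" "ell (z @ [w]) > ell z" for z v w
  proof -
    define J where "J = {a \<in> V. ell (z @ [a]) < ell z}"
    have out: "a \<in> V - J \<longleftrightarrow> a \<in> V \<and> ell (z @ [a]) > ell z" for a unfolding J_def using ell_snoc[of a z] by auto
    have con: "connected_in adj (V - J)" by (rule nonsep) (use finite_descents[OF z(1)] in \<open>auto simp: J_def\<close>)
    define Z where "Z = {a \<in> V - J. d (z @ [a]) = d (z @ [v])}"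
    have vZ: "v \<in> Z" unfolding Z_def using v out by auto
    have cl: "b \<in> Z" if "a \<in> Z" "b \<in> V - J" "adj a b" for a b
    proof -
      have "d (z @ [a]) = d (z @ [b])"
      proof (rule link_around[OF z(1) that(3)])
        show "ell (z @ [a]) > ell z" using that(1) out[of a] unfolding Z_def by blast
        show "ell (z @ [b]) > ell z" using that(2) out[of b] by blast
        show "d y = d y'" if "y \<doteq> y'" for y y' using d[OF that] .
        show "d y = d (y @ [u])" if "y \<in> lists V" "u \<in> V" "ell y > ell z" "ell (y @ [u]) > ell z" for y u
          using step[OF that(1,2)] that(3,4) z(2) by simp
      qed
      then show ?thesis using that unfolding Z_def by simp
    qed
    have "Z = V - J"
    proof (rule con[unfolded connected_in_def, THEN spec, THEN mp, THEN mp, THEN mp])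
      show "Z \<subseteq> V - J" unfolding Z_def by blast
      show "Z \<noteq> {}" using vZ by blast
      show "\<forall>a\<in>Z. \<forall>b\<in>V - J. adj a b \<longrightarrow> b \<in> Z" by (intro ballI impI) (rule cl)
    qed
    moreover have "w \<in> V - J" using w out[of w] by simp
    ultimately have "w \<in> Z" by simp
    then show ?thesis unfolding Z_def by simp
  qed
  \<comment> \<open>At length n the default False is used only if there is no longer neighbour at
    all.\<close>
  define d' where "d' z = (if ell z = n then (\<exists>v\<in>V. ell (z @ [v]) > ell z \<and> d (z @ [v])) else d z)" for z
  have d'n: "d' z = d (z @ [v])" if z: "z \<in> lists V" "ell z = n" "v \<in> V" "ell (z @ [v]) > ell z" for z v
  proof -
    have "(\<exists>w\<in>V. ell (z @ [w]) > ell z \<and> d (z @ [w])) \<longleftrightarrow> d (z @ [v])"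
    proof
      assume "\<exists>w\<in>V. ell (z @ [w]) > ell z \<and> d (z @ [w])"
      then obtain w where "w \<in> V" "ell (z @ [w]) > ell z" "d (z @ [w])" by blast
      then show "d (z @ [v])" using same[OF z(1,2) _ _ z(3,4), of w] by simp
    next
      assume "d (z @ [v])"
      then show "\<exists>w\<in>V. ell (z @ [w]) > ell z \<and> d (z @ [w])" using z(3,4) by (intro bexI[of _ v] conjI)
    qed
    then show ?thesis unfolding d'_def using z(2) by simp
  qed
  have "d' x = d' y"
  proof (rule Suc.IH)
    fix x y assume xy: "x \<doteq> y"
    have e: "x @ [v] \<doteq> y @ [v]" for v by (rule word_eq_append[OF xy weq_refl])
    have "ell (x @ [v]) = ell (y @ [v])" "d (x @ [v]) = d (y @ [v])" for v by (rule ell_weq[OF e], rule d[OF e])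
    then show "d' x = d' y" unfolding d'_def using ell_weq[OF xy] d[OF xy] by simp
  next
    fix x v assume x: "x \<in> lists V" and v: "v \<in> V" and n: "n \<le> ell x" "n \<le> ell (x @ [v])"
    consider (a) "ell x = n" "ell (x @ [v]) = Suc n" | (b) "ell x = Suc n" "ell (x @ [v]) = n" | (c) "Suc n \<le> ell x" "Suc n \<le> ell (x @ [v])"
      using ell_snoc[OF v, of x] n by linarith
    then show "d' x = d' (x @ [v])"
    proof cases
      case a
      then have "d' x = d (x @ [v])" using d'n[OF x _ v] by simp
      then show ?thesis using a unfolding d'_def by simp
    next
      case b
      have e: "(x @ [v]) @ [v] \<doteq> x" by (rule weq_snoc2[OF v])
      have "d' (x @ [v]) = d ((x @ [v]) @ [v])" by (rule d'n) (use x v b ell_weq[OF e] in auto)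
      then show ?thesis using b d[OF e] unfolding d'_def by simp
    next
      case c
      then show ?thesis using step[OF x v] unfolding d'_def by auto
    qed
  qed (use Suc.prems in auto)
  then show ?case using Suc.prems unfolding d'_def by auto
qed

text \<open>For two disjoint infinite almost invariant sets, membership in the first is locally
  constant outside a large ball, hence constant there. One of the two sets then lies in a finite
  ball.\<close>

theorem one_ended:
  assumes nonsep: "\<And>J. J \<subseteq> V \<Longrightarrow> finite (special J) \<Longrightarrow> connected_in adj (V - J)"
  shows "\<not> W.many_ends 2"
proof
  assume "W.many_ends 2"
  then obtain D where D: "\<And>i. i < 2 \<Longrightarrow> infinite (D i) \<and> W.almost_inv (D i)"
    "\<And>i j. i < 2 \<Longrightarrow> j < (2::nat) \<Longrightarrow> i \<noteq> j \<Longrightarrow> D i \<inter> D j = {}" unfolding W.many_ends_def by blast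
  define F where "F = (\<Union>v\<in>V. {g \<in> D 0. g \<otimes>\<^bsub>W\<^esub> gn v \<notin> D 0})"
  have "finite F" unfolding F_def using D(1)[of 0] finV gn_carrier unfolding W.almost_inv_def by auto
  then obtain n where n: "\<And>g. g \<in> F \<Longrightarrow> ell (rep g) < n"
    using finite_nat_bounded[of "(\<lambda>g. ell (rep g)) ` F"] by auto
  define d where "d x = (cls x \<in> D 0)" for x
  have const: "d x = d y" if "x \<in> lists V" "y \<in> lists V" "ell x \<ge> n" "ell y \<ge> n" for x y
  proof (rule ball_complement_connected[OF nonsep _ _ that])
    show "d x = d y" if "x \<doteq> y" for x y unfolding d_def using weq_cls[OF that] by simp
    fix x v assume x: "x \<in> lists V" and v: "v \<in> V" and l: "n \<le> ell x" "n \<le> ell (x @ [v])"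
    have xv: "x @ [v] \<in> lists V" using x v by simp
    have m1: "cls x \<otimes>\<^bsub>W\<^esub> gn v = cls (x @ [v])" unfolding gn_def using x v by (subst mult_W) auto
    have "cls (x @ [v]) \<otimes>\<^bsub>W\<^esub> gn v = cls ((x @ [v]) @ [v])" unfolding gn_def using xv v by (subst mult_W) auto
    then have m2: "cls (x @ [v]) \<otimes>\<^bsub>W\<^esub> gn v = cls x" using weq_cls[OF weq_snoc2[OF v, of x]] by simp
    have "cls x \<notin> F" using n[of "cls x"] ell_rep[OF x] l(1) by auto
    moreover have "cls (x @ [v]) \<notin> F" using n[of "cls (x @ [v])"] ell_rep[OF xv] l(2) by auto
    ultimately show "d x = d (x @ [v])" unfolding d_def F_def using v m1 m2 by auto
  qed auto
  have ball: "D' \<subseteq> {g \<in> carrier W. ell (rep g) \<le> n}" if D': "D' \<subseteq> carrier W" "\<And>x. x \<in> lists V \<Longrightarrow> ell x \<ge> n \<Longrightarrow> cls x \<notin> D'" for D'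
  proof
    fix g assume g: "g \<in> D'"
    then have "rep g \<in> lists V" "cls (rep g) = g" using rep_carrier D'(1) by auto
    then show "g \<in> {g \<in> carrier W. ell (rep g) \<le> n}" using D'(2)[of "rep g"] g D'(1) by (cases "ell (rep g) \<ge> n") auto
  qed
  have Dc: "D 0 \<subseteq> carrier W" "D 1 \<subseteq> carrier W" using D(1)[of 0] D(1)[of 1] unfolding W.almost_inv_def by auto
  show False
  proof (cases "\<exists>x\<in>lists V. ell x \<ge> n \<and> d x")
    case True
    then have "d y" if "y \<in> lists V" "ell y \<ge> n" for y using const that by blast
    then have "D 1 \<subseteq> {g \<in> carrier W. ell (rep g) \<le> n}" using D(2)[of 0 1] unfolding d_def by (intro ball[OF Dc(2)]) auto
    then show False using D(1)[of 1] finite_ball[of n] finite_subset by auto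
  next
    case False
    then have "D 0 \<subseteq> {g \<in> carrier W. ell (rep g) \<le> n}" unfolding d_def by (intro ball[OF Dc(1)]) auto
    then show False using D(1)[of 0] finite_ball[of n] finite_subset by auto
  qed
qed

end

section \<open>Residual finiteness\<close>

context coxeter
begin

definition base :: nat where "base = (\<Prod>e\<in>E. m e)"

definition wave :: "nat \<Rightarrow> real" where "wave k = cos (real k * pi / real base)"

text \<open>As the base is a common multiple of the labels, multiplication by the Cartan coefficients preserves this group of
  real numbers; it need not be a ring.\<close>

definition lattice :: "real set" where
  "lattice = {x. \<exists>a :: nat \<Rightarrow> int. x = (\<Sum>k<2 * base. of_int (a k) * wave k)}"

lemma finE: "finite E"
proof -
  have "E \<subseteq> Pow V"
  proof
    fix e assume "e \<in> E"
    then have "\<exists>v w. v \<in> V \<and> w \<in> V \<and> v \<noteq> w \<and> e = {v, w}" using graph unfolding coxeter_graph_def by simp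
    then show "e \<in> Pow V" by auto
  qed
  then show ?thesis by (rule finite_subset) (simp add: finV)
qed

lemma base_pos: "base > 0"
  unfolding base_def
proof (rule prod_pos)
  fix e assume "e \<in> E"
  then show "0 < m e" using edge_label[of e] by simp
qed

lemma base_dvd: "e \<in> E \<Longrightarrow> m e dvd base"
  unfolding base_def using finE by (rule dvd_prodI)

lemma lattice_zero: "0 \<in> lattice"
  unfolding lattice_def by (rule CollectI, rule exI[of _ "\<lambda>_. 0"]) simp

lemma lattice_add: "x \<in> lattice \<Longrightarrow> y \<in> lattice \<Longrightarrow> x + y \<in> lattice"
proof -
  assume "x \<in> lattice" "y \<in> lattice"
  then obtain a b :: "nat \<Rightarrow> int" where "x = (\<Sum>k<2 * base. of_int (a k) * wave k)" "y = (\<Sum>k<2 * base. of_int (b k) * wave k)"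
    unfolding lattice_def by blast
  then have "x + y = (\<Sum>k<2 * base. of_int (a k + b k) * wave k)" by (simp add: sum.distrib algebra_simps)
  then show ?thesis unfolding lattice_def by (intro CollectI exI)
qed

lemma lattice_scale: "x \<in> lattice \<Longrightarrow> of_int z * x \<in> lattice"
proof -
  assume "x \<in> lattice"
  then obtain a :: "nat \<Rightarrow> int" where "x = (\<Sum>k<2 * base. of_int (a k) * wave k)" unfolding lattice_def by blast
  then have "of_int z * x = (\<Sum>k<2 * base. of_int (z * a k) * wave k)" by (simp add: sum_distrib_left algebra_simps)
  then show ?thesis unfolding lattice_def by (intro CollectI exI)
qed

lemma lattice_diff: "x \<in> lattice \<Longrightarrow> y \<in> lattice \<Longrightarrow> x - y \<in> lattice"
  using lattice_add[of x "of_int (-1) * y"] lattice_scale[of y "-1"] by simp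

lemma lattice_sum: "(\<And>i. i \<in> J \<Longrightarrow> f i \<in> lattice) \<Longrightarrow> (\<Sum>i\<in>J. f i) \<in> lattice"
  by (induction J rule: infinite_finite_induct) (auto intro: lattice_zero lattice_add)

text \<open>The function \<open>wave\<close> has period 2 * base, so the values below that bound
  give all of them.\<close>

lemma wave_lattice: "wave k \<in> lattice"
proof -
  have "wave k = wave (k mod (2 * base))"
  proof -
    have "k mod (2 * base) + 2 * base * (k div (2 * base)) = k" by simp
    from arg_cong[OF this, of real, symmetric]
    have "real k = real (k mod (2 * base)) + 2 * real base * real (k div (2 * base))"
      by (simp only: of_nat_add of_nat_mult of_nat_numeral)
    then have "real k * pi / real base = real (k mod (2 * base)) * pi / real base + 2 * pi * real (k div (2 * base))"
      using base_pos by (simp add: field_simps)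
    then show ?thesis unfolding wave_def
      using cos_int_2pin[of "int (k div (2 * base))"] sin_int_2pin[of "int (k div (2 * base))"] by (simp add: cos_add)
  qed
  also have "\<dots> = (\<Sum>j<2 * base. of_int (if j = k mod (2 * base) then 1 else 0) * wave j)"
  proof -
    have "(\<Sum>j<2 * base. of_int (if j = k mod (2 * base) then 1 else 0) * wave j) = (\<Sum>j<2 * base. if j = k mod (2 * base) then wave j else 0)"
      by (rule sum.cong) auto
    then show ?thesis using base_pos by simp
  qed
  finally show ?thesis unfolding lattice_def by (intro CollectI exI)
qed

text \<open>2 cos a cos b = cos (a + b) + cos (a - b); the factor 2 of this formula is the one built
  into \<open>cc\<close>.\<close>

lemma lattice_wave_mult: "x \<in> lattice \<Longrightarrow> 2 * wave j * x \<in> lattice"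
proof -
  assume "x \<in> lattice"
  then obtain a :: "nat \<Rightarrow> int" where x: "x = (\<Sum>k<2 * base. of_int (a k) * wave k)" unfolding lattice_def by blast
  have "2 * wave j * wave k \<in> lattice" for k
  proof -
    have "2 * wave j * wave k = wave (j + k) + wave (if j \<le> k then k - j else j - k)"
    proof -
      have c: "cos (real j * pi / real base - real k * pi / real base) = wave (if j \<le> k then k - j else j - k)"
      proof (cases "j \<le> k")
        case True
        then have "real (k - j) = real k - real j" by (rule of_nat_diff)
        then have e: "real (k - j) * pi / real base = - (real j * pi / real base - real k * pi / real base)"
          by (simp only: left_diff_distrib diff_divide_distrib minus_diff_eq)
        show ?thesis unfolding wave_def if_P[OF True] e cos_minus ..
      next
        case False
        then have "real (j - k) = real j - real k" by (intro of_nat_diff) simp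
        then have e: "real (j - k) * pi / real base = real j * pi / real base - real k * pi / real base"
          by (simp only: left_diff_distrib diff_divide_distrib)
        show ?thesis unfolding wave_def if_not_P[OF False] e ..
      qed
      have s: "cos (real j * pi / real base + real k * pi / real base) = wave (j + k)"
        unfolding wave_def by (simp add: distrib_right add_divide_distrib)
      show ?thesis unfolding c[symmetric] s[symmetric] cos_add cos_diff unfolding wave_def by simp
    qed
    then show ?thesis using lattice_add[OF wave_lattice wave_lattice] by simp
  qed
  then have "(\<Sum>k<2 * base. of_int (a k) * (2 * wave j * wave k)) \<in> lattice" by (intro lattice_sum lattice_scale)
  then show ?thesis unfolding x by (simp add: sum_distrib_left algebra_simps)
qed

lemma lattice_cc: "x \<in> lattice \<Longrightarrow> cc s t * x \<in> lattice"
proof (cases "s \<noteq> t \<and> {s, t} \<in> E")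
  case True
  assume x: "x \<in> lattice"
  obtain j where j: "base = m {s, t} * j" using base_dvd True by blast
  have "pi / real (m {s, t}) = real j * pi / real base" unfolding j using base_pos j by (simp add: field_simps)
  then have "cc s t = - (2 * wave j)" unfolding cc_def wave_def using True by simp
  then show ?thesis using lattice_scale[OF lattice_wave_mult[OF x, of j], of "-1"] by simp
next
  case False
  assume x: "x \<in> lattice"
  then show ?thesis using False lattice_scale[OF x, of 2] lattice_scale[OF x, of "-2"] unfolding cc_def by auto
qed

text \<open>Vanishing outside V makes these vectors combinations of simple roots.\<close>

definition lvec :: "('v \<Rightarrow> real) set" where
  "lvec = {x. (\<forall>t\<in>V. x t \<in> lattice) \<and> (\<forall>t. t \<notin> V \<longrightarrow> x t = 0)}"

lemma act_lvec: "w \<in> lists V \<Longrightarrow> x \<in> lvec \<Longrightarrow> act w x \<in> lvec"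
proof (induction w)
  case (Cons v w)
  then have y: "act w x \<in> lvec" and v: "v \<in> V" by auto
  have "lin v (act w x) \<in> lattice" unfolding lin_def using y unfolding lvec_def by (intro lattice_sum lattice_cc) auto
  then have "refl_act v (act w x) \<in> lvec" using y v unfolding lvec_def refl_act_def by (auto intro: lattice_diff)
  then show ?case by simp
qed simp

lemma root_lvec: "s \<in> V \<Longrightarrow> (\<lambda>t. wave k * root s t) \<in> lvec" "s \<in> V \<Longrightarrow> root s \<in> lvec"
proof -
  have "1 \<in> lattice" using wave_lattice[of 0] unfolding wave_def by simp
  then show "s \<in> V \<Longrightarrow> (\<lambda>t. wave k * root s t) \<in> lvec" "s \<in> V \<Longrightarrow> root s \<in> lvec"
    unfolding lvec_def root_def using wave_lattice lattice_zero by auto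
qed

section \<open>Congruence subgroups\<close>

definition congr :: "nat \<Rightarrow> ('v \<Rightarrow> real) \<Rightarrow> ('v \<Rightarrow> real) \<Rightarrow> bool" where
  "congr n x y \<longleftrightarrow> (\<exists>z\<in>lvec. x = (\<lambda>t. y t + real n * z t))"

lemma lvec_lin: "x \<in> lvec \<Longrightarrow> y \<in> lvec \<Longrightarrow> (\<lambda>t. of_int a * x t + of_int b * y t) \<in> lvec"
  unfolding lvec_def by (auto intro!: lattice_add lattice_scale)

lemma congr_refl: "congr n x x"
  unfolding congr_def by (rule bexI[of _ "\<lambda>_. 0"]) (auto simp: lvec_def lattice_zero)

lemma congr_sym: "congr n x y \<Longrightarrow> congr n y x"
proof -
  assume "congr n x y"
  then obtain z where z: "z \<in> lvec" "x = (\<lambda>t. y t + real n * z t)" unfolding congr_def by blast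
  then show ?thesis unfolding congr_def using lvec_lin[OF z(1,1), of "-1" 0] by (intro bexI[of _ "\<lambda>t. - z t"]) auto
qed

lemma congr_trans: "congr n x y \<Longrightarrow> congr n y w \<Longrightarrow> congr n x w"
proof -
  assume "congr n x y" "congr n y w"
  then obtain z z' where z: "z \<in> lvec" "x = (\<lambda>t. y t + real n * z t)" "z' \<in> lvec" "y = (\<lambda>t. w t + real n * z' t)" unfolding congr_def by blast
  then show ?thesis unfolding congr_def using lvec_lin[OF z(1,3), of 1 1]
    by (intro bexI[of _ "\<lambda>t. z t + z' t"]) (auto simp: algebra_simps)
qed

lemma act_congr: "w \<in> lists V \<Longrightarrow> congr n x y \<Longrightarrow> congr n (act w x) (act w y)"
proof -
  assume w: "w \<in> lists V" and "congr n x y"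
  then obtain z where z: "z \<in> lvec" "x = (\<lambda>t. y t + real n * z t)" unfolding congr_def by blast
  have "act w x = (\<lambda>t. act w y t + real n * act w z t)" unfolding z(2) using act_linear[of w 1 y "real n" z] by simp
  then show ?thesis unfolding congr_def using act_lvec[OF w z(1)] by blast
qed

definition cong_sub :: "nat \<Rightarrow> 'v list set set" where
  "cong_sub n = {g \<in> carrier W. \<forall>x\<in>lvec. congr n (act (rep g) x) x}"

lemma act_rep: "w \<in> lists V \<Longrightarrow> act (rep (cls w)) = act w"
  using rep_cls act_weq by metis

lemma cong_sub_cls: "w \<in> lists V \<Longrightarrow> cls w \<in> cong_sub n \<longleftrightarrow> (\<forall>x\<in>lvec. congr n (act w x) x)"
  unfolding cong_sub_def act_rep carrier_W by (auto simp: act_rep)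

lemma act_inj': "x \<in> lists V \<Longrightarrow> act x (act (rev x) y) = y"
  using act_inj[of "rev x" y] by simp

lemma cong_sub_subgroup: "subgroup (cong_sub n) W"
proof
  show "cong_sub n \<subseteq> carrier W" unfolding cong_sub_def by blast
  show "\<one>\<^bsub>W\<^esub> \<in> cong_sub n" unfolding one_W by (subst cong_sub_cls) (auto intro: congr_refl)
  fix g assume g: "g \<in> cong_sub n"
  then obtain x where x: "x \<in> lists V" "g = cls x" unfolding cong_sub_def carrier_W by auto
  have gx: "congr n (act x z) z" if "z \<in> lvec" for z using g that unfolding x(2) cong_sub_cls[OF x(1)] by blast
  have rx: "rev x \<in> lists V" using x(1) by simp
  have "congr n (act (rev x) z) z" if z: "z \<in> lvec" for z
    using act_congr[OF rx gx[OF z]] unfolding act_inj[OF x(1)] by (rule congr_sym)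
  then show "inv\<^bsub>W\<^esub> g \<in> cong_sub n" unfolding x(2) inv_W[OF x(1)] cong_sub_cls[OF rx] by blast
  fix h assume h: "h \<in> cong_sub n"
  then obtain y where y: "y \<in> lists V" "h = cls y" unfolding cong_sub_def carrier_W by auto
  have hy: "congr n (act y z) z" if "z \<in> lvec" for z using h that unfolding y(2) cong_sub_cls[OF y(1)] by blast
  have xy: "x @ y \<in> lists V" using x(1) y(1) by (simp add: ball_Un)
  have "congr n (act (x @ y) z) z" if "z \<in> lvec" for z
    using gx[OF act_lvec[OF y(1) that]] hy[OF that] congr_trans by simp
  then show "g \<otimes>\<^bsub>W\<^esub> h \<in> cong_sub n" unfolding x(2) y(2) mult_W[OF x(1) y(1)] cong_sub_cls[OF xy] by blast
qed

lemma cong_sub_normal: "cong_sub n \<lhd> W"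
proof (rule W.normal_invI[OF cong_sub_subgroup])
  fix g h assume g: "g \<in> carrier W" and h: "h \<in> cong_sub n"
  obtain x where x: "x \<in> lists V" "g = cls x" using g unfolding carrier_W by auto
  obtain y where y: "y \<in> lists V" "h = cls y" using h unfolding cong_sub_def carrier_W by auto
  have hy: "congr n (act y z) z" if "z \<in> lvec" for z using h that unfolding y(2) cong_sub_cls[OF y(1)] by blast
  have rx: "rev x \<in> lists V" using x(1) by simp
  have xy: "x @ y \<in> lists V" "(x @ y) @ rev x \<in> lists V" using x(1) y(1) by (simp_all add: ball_Un)
  have "congr n (act ((x @ y) @ rev x) z) z" if z: "z \<in> lvec" for z
    using act_congr[OF x(1) hy[OF act_lvec[OF rx z]]] unfolding act_inj'[OF x(1)] by simp
  then show "g \<otimes>\<^bsub>W\<^esub> h \<otimes>\<^bsub>W\<^esub> inv\<^bsub>W\<^esub> g \<in> cong_sub n"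
    unfolding x(2) y(2) inv_W[OF x(1)] mult_W[OF x(1) y(1)] mult_W[OF xy(1) rx] cong_sub_cls[OF xy(2)] by blast
qed

text \<open>f records the residues modulo n of integer coefficients of the images of finitely many
  generators of \<open>lvec\<close>. The cosines may be linearly dependent, so the coefficients
  \<kappa> are merely chosen; equal residues still force congruent vectors, which is the direction
  needed.\<close>

lemma cong_sub_fin_normal:
  assumes n: "n > 0" shows "cong_sub n \<in> fin_normal W"
proof -
  define \<kappa> where "\<kappa> x = (SOME a :: nat \<Rightarrow> int. x = (\<Sum>k<2 * base. of_int (a k) * wave k))" for x
  have \<kappa>: "x = (\<Sum>k<2 * base. of_int (\<kappa> x k) * wave k)" if "x \<in> lattice" for x
  proof -
    have "\<exists>a :: nat \<Rightarrow> int. x = (\<Sum>k<2 * base. of_int (a k) * wave k)" using that unfolding lattice_def by (rule CollectD)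
    from someI_ex[OF this] show ?thesis unfolding \<kappa>_def .
  qed
  define res where "res x = (\<lambda>k. if k < 2 * base then \<kappa> x k mod int n else 0)" for x
  have res: "\<exists>z\<in>lattice. x = y + real n * z" if x: "x \<in> lattice" and y: "y \<in> lattice" and e: "res x = res y" for x y
  proof -
    have "\<kappa> x k = \<kappa> y k + int n * ((\<kappa> x k - \<kappa> y k) div int n)" if "k < 2 * base" for k
    proof -
      have "\<kappa> x k mod int n = \<kappa> y k mod int n" using fun_cong[OF e, of k] that unfolding res_def by simp
      then have "int n dvd \<kappa> x k - \<kappa> y k" by (simp add: mod_eq_dvd_iff)
      then show ?thesis by simp
    qed
    then have "x = (\<Sum>k<2 * base. of_int (\<kappa> y k + int n * ((\<kappa> x k - \<kappa> y k) div int n)) * wave k)"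
      by (subst \<kappa>[OF x]) (intro sum.cong; simp)
    also have "\<dots> = (\<Sum>k<2 * base. of_int (\<kappa> y k) * wave k) + real n * (\<Sum>k<2 * base. of_int ((\<kappa> x k - \<kappa> y k) div int n) * wave k)"
      by (simp only: of_int_add of_int_mult of_int_of_nat_eq sum_distrib_left distrib_right sum.distrib mult.assoc)
    also have "(\<Sum>k<2 * base. of_int (\<kappa> y k) * wave k) = y" using \<kappa>[OF y] by simp
    finally have "x = y + real n * (\<Sum>k<2 * base. of_int ((\<kappa> x k - \<kappa> y k) div int n) * wave k)" .
    moreover have "(\<Sum>k<2 * base. of_int ((\<kappa> x k - \<kappa> y k) div int n) * wave k) \<in> lattice"
      unfolding lattice_def by (intro CollectI exI) (rule HOL.refl)
    ultimately show ?thesis by (rule bexI)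
  qed
  define bv where "bv p = (\<lambda>t. wave (fst p) * root (snd p) t)" for p :: "nat \<times> 'v"
  define P where "P = {..<2 * base} \<times> V"
  have finP: "finite P" unfolding P_def using finV by simp
  have bvl: "bv p \<in> lvec" if "p \<in> P" for p unfolding bv_def using root_lvec(1)[of "snd p" "fst p"] that unfolding P_def by auto
  define f where "f g = (\<lambda>q. if q \<in> P \<times> V then res (act (rep g) (bv (fst q)) (snd q)) else (\<lambda>_. 0))" for g
  show ?thesis
  proof (rule W.fin_normalI[OF cong_sub_normal, of f])
    define Q where "Q = {h. \<forall>k. (k \<in> {..<2 * base} \<longrightarrow> h k \<in> {0..<int n}) \<and> (k \<notin> {..<2 * base} \<longrightarrow> h k = (0::int))}"
    have "finite Q" unfolding Q_def by (rule finite_set_of_finite_funs) auto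
    then have "finite {F. \<forall>q. (q \<in> P \<times> V \<longrightarrow> F q \<in> Q) \<and> (q \<notin> P \<times> V \<longrightarrow> F q = (\<lambda>_. 0))}"
      using finP finV by (intro finite_set_of_finite_funs) auto
    moreover have "f ` carrier W \<subseteq> {F. \<forall>q. (q \<in> P \<times> V \<longrightarrow> F q \<in> Q) \<and> (q \<notin> P \<times> V \<longrightarrow> F q = (\<lambda>_. 0))}"
    proof (rule image_subsetI, rule CollectI, intro allI conjI impI)
      fix g q
      show "f g q \<in> Q" if "q \<in> P \<times> V" unfolding f_def if_P[OF that] Q_def res_def using n by simp
      show "f g q = (\<lambda>_. 0)" if "q \<notin> P \<times> V" unfolding f_def if_not_P[OF that] ..
    qed
    ultimately show "finite (f ` carrier W)" by (rule finite_subset[rotated])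
  next
    fix g h assume g: "g \<in> carrier W" and h: "h \<in> carrier W" and fe: "f g = f h"
    obtain x where x: "x \<in> lists V" "g = cls x" using g unfolding carrier_W by auto
    obtain y where y: "y \<in> lists V" "h = cls y" using h unfolding carrier_W by auto
    have "congr n (act x (bv p)) (act y (bv p))" if p: "p \<in> P" for p
    proof -
      have l: "act x (bv p) \<in> lvec" "act y (bv p) \<in> lvec" using act_lvec x(1) y(1) bvl[OF p] by auto
      have "\<exists>z\<in>lattice. act x (bv p) t = act y (bv p) t + real n * z" if t: "t \<in> V" for t
      proof (rule res)
        show "act x (bv p) t \<in> lattice" "act y (bv p) t \<in> lattice" using l t unfolding lvec_def by auto
        show "res (act x (bv p) t) = res (act y (bv p) t)"
          using fun_cong[OF fe, of "(p, t)"] p t unfolding f_def x(2) y(2) act_rep[OF x(1)] act_rep[OF y(1)] by simp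
      qed
      then obtain z where z: "\<And>t. t \<in> V \<Longrightarrow> z t \<in> lattice \<and> act x (bv p) t = act y (bv p) t + real n * z t" by metis
      have "act x (bv p) = (\<lambda>t. act y (bv p) t + real n * (if t \<in> V then z t else 0))"
        using z l unfolding lvec_def by (auto simp: fun_eq_iff)
      moreover have "(\<lambda>t. if t \<in> V then z t else 0) \<in> lvec" unfolding lvec_def using z by auto
      ultimately show ?thesis unfolding congr_def by (intro bexI[of _ "\<lambda>t. if t \<in> V then z t else 0"])
    qed
    then obtain z where z: "\<And>p. p \<in> P \<Longrightarrow> z p \<in> lvec \<and> act x (bv p) = (\<lambda>t. act y (bv p) t + real n * z p t)"
      unfolding congr_def by metis
    have same: "congr n (act x u) (act y u)" if u: "u \<in> lvec" for u
    proof -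
      define a where "a p = real_of_int (\<kappa> (u (snd p)) (fst p))" for p :: "nat \<times> 'v"
      have ue: "u = (\<lambda>t. \<Sum>p\<in>P. a p * bv p t)"
      proof
        fix t
        have "u t = (\<Sum>s\<in>V. u s * root s t)" using fun_cong[OF root_expand[of V u], of t] u unfolding lvec_def by auto
        also have "\<dots> = (\<Sum>s\<in>V. \<Sum>k<2 * base. of_int (\<kappa> (u s) k) * wave k * root s t)"
          using \<kappa> u unfolding lvec_def sum_distrib_right[symmetric] by (intro sum.cong) auto
        also have "\<dots> = (\<Sum>k<2 * base. \<Sum>s\<in>V. of_int (\<kappa> (u s) k) * wave k * root s t)" by (rule sum.swap)
        also have "\<dots> = (\<Sum>p\<in>P. a p * bv p t)" unfolding P_def a_def bv_def sum.cartesian_product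
          by (intro sum.cong) (auto simp: mult.assoc)
        finally show "u t = (\<Sum>p\<in>P. a p * bv p t)" .
      qed
      have ay: "act y u = (\<lambda>t. \<Sum>p\<in>P. a p * act y (bv p) t)" by (subst ue) (rule act_sum[OF finP])
      have "act x u = (\<lambda>t. \<Sum>p\<in>P. a p * act x (bv p) t)" by (subst ue) (rule act_sum[OF finP])
      also have "\<dots> = (\<lambda>t. (\<Sum>p\<in>P. a p * act y (bv p) t) + real n * (\<Sum>p\<in>P. a p * z p t))"
      proof
        fix t
        have "(\<Sum>p\<in>P. a p * act x (bv p) t) = (\<Sum>p\<in>P. a p * act y (bv p) t + real n * (a p * z p t))"
          using z by (intro sum.cong) (auto simp: algebra_simps)
        then show "(\<Sum>p\<in>P. a p * act x (bv p) t) = (\<Sum>p\<in>P. a p * act y (bv p) t) + real n * (\<Sum>p\<in>P. a p * z p t)"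
          by (simp add: sum.distrib sum_distrib_left)
      qed
      finally have "act x u = (\<lambda>t. act y u t + real n * (\<Sum>p\<in>P. a p * z p t))" unfolding ay .
      moreover have "(\<lambda>t. \<Sum>p\<in>P. a p * z p t) \<in> lvec"
        using z unfolding lvec_def a_def by (auto intro!: lattice_sum lattice_scale)
      ultimately show ?thesis unfolding congr_def by (intro bexI[of _ "\<lambda>t. \<Sum>p\<in>P. a p * z p t"])
    qed
    have ry: "rev y \<in> lists V" using y(1) by simp
    have xy: "x @ rev y \<in> lists V" using x(1) y(1) by (simp add: ball_Un)
    have "congr n (act (x @ rev y) u) u" if u: "u \<in> lvec" for u
      using same[OF act_lvec[OF ry u]] unfolding act_inj'[OF y(1)] by simp
    then show "g \<otimes>\<^bsub>W\<^esub> inv\<^bsub>W\<^esub> h \<in> cong_sub n"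
      unfolding x(2) y(2) inv_W[OF y(1)] mult_W[OF x(1) ry] cong_sub_cls[OF xy] by blast
  qed
qed

lemma lattice_separated: "r \<noteq> 0 \<Longrightarrow> \<exists>n>0. \<not> (\<exists>z\<in>lattice. r = real n * z)"
  using not_infinitely_divisible[where e = wave and K = "2 * base" and r = r] unfolding lattice_def by blast

text \<open>By faithfulness some coordinate of the difference between a root and its image is
  nonzero; a modulus that does not divide it in the lattice keeps g out of the congruence
  subgroup.\<close>

theorem residually_finite_W: "W.residually_finite"
  unfolding W.residually_finite_def
proof (intro ballI impI)
  fix g assume g: "g \<in> carrier W" "g \<noteq> \<one>\<^bsub>W\<^esub>"
  obtain x where x: "x \<in> lists V" "g = cls x" using g unfolding carrier_W by auto
  have "\<not> x \<doteq> []" using g(2) x weq_cls unfolding one_W by blast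
  then obtain s where s: "s \<in> V" "act x (root s) \<noteq> root s" using tits_faithful[OF x(1)] by blast
  then obtain t where t: "act x (root s) t - root s t \<noteq> 0" by (auto simp: fun_eq_iff)
  have tV: "t \<in> V" using act_support[OF x(1), of t "root s"] t by auto
  obtain n where n: "n > 0" "\<not> (\<exists>z\<in>lattice. act x (root s) t - root s t = real n * z)" using lattice_separated[OF t] by blast
  have "g \<notin> cong_sub n"
  proof
    assume "g \<in> cong_sub n"
    then have "congr n (act x (root s)) (root s)" unfolding x(2) cong_sub_cls[OF x(1)] using root_lvec(2)[OF s(1)] by blast
    then obtain z where "z \<in> lvec" "act x (root s) = (\<lambda>t. root s t + real n * z t)" unfolding congr_def by blast
    then have "act x (root s) t - root s t = real n * z t" "z t \<in> lattice" using tV unfolding lvec_def by auto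
    then show False using n(2) by blast
  qed
  then show "\<exists>N\<in>fin_normal W. g \<notin> N" using cong_sub_fin_normal[OF n(1)] by blast
qed

text \<open>Compare the coordinate t of the images of the root of t: the generator t makes it -1,
  letters of J leave it alone, and the congruence subgroup preserves it modulo n. The modulus is
  chosen so that 2 is not n times an element of the lattice.\<close>

lemma special_separable:
  assumes J: "J \<subseteq> V" and t: "t \<in> V" "t \<notin> J"
  shows "\<exists>N\<in>fin_normal W. gn t \<notin> special J <#>\<^bsub>W\<^esub> N"
proof -
  obtain n where n: "n > 0" "\<not> (\<exists>z\<in>lattice. (2::real) = real n * z)" using lattice_separated[of 2] by auto
  have "gn t \<notin> special J <#>\<^bsub>W\<^esub> cong_sub n"
  proof
    assume "gn t \<in> special J <#>\<^bsub>W\<^esub> cong_sub n"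
    then obtain g h where gh: "g \<in> special J" "h \<in> cong_sub n" "gn t = g \<otimes>\<^bsub>W\<^esub> h" unfolding set_mult_def by blast
    obtain x where x: "x \<in> lists J" "g = cls x" using gh(1) unfolding special_def by blast
    obtain y where y: "y \<in> lists V" "h = cls y" using gh(2) unfolding cong_sub_def carrier_W by auto
    have xV: "x \<in> lists V" using x(1) J by auto
    have "cls [t] = cls (x @ y)" using gh(3) unfolding gn_def x(2) y(2) mult_W[OF xV y(1)] .
    moreover have "[t] \<in> lists V" "x @ y \<in> lists V" using t xV y(1) by (simp_all add: ball_Un)
    ultimately have "[t] \<doteq> x @ y" using cls_eq by blast
    then have "act [t] = act (x @ y)" by (rule act_weq)
    then have e: "refl_act t (root t) = act x (act y (root t))" by (metis act_simps(1,2,3) comp_apply id_apply)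
    have "congr n (act y (root t)) (root t)" using gh(2) root_lvec(2)[OF t(1)] unfolding y(2) cong_sub_cls[OF y(1)] by blast
    from act_congr[OF xV this] obtain z where z: "z \<in> lvec" "act x (act y (root t)) = (\<lambda>u. act x (root t) u + real n * z u)"
      unfolding congr_def by blast
    have "- root t t = root t t + real n * z t"
      using fun_cong[OF e, of t] act_support[OF x(1) t(2), of "root t"] unfolding z(2) refl_act_root_self[OF t(1)] by simp
    then have "2 = real n * (- z t)" unfolding root_def by simp
    moreover have "- z t \<in> lattice" using z(1) t(1) lattice_scale[of "z t" "-1"] unfolding lvec_def by simp
    ultimately show False using n(2) by blast
  qed
  then show ?thesis using cong_sub_fin_normal[OF n(1)] by blast
qed

end

section \<open>Splittings of Coxeter groups\<close>

context coxeter
begin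

text \<open>The steps along a word with letters in Z, weighted by the variation of f; this potential splits a C-invariant
  function f into an A-invariant and a B-invariant part.\<close>

primrec shift :: "'v set \<Rightarrow> ('v list \<Rightarrow> int) \<Rightarrow> 'v list \<Rightarrow> 'v list \<Rightarrow> int" where
  "shift Z f p [] = 0"
| "shift Z f p (v # x) = (if v \<in> Z then f p - f (p @ [v]) else 0) + shift Z f (p @ [v]) x"

lemma shift_append: "shift Z f p (x @ y) = shift Z f p x + shift Z f (p @ x) y"
  by (induction x arbitrary: p) auto

lemma shift_outside: "x \<in> lists (V - Z) \<Longrightarrow> shift Z f p x = 0"
  by (induction x arbitrary: p) auto

lemma shift_cong:
  assumes "\<And>y. f (p @ y) = f (p' @ y)" shows "shift Z f p x = shift Z f p' x"
  using assms
proof (induction x arbitrary: p p')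
  case (Cons v x)
  have "shift Z f (p @ [v]) x = shift Z f (p' @ [v]) x" by (rule Cons.IH) (use Cons.prems[of "v # _"] in simp)
  then show ?case using Cons.prems[of "[]"] Cons.prems[of "[v]"] by simp
qed simp

end

text \<open>Z is a nonempty proper union of components of the graph without J. No edge joins Z to
  the remaining vertices outside J, so W is the amalgam of the groups of V - Z and J \<union> Z over
  the finite group of J.\<close>

locale coxeter_split = coxeter V E m for V :: "'v set" and E :: "'v set set" and m :: "'v set \<Rightarrow> nat" +
  fixes J Z :: "'v set"
  assumes JV: "J \<subseteq> V" and finJ: "finite (special J)" and ZV: "Z \<subseteq> V - J" and Z_ne: "Z \<noteq> {}" and Z_proper: "Z \<noteq> V - J"
    and Z_closed: "\<And>v w. v \<in> Z \<Longrightarrow> w \<in> V - J \<Longrightarrow> {v, w} \<in> E \<Longrightarrow> w \<in> Z"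
begin

abbreviation AA where "AA \<equiv> special (V - Z)"
abbreviation BB where "BB \<equiv> special (J \<union> Z)"
abbreviation CC where "CC \<equiv> special J"

lemma sub: "V - Z \<subseteq> V" "J \<union> Z \<subseteq> V" "J \<subseteq> V - Z"
  using JV ZV by auto

lemma subgroups: "subgroup AA W" "subgroup BB W" "subgroup CC W" "CC \<subseteq> AA" "CC \<subseteq> BB"
  using special_subgroup sub JV special_mono[OF sub(3)] special_mono[of J "J \<union> Z"] by auto

lemma generated: "generate W (AA \<union> BB) = carrier W"
proof
  have c: "AA \<union> BB \<subseteq> carrier W" using special_carrier sub by auto
  show "generate W (AA \<union> BB) \<subseteq> carrier W" using W.generate_incl[OF c] .
  have "gn ` V \<subseteq> AA \<union> BB"
  proof
    fix g assume "g \<in> gn ` V"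
    then obtain v where v: "v \<in> V" "g = gn v" by blast
    show "g \<in> AA \<union> BB"
    proof (cases "v \<in> Z")
      case True
      then have "[v] \<in> lists (J \<union> Z)" by simp
      then show ?thesis unfolding v(2) gn_def special_def by blast
    next
      case False
      then have "[v] \<in> lists (V - Z)" using v by simp
      then show ?thesis unfolding v(2) gn_def special_def by blast
    qed
  qed
  then have "generate W (gn ` V) \<subseteq> generate W (AA \<union> BB)" by (rule W.mono_generate)
  then show "carrier W \<subseteq> generate W (AA \<union> BB)" unfolding special_generate[OF order_refl] special_V .
qed

context
  fixes f :: "'v list set \<Rightarrow> int"
  assumes fC: "W.right_inv CC f"
begin

abbreviation fw where "fw \<equiv> \<lambda>x. f (cls x)"

lemma fw_weq: "x \<doteq> y \<Longrightarrow> fw x = fw y"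
  using weq_cls by simp

lemma fw_J: "p \<in> lists V \<Longrightarrow> u \<in> lists J \<Longrightarrow> fw (p @ u) = fw p"
proof -
  assume p: "p \<in> lists V" and u: "u \<in> lists J"
  have "u \<in> lists V" using u JV by auto
  then have "cls (p @ u) = cls p \<otimes>\<^bsub>W\<^esub> cls u" using p mult_W by simp
  moreover have "cls u \<in> CC" "cls p \<in> carrier W" using u p unfolding special_def carrier_W by blast+
  ultimately show ?thesis using fC unfolding W.right_inv_def by simp
qed

text \<open>The sum telescopes, because steps in Z are counted and steps in J do not change
  f.\<close>

lemma shift_inside: "x \<in> lists (J \<union> Z) \<Longrightarrow> p \<in> lists V \<Longrightarrow> shift Z fw p x = fw p - fw (p @ x)"
proof (induction x arbitrary: p)
  case (Cons v x)
  have v: "v \<in> J \<union> Z" "v \<in> V" using Cons.prems(1) sub by auto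
  have pv: "p @ [v] \<in> lists V" using Cons.prems v by (simp add: ball_Un)
  have "shift Z fw (p @ [v]) x = fw (p @ [v]) - fw ((p @ [v]) @ x)" by (rule Cons.IH[OF _ pv]) (use Cons.prems in simp)
  moreover have "v \<notin> Z \<Longrightarrow> fw (p @ [v]) = fw p" using fw_J[OF Cons.prems(2), of "[v]"] v by simp
  ultimately show ?case by simp
qed simp

text \<open>Each relator has its letters in one of the two vertex groups. On the side of V - Z
  nothing is counted; on the side of J \<union> Z the sum telescopes between equal values of
  f.\<close>

lemma shift_rel:
  assumes r: "r \<in> R" and p: "p \<in> lists V" shows "shift Z fw p r = 0"
proof -
  have pr: "p @ r \<doteq> p" using word_eq.rel[OF r, of p "[]"] by simp
  have "r \<in> lists (V - Z) \<or> r \<in> lists (J \<union> Z)"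
    using r
  proof (cases rule: relE)
    case (sq v)
    then show ?thesis by auto
  next
    case (br v w)
    have "{w, v} \<in> E" using br by (simp add: insert_commute)
    then have "(v \<notin> Z \<and> w \<notin> Z) \<or> (v \<in> J \<union> Z \<and> w \<in> J \<union> Z)" using Z_closed[of v w] Z_closed[of w v] br ZV by auto
    then show ?thesis unfolding br(5)
    proof
      assume "v \<notin> Z \<and> w \<notin> Z"
      then show "concat (replicate (m {v, w}) [v, w]) \<in> lists (V - Z) \<or> concat (replicate (m {v, w}) [v, w]) \<in> lists (J \<union> Z)"
        using alternating_lists[of v "V - Z" w] br(3,4) by blast
    next
      assume "v \<in> J \<union> Z \<and> w \<in> J \<union> Z"
      then show "concat (replicate (m {v, w}) [v, w]) \<in> lists (V - Z) \<or> concat (replicate (m {v, w}) [v, w]) \<in> lists (J \<union> Z)"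
        using alternating_lists[of v "J \<union> Z" w] by blast
    qed
  qed
  then show ?thesis using shift_outside shift_inside[OF _ p] fw_weq[OF pr] by auto
qed

lemma shift_weq:
  assumes "x \<doteq> y" "x \<in> lists V" "p \<in> lists V" shows "shift Z fw p x = shift Z fw p y"
  using assms(1,2)
proof (induction rule: word_eq.induct)
  case (sym x y)
  then show ?case using weq_lists by simp
next
  case (trans x y z)
  then show ?case using weq_lists by metis
next
  case (rel r u w)
  have pu: "p @ u \<in> lists V" using assms(3) rel(2) by (simp add: ball_Un)
  have "p @ u @ r @ y \<doteq> p @ u @ y" for y using word_eq.rel[OF rel(1), of "p @ u" y] by simp
  then have "shift Z fw ((p @ u) @ r) w = shift Z fw (p @ u) w" by (intro shift_cong) (simp add: fw_weq)
  then show ?case using shift_rel[OF rel(1) pu] by (simp add: shift_append)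
qed simp

text \<open>The potential F as a function on the group. F turns out right invariant under
  \<open>AA\<close> and F + f under \<open>BB\<close>, so f is the difference of -F and -(F +
  f).\<close>

definition shg :: "'v list set \<Rightarrow> int" where "shg g = shift Z fw [] (rep g)"

lemma shg_cls: "x \<in> lists V \<Longrightarrow> shg (cls x) = shift Z fw [] x"
  unfolding shg_def using rep_cls shift_weq[of x "rep (cls x)" "[]"] by simp

lemma shg_diff:
  assumes "x \<in> lists V" "w \<in> lists V"
  shows "shg (cls x \<otimes>\<^bsub>W\<^esub> cls w) - shg (cls x) = shift Z fw x w"
proof -
  have "x @ w \<in> lists V" using assms by (simp add: ball_Un)
  then show ?thesis unfolding mult_W[OF assms] by (simp add: shg_cls assms(1) shift_append)
qed

lemma shg_A: "W.right_inv AA shg"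
  unfolding W.right_inv_def
proof (intro ballI)
  fix g h assume "g \<in> carrier W" "h \<in> AA"
  then obtain x w where xw: "x \<in> lists V" "g = cls x" "w \<in> lists (V - Z)" "h = cls w" unfolding carrier_W special_def by auto
  then have "w \<in> lists V" by auto
  then show "shg (g \<otimes>\<^bsub>W\<^esub> h) = shg g" using shg_diff[OF xw(1), of w] shift_outside[OF xw(3)] xw by simp
qed

lemma shg_B: "W.right_inv BB (\<lambda>g. shg g + f g)"
  unfolding W.right_inv_def
proof (intro ballI)
  fix g h assume "g \<in> carrier W" "h \<in> BB"
  then obtain x w where xw: "x \<in> lists V" "g = cls x" "w \<in> lists (J \<union> Z)" "h = cls w" unfolding carrier_W special_def by auto
  then have w: "w \<in> lists V" using sub(2) by auto
  show "shg (g \<otimes>\<^bsub>W\<^esub> h) + f (g \<otimes>\<^bsub>W\<^esub> h) = shg g + f g"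
    using shg_diff[OF xw(1) w] shift_inside[OF xw(3,1)] mult_W[OF xw(1) w] xw by simp
qed

text \<open>F itself need not be invariant under N, but its increments depend only on the values of
  f along a path, and f is also left N-invariant because N is normal.\<close>

lemma shg_left:
  assumes N: "N \<lhd> W" "W.right_inv N f" and n: "n \<in> N" and g: "g \<in> carrier W" and h: "h \<in> carrier W"
  shows "shg (n \<otimes>\<^bsub>W\<^esub> g \<otimes>\<^bsub>W\<^esub> h) - shg (n \<otimes>\<^bsub>W\<^esub> g) = shg (g \<otimes>\<^bsub>W\<^esub> h) - shg g"
proof -
  have nc: "n \<in> carrier W" using subgroup.mem_carrier[OF normal_imp_subgroup[OF N(1)] n] .
  obtain u where u: "u \<in> lists V" "n = cls u" using nc unfolding carrier_W by auto
  obtain x where x: "x \<in> lists V" "g = cls x" using g unfolding carrier_W by auto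
  obtain w where w: "w \<in> lists V" "h = cls w" using h unfolding carrier_W by auto
  have left: "f (n \<otimes>\<^bsub>W\<^esub> k) = f k" if k: "k \<in> carrier W" for k
  proof -
    have "inv\<^bsub>W\<^esub> k \<otimes>\<^bsub>W\<^esub> n \<otimes>\<^bsub>W\<^esub> k \<in> N" by (rule normal.inv_op_closed1[OF N(1) k n])
    then have "f (k \<otimes>\<^bsub>W\<^esub> (inv\<^bsub>W\<^esub> k \<otimes>\<^bsub>W\<^esub> n \<otimes>\<^bsub>W\<^esub> k)) = f k" using N(2) k unfolding W.right_inv_def by blast
    moreover have "k \<otimes>\<^bsub>W\<^esub> (inv\<^bsub>W\<^esub> k \<otimes>\<^bsub>W\<^esub> n \<otimes>\<^bsub>W\<^esub> k) = n \<otimes>\<^bsub>W\<^esub> k" using k nc by (simp add: W.m_assoc[symmetric])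
    ultimately show ?thesis by simp
  qed
  have ux: "u @ x \<in> lists V" using u x by (simp add: ball_Un)
  have "shift Z fw (u @ x) w' = shift Z fw x w'" if "w' \<in> lists V" for w'
    using x(1) ux that
  proof (induction w' arbitrary: x)
    case (Cons v w')
    have v: "v \<in> V" using Cons.prems by simp
    have l: "x @ [v] \<in> lists V" "u @ x @ [v] \<in> lists V" using Cons.prems v by (simp_all add: ball_Un)
    have "fw (u @ x) = fw x" "fw (u @ x @ [v]) = fw (x @ [v])"
      using left[of "cls x"] left[of "cls (x @ [v])"] Cons.prems(1) l(1) mult_W[OF u(1), of x] mult_W[OF u(1) l(1)] unfolding u(2) carrier_W by auto
    moreover have "shift Z fw (u @ x @ [v]) w' = shift Z fw (x @ [v]) w'" using Cons.IH[OF l(1)] l(2) Cons.prems(3) by simp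
    ultimately show ?case by simp
  qed simp
  then show ?thesis using shg_diff[OF ux w(1)] shg_diff[OF x(1) w(1)] w(1) mult_W[OF u(1) x(1)] u(2) x(2) w(2) by simp
qed

end

text \<open>The integer potential F need not factor through a finite quotient. Its increments F (x
  w) - F x depend only on w and on the coset of x modulo N, so modulo p there are finitely many
  possibilities for them; the elements of N with zero increments modulo p form a normal subgroup of
  finite index.\<close>

lemma periodic_splitting:
  assumes p: "0 < (p::nat)" and N: "N \<in> fin_normal W" and f: "W.level_fun CC N (f :: 'v list set \<Rightarrow> int)"
  shows "\<exists>M\<in>fin_normal W. \<exists>gA gB. W.level_fun AA M gA \<and> W.level_fun BB M gB \<and> (\<forall>x\<in>carrier W. [f x = gA x - gB x] (mod int p))"
proof -
  have fC: "W.right_inv CC f" and fN: "W.right_inv N f" using f unfolding W.level_fun_def by auto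
  note Nn = W.fin_normal_normal[OF N]
  note Ns = normal_imp_subgroup[OF Nn]
  define F where "F = shg f"
  note FA = shg_A[OF fC, folded F_def] and FB = shg_B[OF fC, folded F_def] and Fl = shg_left[OF fC Nn fN, folded F_def]
  define M where "M = {n \<in> N. \<forall>x\<in>carrier W. [F (x \<otimes>\<^bsub>W\<^esub> n) = F x] (mod int p)}"
  have MN: "M \<subseteq> N" unfolding M_def by blast
  have Nc: "n \<in> carrier W" if "n \<in> N" for n using subgroup.mem_carrier[OF Ns that] .
  have Mc: "n \<in> carrier W" if "n \<in> M" for n using that MN Nc by blast
  have Ms: "subgroup M W"
  proof
    show "M \<subseteq> carrier W" using Mc by blast
    show "\<one>\<^bsub>W\<^esub> \<in> M" unfolding M_def using subgroup.one_closed[OF Ns] by simp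
    fix n assume n: "n \<in> M"
    have nN: "n \<in> N" and nF: "\<And>x. x \<in> carrier W \<Longrightarrow> [F (x \<otimes>\<^bsub>W\<^esub> n) = F x] (mod int p)" using n unfolding M_def by auto
    have "[F (x \<otimes>\<^bsub>W\<^esub> inv\<^bsub>W\<^esub> n) = F x] (mod int p)" if x: "x \<in> carrier W" for x
    proof -
      have "[F (x \<otimes>\<^bsub>W\<^esub> inv\<^bsub>W\<^esub> n \<otimes>\<^bsub>W\<^esub> n) = F (x \<otimes>\<^bsub>W\<^esub> inv\<^bsub>W\<^esub> n)] (mod int p)" using x Mc[OF n] by (intro nF) simp
      then show ?thesis using x Mc[OF n] by (simp add: W.m_assoc cong_sym_eq)
    qed
    then show "inv\<^bsub>W\<^esub> n \<in> M" unfolding M_def using subgroup.m_inv_closed[OF Ns nN] by blast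
    fix k assume k: "k \<in> M"
    have kF: "\<And>x. x \<in> carrier W \<Longrightarrow> [F (x \<otimes>\<^bsub>W\<^esub> k) = F x] (mod int p)" using k unfolding M_def by auto
    have "[F (x \<otimes>\<^bsub>W\<^esub> (n \<otimes>\<^bsub>W\<^esub> k)) = F x] (mod int p)" if x: "x \<in> carrier W" for x
      using cong_trans[OF kF[of "x \<otimes>\<^bsub>W\<^esub> n"] nF[OF x]] x Mc[OF n] Mc[OF k] by (simp add: W.m_assoc)
    then show "n \<otimes>\<^bsub>W\<^esub> k \<in> M" unfolding M_def using subgroup.m_closed[OF Ns nN] k MN by blast
  qed
  have Mn: "M \<lhd> W"
  proof (rule W.normal_invI[OF Ms])
    fix g n assume g: "g \<in> carrier W" and n: "n \<in> M"
    have nN: "n \<in> N" and nF: "\<And>x. x \<in> carrier W \<Longrightarrow> [F (x \<otimes>\<^bsub>W\<^esub> n) = F x] (mod int p)" using n unfolding M_def by auto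
    have nc: "n \<in> carrier W" using Mc[OF n] .
    have "[F (x \<otimes>\<^bsub>W\<^esub> (g \<otimes>\<^bsub>W\<^esub> n \<otimes>\<^bsub>W\<^esub> inv\<^bsub>W\<^esub> g)) = F x] (mod int p)" if x: "x \<in> carrier W" for x
    proof -
      define y where "y = x \<otimes>\<^bsub>W\<^esub> g"
      have yc: "y \<in> carrier W" unfolding y_def using x g by simp
      \<comment> \<open>The factor n to the right of y becomes its conjugate to the left of y, where
        \<open>shg_left\<close> applies.\<close>
      define n' where "n' = y \<otimes>\<^bsub>W\<^esub> n \<otimes>\<^bsub>W\<^esub> inv\<^bsub>W\<^esub> y"
      have n': "n' \<in> N" unfolding n'_def by (rule normal.inv_op_closed2[OF Nn yc nN])
      have yn: "n' \<otimes>\<^bsub>W\<^esub> y = y \<otimes>\<^bsub>W\<^esub> n" unfolding n'_def using yc nc by (simp add: W.m_assoc)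
      have yg: "y \<otimes>\<^bsub>W\<^esub> inv\<^bsub>W\<^esub> g = x" unfolding y_def using x g by (simp add: W.m_assoc)
      have e: "x \<otimes>\<^bsub>W\<^esub> (g \<otimes>\<^bsub>W\<^esub> n \<otimes>\<^bsub>W\<^esub> inv\<^bsub>W\<^esub> g) = y \<otimes>\<^bsub>W\<^esub> n \<otimes>\<^bsub>W\<^esub> inv\<^bsub>W\<^esub> g" unfolding y_def using x g nc by (simp add: W.m_assoc)
      have "F (y \<otimes>\<^bsub>W\<^esub> n \<otimes>\<^bsub>W\<^esub> inv\<^bsub>W\<^esub> g) = F (y \<otimes>\<^bsub>W\<^esub> n) - F y + F x"
        using Fl[OF n' yc, of "inv\<^bsub>W\<^esub> g"] g unfolding yn yg by simp
      moreover have "[F (y \<otimes>\<^bsub>W\<^esub> n) - F y + F x = F y - F y + F x] (mod int p)"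
        by (intro cong_add cong_diff nF[OF yc] cong_refl)
      ultimately show ?thesis unfolding e by simp
    qed
    moreover have "g \<otimes>\<^bsub>W\<^esub> n \<otimes>\<^bsub>W\<^esub> inv\<^bsub>W\<^esub> g \<in> N" by (rule normal.inv_op_closed2[OF Nn g nN])
    ultimately show "g \<otimes>\<^bsub>W\<^esub> n \<otimes>\<^bsub>W\<^esub> inv\<^bsub>W\<^esub> g \<in> M" unfolding M_def by blast
  qed
  define Q where "Q = carrier (W Mod N)"
  have finQ: "finite Q" using N unfolding Q_def fin_normal_def by blast
  define s where "s c = (SOME x. x \<in> carrier W \<and> c = N #>\<^bsub>W\<^esub> x)" for c
  have s: "s c \<in> carrier W \<and> c = N #>\<^bsub>W\<^esub> s c" if "c \<in> Q" for c
    unfolding s_def by (rule someI_ex) (use that in \<open>auto simp: Q_def W.rcosets_carrier\<close>)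
  \<comment> \<open>The increments at one representative of each coset of N determine all increments
    modulo p.\<close>
  define h where "h w = (N #>\<^bsub>W\<^esub> w, \<lambda>c. if c \<in> Q then (F (s c \<otimes>\<^bsub>W\<^esub> w) - F (s c)) mod int p else 0)" for w
  have Mf: "M \<in> fin_normal W"
  proof (rule W.fin_normalI[OF Mn, of h])
    have "finite {k. \<forall>c. (c \<in> Q \<longrightarrow> k c \<in> {0..<int p}) \<and> (c \<notin> Q \<longrightarrow> k c = 0)}"
      by (rule finite_set_of_finite_funs[OF finQ]) simp
    then have "finite (Q \<times> {k. \<forall>c. (c \<in> Q \<longrightarrow> k c \<in> {0..<int p}) \<and> (c \<notin> Q \<longrightarrow> k c = 0)})" using finQ by simp
    moreover have "h ` carrier W \<subseteq> Q \<times> {k. \<forall>c. (c \<in> Q \<longrightarrow> k c \<in> {0..<int p}) \<and> (c \<notin> Q \<longrightarrow> k c = 0)}"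
    proof (rule image_subsetI)
      fix w assume w: "w \<in> carrier W"
      have "N #>\<^bsub>W\<^esub> w \<in> Q" unfolding Q_def W.rcosets_carrier using w by (rule imageI)
      then show "h w \<in> Q \<times> {k. \<forall>c. (c \<in> Q \<longrightarrow> k c \<in> {0..<int p}) \<and> (c \<notin> Q \<longrightarrow> k c = 0)}"
        unfolding h_def using p by simp
    qed
    ultimately show "finite (h ` carrier W)" by (rule finite_subset[rotated])
  next
    fix w w' assume w: "w \<in> carrier W" and w': "w' \<in> carrier W" and he: "h w = h w'"
    have d: "w \<otimes>\<^bsub>W\<^esub> inv\<^bsub>W\<^esub> w' \<in> N" using he W.rcoset_eq_iff[OF Ns w w'] unfolding h_def by simp
    have same: "[F (x \<otimes>\<^bsub>W\<^esub> w) - F x = F (x \<otimes>\<^bsub>W\<^esub> w') - F x] (mod int p)" if x: "x \<in> carrier W" for x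
    proof -
      define c where "c = N #>\<^bsub>W\<^esub> x"
      have cQ: "c \<in> Q" unfolding c_def Q_def W.rcosets_carrier using x by blast
      have sc: "s c \<in> carrier W" "N #>\<^bsub>W\<^esub> x = N #>\<^bsub>W\<^esub> s c" using s[OF cQ] unfolding c_def by auto
      define n where "n = x \<otimes>\<^bsub>W\<^esub> inv\<^bsub>W\<^esub> (s c)"
      have n: "n \<in> N" unfolding n_def using W.rcoset_eq_iff[OF Ns x sc(1)] sc(2) by blast
      have nx: "n \<otimes>\<^bsub>W\<^esub> s c = x" unfolding n_def using x sc(1) by (simp add: W.m_assoc)
      have "[F (s c \<otimes>\<^bsub>W\<^esub> w) - F (s c) = F (s c \<otimes>\<^bsub>W\<^esub> w') - F (s c)] (mod int p)"
        using fun_cong[OF arg_cong[OF he, of snd], of c] cQ unfolding h_def cong_def by simp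
      then show ?thesis using Fl[OF n sc(1) w] Fl[OF n sc(1) w'] unfolding nx by simp
    qed
    have "[F (x \<otimes>\<^bsub>W\<^esub> (w \<otimes>\<^bsub>W\<^esub> inv\<^bsub>W\<^esub> w')) = F x] (mod int p)" if x: "x \<in> carrier W" for x
    proof -
      define y where "y = x \<otimes>\<^bsub>W\<^esub> w'"
      have yc: "y \<in> carrier W" unfolding y_def using x w' by simp
      define n where "n = x \<otimes>\<^bsub>W\<^esub> (w \<otimes>\<^bsub>W\<^esub> inv\<^bsub>W\<^esub> w') \<otimes>\<^bsub>W\<^esub> inv\<^bsub>W\<^esub> x"
      have n: "n \<in> N" unfolding n_def by (rule normal.inv_op_closed2[OF Nn x d])
      have ny: "n \<otimes>\<^bsub>W\<^esub> y = x \<otimes>\<^bsub>W\<^esub> w" unfolding n_def y_def using x w w' by (simp add: W.m_assoc) (simp add: W.m_assoc[symmetric])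
      have yw: "y \<otimes>\<^bsub>W\<^esub> inv\<^bsub>W\<^esub> w' = x" unfolding y_def using x w' by (simp add: W.m_assoc)
      have "F (x \<otimes>\<^bsub>W\<^esub> (w \<otimes>\<^bsub>W\<^esub> inv\<^bsub>W\<^esub> w')) = F (x \<otimes>\<^bsub>W\<^esub> w \<otimes>\<^bsub>W\<^esub> inv\<^bsub>W\<^esub> w')" using x w w' by (simp add: W.m_assoc)
      also have "\<dots> = F (x \<otimes>\<^bsub>W\<^esub> w) + F x - F y"
        using Fl[OF n yc, of "inv\<^bsub>W\<^esub> w'"] w' unfolding ny yw by simp
      finally have e: "F (x \<otimes>\<^bsub>W\<^esub> (w \<otimes>\<^bsub>W\<^esub> inv\<^bsub>W\<^esub> w')) - F x = (F (x \<otimes>\<^bsub>W\<^esub> w) - F x) - (F (x \<otimes>\<^bsub>W\<^esub> w') - F x)" unfolding y_def by simp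
      show ?thesis unfolding cong_iff_dvd_diff e using same[OF x] unfolding cong_iff_dvd_diff .
    qed
    then show "w \<otimes>\<^bsub>W\<^esub> inv\<^bsub>W\<^esub> w' \<in> M" unfolding M_def using d by blast
  qed
  \<comment> \<open>Taking residues turns invariance modulo p into invariance.\<close>
  define gA where "gA x = (- F x) mod int p" for x
  define gB where "gB x = (- (F x + f x)) mod int p" for x
  have MF: "[F (x \<otimes>\<^bsub>W\<^esub> n) = F x] (mod int p)" "f (x \<otimes>\<^bsub>W\<^esub> n) = f x" if "x \<in> carrier W" "n \<in> M" for x n
    using that fN MN unfolding M_def W.right_inv_def by auto
  have "W.level_fun AA M gA" unfolding W.level_fun_def
  proof
    show "W.right_inv AA gA" using FA unfolding gA_def W.right_inv_def by simp
    show "W.right_inv M gA" unfolding gA_def W.right_inv_def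
    proof (intro ballI)
      fix x n assume xn: "x \<in> carrier W" "n \<in> M"
      have "[- F (x \<otimes>\<^bsub>W\<^esub> n) = - F x] (mod int p)" unfolding cong_minus_minus_iff by (rule MF(1)[OF xn])
      then show "- F (x \<otimes>\<^bsub>W\<^esub> n) mod int p = - F x mod int p" unfolding cong_def .
    qed
  qed
  moreover have "W.level_fun BB M gB" unfolding W.level_fun_def
  proof
    show "W.right_inv BB gB" using FB unfolding gB_def W.right_inv_def by simp
    show "W.right_inv M gB" unfolding gB_def W.right_inv_def
    proof (intro ballI)
      fix x n assume xn: "x \<in> carrier W" "n \<in> M"
      have "[- (F (x \<otimes>\<^bsub>W\<^esub> n) + f x) = - (F x + f x)] (mod int p)"
        unfolding cong_minus_minus_iff by (intro cong_add MF(1)[OF xn] cong_refl)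
      then show "- (F (x \<otimes>\<^bsub>W\<^esub> n) + f (x \<otimes>\<^bsub>W\<^esub> n)) mod int p = - (F x + f x) mod int p" unfolding cong_def MF(2)[OF xn] .
    qed
  qed
  moreover have "[f x = gA x - gB x] (mod int p)" for x
    unfolding gA_def gB_def cong_def by (simp add: mod_diff_eq)
  ultimately show ?thesis using Mf by blast
qed

lemma gn_notin_special: "I \<subseteq> V \<Longrightarrow> t \<in> V \<Longrightarrow> t \<notin> I \<Longrightarrow> gn t \<notin> special I"
proof
  assume I: "I \<subseteq> V" and t: "t \<in> V" "t \<notin> I" and g: "gn t \<in> special I"
  obtain N where N: "N \<in> fin_normal W" "gn t \<notin> special I <#>\<^bsub>W\<^esub> N" using special_separable[OF I t] by blast
  have "special I \<subseteq> special I <#>\<^bsub>W\<^esub> N"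
    by (rule W.subset_setmult(1)[OF special_subgroup[OF I] normal_imp_subgroup[OF W.fin_normal_normal[OF N(1)]]])
  then show False using g N(2) by blast
qed

text \<open>The sides are read off from the potential F of the indicator f of the edge group, which
  vanishes on that group: S is given by F odd, T by F + f even. The right invariances of F and F + f
  become those of S and T; only parities are used.\<close>

theorem splits: "\<exists>S T. finite_splitting W AA BB CC S T"
proof -
  define f where "f g = (of_bool (g \<in> CC) :: int)" for g
  have fC: "W.right_inv CC f" unfolding W.right_inv_def f_def
  proof (intro ballI)
    fix x y assume x: "x \<in> carrier W" and y: "y \<in> CC"
    have yc: "y \<in> carrier W" using y special_carrier[OF JV] by blast
    have "x \<otimes>\<^bsub>W\<^esub> y \<in> CC \<longleftrightarrow> x \<in> CC"
    proof
      assume "x \<otimes>\<^bsub>W\<^esub> y \<in> CC"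
      then have "x \<otimes>\<^bsub>W\<^esub> y \<otimes>\<^bsub>W\<^esub> inv\<^bsub>W\<^esub> y \<in> CC" by (rule subgroup.m_closed[OF subgroups(3) _ subgroup.m_inv_closed[OF subgroups(3) y]])
      then show "x \<in> CC" using x yc by (simp add: W.m_assoc)
    next
      assume "x \<in> CC"
      then show "x \<otimes>\<^bsub>W\<^esub> y \<in> CC" by (rule subgroup.m_closed[OF subgroups(3) _ y])
    qed
    then show "of_bool (x \<otimes>\<^bsub>W\<^esub> y \<in> CC) = (of_bool (x \<in> CC) :: int)" by simp
  qed
  define F where "F = shg f"
  have FA: "F (x \<otimes>\<^bsub>W\<^esub> a) = F x" if "x \<in> carrier W" "a \<in> AA" for x a
    using shg_A[OF fC] that unfolding F_def W.right_inv_def by blast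
  have FB: "F (x \<otimes>\<^bsub>W\<^esub> b) + f (x \<otimes>\<^bsub>W\<^esub> b) = F x + f x" if "x \<in> carrier W" "b \<in> BB" for x b
    using shg_B[OF fC] that unfolding F_def W.right_inv_def by blast
  have F1: "F \<one>\<^bsub>W\<^esub> = 0" unfolding F_def one_W using shg_cls[OF fC, of "[]"] by simp
  have FC: "F x = 0" if x: "x \<in> CC" for x
  proof -
    have "x \<in> carrier W" "x \<in> AA" using x special_carrier[OF JV] subgroups(4) by auto
    then show ?thesis using FA[of "\<one>\<^bsub>W\<^esub>" x] F1 by simp
  qed
  define S where "S = {g \<in> carrier W. odd (F g)}"
  define T where "T = {g \<in> carrier W. even (F g + f g)}"
  have cC: "CC \<subseteq> carrier W" "AA \<subseteq> carrier W" "BB \<subseteq> carrier W" using special_carrier JV sub by auto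
  have "finite_splitting W AA BB CC S T"
  proof (intro finite_splitting.intro finite_splitting_axioms.intro)
    show "group W" by (rule group_W)
    show "carrier W = S \<union> CC \<union> T"
    proof
      show "carrier W \<subseteq> S \<union> CC \<union> T" unfolding S_def T_def f_def by auto
      show "S \<union> CC \<union> T \<subseteq> carrier W" unfolding S_def T_def using cC by auto
    qed
    show "S \<inter> CC = {}" unfolding S_def using FC by auto
    show "T \<inter> CC = {}" unfolding T_def f_def using FC by auto
    show "S \<inter> T = {}" unfolding S_def T_def f_def using FC by auto
    show "x \<otimes>\<^bsub>W\<^esub> a \<in> S" if "x \<in> S" "a \<in> AA" for x a using that FA[of x a] cC unfolding S_def by auto
    show "x \<otimes>\<^bsub>W\<^esub> b \<in> T" if xb: "x \<in> T" "b \<in> BB" for x b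
    proof -
      have "x \<in> carrier W" "b \<in> carrier W" "even (F x + f x)" using xb cC unfolding T_def by auto
      then show ?thesis unfolding T_def mem_Collect_eq FB[OF \<open>x \<in> carrier W\<close> xb(2)] by simp
    qed
    obtain t where t: "t \<in> V - J" "t \<notin> Z" using Z_proper ZV by blast
    have "[t] \<in> lists (V - Z)" using t by simp
    then have "gn t \<in> AA" unfolding gn_def special_def by blast
    moreover have "gn t \<notin> CC" using gn_notin_special[OF JV] t by blast
    ultimately show "AA \<noteq> CC" by blast
    obtain u where u: "u \<in> Z" using Z_ne by blast
    then have "[u] \<in> lists (J \<union> Z)" by simp
    then have "gn u \<in> BB" unfolding gn_def special_def by blast
    moreover have "gn u \<notin> CC" using gn_notin_special[OF JV] u ZV by blast
    ultimately show "BB \<noteq> CC" by blast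
    show "subgroup AA W" "subgroup BB W" "subgroup CC W" "CC \<subseteq> AA" "CC \<subseteq> BB" by (fact subgroups)+
    show "finite CC" by (fact finJ)
    show "generate W (AA \<union> BB) = carrier W" by (fact generated)
  qed
  then show ?thesis by (intro exI)
qed

lemma not_dense: "\<exists>N\<in>fin_normal W. AA <#>\<^bsub>W\<^esub> N \<noteq> carrier W" "\<exists>N\<in>fin_normal W. BB <#>\<^bsub>W\<^esub> N \<noteq> carrier W"
proof -
  obtain t where t: "t \<in> V - J" "t \<notin> Z" using Z_proper ZV by blast
  obtain u where u: "u \<in> Z" using Z_ne by blast
  show "\<exists>N\<in>fin_normal W. AA <#>\<^bsub>W\<^esub> N \<noteq> carrier W"
    using special_separable[OF sub(1), of u] gn_carrier[of u] u ZV by blast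
  show "\<exists>N\<in>fin_normal W. BB <#>\<^bsub>W\<^esub> N \<noteq> carrier W"
    using special_separable[OF sub(2), of t] gn_carrier[of t] t by blast
qed

end

section \<open>Profinite invariants\<close>

lemma enat_leI:
  assumes "\<And>n. enat n \<le> a \<Longrightarrow> enat n \<le> b" shows "a \<le> b"
proof (cases b)
  case (enat k)
  show ?thesis
  proof (rule ccontr)
    assume "\<not> a \<le> b"
    then have "enat (Suc k) \<le> a" unfolding enat by (simp add: Suc_ile_eq)
    then show False using assms[of "Suc k"] enat by simp
  qed
qed simp

text \<open>Evaluating the dense homomorphism at N shows that every finite quotient of G is a
  quotient of H, which suffices for finiteness and for laws.\<close>

lemma profinite_iso_quotient_hom:
  assumes G: "group G" and H: "group H" and iso: "profinite_iso H G" and N: "N \<in> fin_normal G"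
  shows "\<exists>h. h \<in> hom H (G Mod N) \<and> h ` carrier H = carrier (G Mod N)"
proof -
  interpret G: group G by (rule G)
  obtain \<sigma> where hom: "\<sigma> \<in> hom H G.Ghat"
    and dense: "\<And>N c. N \<in> fin_normal G \<Longrightarrow> c \<in> carrier (G Mod N) \<Longrightarrow> \<exists>h\<in>carrier H. \<sigma> h N = c"
    by (rule profinite_iso_dense[OF G H iso]) (rule that)
  have c: "\<sigma> x \<in> carrier G.Ghat" if "x \<in> carrier H" for x using hom that unfolding hom_def by blast
  have "(\<lambda>x. \<sigma> x N) \<in> hom H (G Mod N)"
  proof (rule homI)
    fix x y assume xy: "x \<in> carrier H" "y \<in> carrier H"
    show "\<sigma> x N \<in> carrier (G Mod N)" by (rule G.hat_eval[OF c[OF xy(1)] N])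
    have "\<sigma> (x \<otimes>\<^bsub>H\<^esub> y) = \<sigma> x \<otimes>\<^bsub>G.Ghat\<^esub> \<sigma> y" by (rule hom_mult[OF hom xy])
    then show "\<sigma> (x \<otimes>\<^bsub>H\<^esub> y) N = \<sigma> x N \<otimes>\<^bsub>G Mod N\<^esub> \<sigma> y N" using G.hat_mult[OF N] by simp
  qed
  moreover have "(\<lambda>x. \<sigma> x N) ` carrier H = carrier (G Mod N)"
  proof
    show "(\<lambda>x. \<sigma> x N) ` carrier H \<subseteq> carrier (G Mod N)" using G.hat_eval[OF c N] by blast
    show "carrier (G Mod N) \<subseteq> (\<lambda>x. \<sigma> x N) ` carrier H" using dense[OF N] by blast
  qed
  ultimately show ?thesis by blast
qed

text \<open>If G were infinite, some finite quotient would separate more of its elements than H has,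
  but that quotient is an image of H.\<close>

lemma profinite_iso_finite:
  assumes G: "group G" and H: "group H" and iso: "profinite_iso H G" and rf: "group.residually_finite G" and fin: "finite (carrier H)"
  shows "finite (carrier G)"
proof (rule ccontr)
  interpret G: group G by (rule G)
  assume "infinite (carrier G)"
  then obtain F where F: "F \<subseteq> carrier G" "finite F" "card F = Suc (card (carrier H))"
    using infinite_arbitrarily_large by blast
  define D where "D = (\<lambda>(x, y). x \<otimes>\<^bsub>G\<^esub> inv\<^bsub>G\<^esub> y) ` (F \<times> F) - {\<one>\<^bsub>G\<^esub>}"
  have "finite D" unfolding D_def using F(2) by simp
  moreover have "D \<subseteq> carrier G - {\<one>\<^bsub>G\<^esub>}" unfolding D_def using F(1) by auto
  ultimately obtain N where N: "N \<in> fin_normal G" "D \<inter> N = {}" using G.residually_finite_avoid[OF rf] by blast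
  note Ns = normal_imp_subgroup[OF G.fin_normal_normal[OF N(1)]]
  have "inj_on (\<lambda>x. N #>\<^bsub>G\<^esub> x) F"
  proof (rule inj_onI)
    fix x y assume xy: "x \<in> F" "y \<in> F" "N #>\<^bsub>G\<^esub> x = N #>\<^bsub>G\<^esub> y"
    have xyc: "x \<in> carrier G" "y \<in> carrier G" using xy F(1) by auto
    have "x \<otimes>\<^bsub>G\<^esub> inv\<^bsub>G\<^esub> y \<in> N" using G.rcoset_eq_iff[OF Ns xyc] xy(3) by blast
    then have "x \<otimes>\<^bsub>G\<^esub> inv\<^bsub>G\<^esub> y = \<one>\<^bsub>G\<^esub>" using N(2) xy(1,2) unfolding D_def by blast
    then show "x = y" using xyc by (metis G.inv_closed G.inv_equality G.inv_inv)
  qed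
  moreover have "(\<lambda>x. N #>\<^bsub>G\<^esub> x) ` F \<subseteq> carrier (G Mod N)" unfolding G.rcosets_carrier using F(1) by blast
  moreover have "finite (carrier (G Mod N))" using N(1) unfolding fin_normal_def by blast
  ultimately have "card F \<le> card (carrier (G Mod N))" by (rule card_inj_on_le)
  moreover obtain h where "h ` carrier H = carrier (G Mod N)" using profinite_iso_quotient_hom[OF G H iso N(1)] by blast
  then have "card (carrier (G Mod N)) \<le> card (carrier H)" using card_image_le[OF fin, of h] by simp
  ultimately show False using F(3) by simp
qed

text \<open>A failure of the law in G persists in some finite quotient by residual finiteness, and
  this quotient is an image of H, where the law holds.\<close>

lemma profinite_iso_powers_commute:
  assumes G: "group G" and H: "group H" and iso: "profinite_iso H G" and rf: "group.residually_finite G" and pc: "group.powers_commute H k"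
  shows "group.powers_commute G k"
proof -
  interpret G: group G by (rule G)
  interpret H: group H by (rule H)
  show ?thesis unfolding G.powers_commute_def
  proof (intro ballI, rule ccontr)
    fix x y assume x: "x \<in> carrier G" and y: "y \<in> carrier G" and ne: "x [^]\<^bsub>G\<^esub> k \<otimes>\<^bsub>G\<^esub> y [^]\<^bsub>G\<^esub> k \<noteq> y [^]\<^bsub>G\<^esub> k \<otimes>\<^bsub>G\<^esub> x [^]\<^bsub>G\<^esub> k"
    define u where "u = x [^]\<^bsub>G\<^esub> k \<otimes>\<^bsub>G\<^esub> y [^]\<^bsub>G\<^esub> k"
    define v where "v = y [^]\<^bsub>G\<^esub> k \<otimes>\<^bsub>G\<^esub> x [^]\<^bsub>G\<^esub> k"
    have uv: "u \<in> carrier G" "v \<in> carrier G" "u \<noteq> v" unfolding u_def v_def using x y ne by auto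
    then have "u \<otimes>\<^bsub>G\<^esub> inv\<^bsub>G\<^esub> v \<noteq> \<one>\<^bsub>G\<^esub>" by (metis G.inv_closed G.inv_equality G.inv_inv)
    then obtain N where N: "N \<in> fin_normal G" "u \<otimes>\<^bsub>G\<^esub> inv\<^bsub>G\<^esub> v \<notin> N" using rf uv unfolding G.residually_finite_def by auto
    note Nn = G.fin_normal_normal[OF N(1)]
    obtain h where h: "h \<in> hom H (G Mod N)" "h ` carrier H = carrier (G Mod N)" using profinite_iso_quotient_hom[OF G H iso N(1)] by blast
    interpret h: group_hom H "G Mod N" h by (intro group_hom.intro H G.Mod_group[OF N(1)] group_hom_axioms.intro h(1))
    interpret q: group_hom G "G Mod N" "\<lambda>x. N #>\<^bsub>G\<^esub> x"
      by (intro group_hom.intro G G.Mod_group[OF N(1)] group_hom_axioms.intro normal.r_coset_hom_Mod[OF Nn])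
    have "N #>\<^bsub>G\<^esub> x \<in> h ` carrier H" "N #>\<^bsub>G\<^esub> y \<in> h ` carrier H" unfolding h(2) using x y by simp_all
    then obtain a b where ab: "a \<in> carrier H" "h a = N #>\<^bsub>G\<^esub> x" "b \<in> carrier H" "h b = N #>\<^bsub>G\<^esub> y" by (metis imageE)
    have "h (a [^]\<^bsub>H\<^esub> k \<otimes>\<^bsub>H\<^esub> b [^]\<^bsub>H\<^esub> k) = h (b [^]\<^bsub>H\<^esub> k \<otimes>\<^bsub>H\<^esub> a [^]\<^bsub>H\<^esub> k)" using pc ab unfolding H.powers_commute_def by simp
    then have "N #>\<^bsub>G\<^esub> u = N #>\<^bsub>G\<^esub> v" unfolding u_def v_def using ab x y by (simp add: h.hom_nat_pow q.hom_nat_pow)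
    then show False using G.rcoset_eq_iff[OF normal_imp_subgroup[OF Nn] uv(1,2)] N(2) by blast
  qed
qed

context coxeter
begin

text \<open>J may be empty, which covers disconnected graphs; J = V never qualifies, since the empty
  graph counts as connected.\<close>

definition separated :: bool where
  "separated \<longleftrightarrow> (\<exists>J\<subseteq>V. finite (special J) \<and> \<not> connected_in adj (V - J))"

lemma separatedE:
  assumes separated obtains J Z where "coxeter_split V E m J Z"
proof -
  obtain J where J: "J \<subseteq> V" "finite (special J)" "\<not> connected_in adj (V - J)" using assms unfolding separated_def by blast
  obtain Z where "Z \<subseteq> V - J" "Z \<noteq> {}" "\<forall>v\<in>Z. \<forall>w\<in>V - J. {v, w} \<in> E \<longrightarrow> w \<in> Z" "Z \<noteq> V - J"
    using J(3) unfolding connected_in_def by blast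
  then have "coxeter_split V E m J Z" 
    by (intro coxeter_split.intro coxeter_axioms coxeter_split_axioms.intro J) auto
  then show ?thesis by (rule that)
qed

lemma ends_iff: "enat n \<le> group_ends W \<longleftrightarrow> W.many_ends n"
proof (rule W.group_ends_ge_iff)
  show "\<exists>S. finite S \<and> S \<subseteq> carrier W \<and> generate W S = carrier W"
    using finV gn_carrier special_generate[OF order_refl] special_V by (intro exI[of _ "gn ` V"]) auto
qed

lemma separated_ends:
  assumes separated
  shows "infinite (carrier W)" "W.many_ends n \<longleftrightarrow> n \<le> 2 \<or> \<not> (\<exists>k>0. W.powers_commute k)"
proof -
  obtain J Z where "coxeter_split V E m J Z" using assms by (rule separatedE)
  then obtain S T where st: "finite_splitting W (special (V - Z)) (special (J \<union> Z)) (special J) S T" using coxeter_split.splits by blast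
  show "infinite (carrier W)" by (rule finite_splitting.infinite_group[OF st])
  show "W.many_ends n \<longleftrightarrow> n \<le> 2 \<or> \<not> (\<exists>k>0. W.powers_commute k)" by (rule finite_splitting.splitting_ends[OF st])
qed

lemma not_separated_ends:
  assumes "\<not> separated" "infinite (carrier W)"
  shows "W.many_ends n \<longleftrightarrow> n \<le> 1"
proof
  have "\<not> W.many_ends 2" by (rule one_ended) (use assms(1) in \<open>auto simp: separated_def\<close>)
  then show "W.many_ends n \<Longrightarrow> n \<le> 1" using W.many_ends_mono[of n 2] by linarith
  show "n \<le> 1 \<Longrightarrow> W.many_ends n" using W.many_ends_mono[OF W.many_ends_1[OF assms(2)]] .
qed

end

text \<open>If W' were not separated, its generators would meet the hypotheses of
  \<open>splitting_not_profinite_iso\<close> for the splitting of W: they are involutions, edges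
  give products of finite order, and the graph stays connected after removal of any set that
  generates a finite group.\<close>

lemma separated_profinite:
  assumes C: "coxeter V E m" and D: "coxeter V' E' m'" and iso: "profinite_iso (coxeter_group V' E' m') (coxeter_group V E m)"
    and sep: "coxeter.separated V E m"
  shows "coxeter.separated V' E' m'"
proof (rule ccontr)
  assume nonsep: "\<not> coxeter.separated V' E' m'"
  interpret C: coxeter V E m by (rule C)
  interpret D: coxeter V' E' m' by (rule D)
  obtain J Z where "coxeter_split V E m J Z" using C.separatedE[OF sep] .
  then interpret S: coxeter_split V E m J Z .
  obtain NA where NA: "NA \<in> fin_normal C.W" "S.AA <#>\<^bsub>C.W\<^esub> NA \<noteq> carrier C.W" using S.not_dense(1) by blast
  obtain NB where NB: "NB \<in> fin_normal C.W" "S.BB <#>\<^bsub>C.W\<^esub> NB \<noteq> carrier C.W" using S.not_dense(2) by blast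
  have "\<not> profinite_iso D.W C.W"
  proof (rule splitting_not_profinite_iso[where s = D.gn and adj = D.adj, OF C.group_W D.group_W S.subgroups S.finJ S.generated S.periodic_splitting NA NB D.finV])
    show "D.gn ` V' \<subseteq> carrier D.W" using D.gn_carrier by blast
    show "generate D.W (D.gn ` V') = carrier D.W" unfolding D.special_generate[OF order_refl] D.special_V ..
    show "D.gn v \<otimes>\<^bsub>D.W\<^esub> D.gn v = \<one>\<^bsub>D.W\<^esub>" if "v \<in> V'" for v by (rule D.gn_invol[OF that])
    show "\<exists>n>0. (D.gn v \<otimes>\<^bsub>D.W\<^esub> D.gn w) [^]\<^bsub>D.W\<^esub> (n::nat) = \<one>\<^bsub>D.W\<^esub>" if "v \<in> V'" "w \<in> V'" "{v, w} \<in> E'" for v w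
      using D.gn_pow[OF that(3)] D.edge_label[OF that(3)] by (intro exI[of _ "m' {v, w}"]) auto
    show "group.residually_finite D.W" by (rule D.residually_finite_W)
    show "connected_in D.adj (V' - K)" if "K \<subseteq> V'" "finite (generate D.W (D.gn ` K))" for K
      using nonsep that unfolding D.separated_def D.special_generate[OF that(1)] by blast
  qed
  then show False using iso by blast
qed

theorem theorem6p11:
  fixes V :: "'v set" and E :: "'v set set" and m :: "'v set \<Rightarrow> nat"
    and V' :: "'w set" and E' :: "'w set set" and m' :: "'w set \<Rightarrow> nat"
  assumes "coxeter_graph V E m" and "coxeter_graph V' E' m'"
    and "profinite_iso (coxeter_group V E m) (coxeter_group V' E' m')"
  shows "group_ends (coxeter_group V E m) = group_ends (coxeter_group V' E' m')"
proof -
  interpret C: coxeter V E m by (rule coxeter.intro) fact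
  interpret D: coxeter V' E' m' by (rule coxeter.intro) fact
  note CD = assms(3)
  have DC: "profinite_iso D.W C.W" by (rule profinite_iso_sym[OF C.group_W D.group_W CD])
  have fin: "finite (carrier C.W) \<longleftrightarrow> finite (carrier D.W)"
    using profinite_iso_finite[OF C.group_W D.group_W DC C.residually_finite_W] 
      profinite_iso_finite[OF D.group_W C.group_W CD D.residually_finite_W] by blast
  have pc: "C.W.powers_commute k \<longleftrightarrow> D.W.powers_commute k" for k
    using profinite_iso_powers_commute[OF C.group_W D.group_W DC C.residually_finite_W] 
      profinite_iso_powers_commute[OF D.group_W C.group_W CD D.residually_finite_W] by blast
  have sep: "C.separated \<longleftrightarrow> D.separated"
    using separated_profinite[OF C.coxeter_axioms D.coxeter_axioms DC] separated_profinite[OF D.coxeter_axioms C.coxeter_axioms CD] by blast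
  \<comment> \<open>Three properties decide the number of ends: finiteness, separation and the
    existence of a commuting power law. Each has been transferred in both directions.\<close>
  have many: "C.W.many_ends n \<longleftrightarrow> D.W.many_ends n" for n
  proof (cases "finite (carrier C.W)")
    case True
    then show ?thesis using fin C.W.many_ends_finite D.W.many_ends_finite C.W.many_ends_0 D.W.many_ends_0 by metis
  next
    case inf: False
    show ?thesis
    proof (cases C.separated)
      case True
      then show ?thesis using C.separated_ends(2) D.separated_ends(2) sep pc by simp
    next
      case False
      then show ?thesis using C.not_separated_ends[OF False inf] D.not_separated_ends fin inf sep by simp
    qed
  qed
  show ?thesis
  proof (rule order_antisym)
    show "group_ends C.W \<le> group_ends D.W" by (rule enat_leI) (use many C.ends_iff D.ends_iff in auto)
    show "group_ends D.W \<le> group_ends C.W" by (rule enat_leI) (use many C.ends_iff D.ends_iff in auto)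
  qed
qed

end
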